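(* Let $X_t$ be a Lévy process on $\mathbb{R}$, $X_0=0$, with continuous density $\rho(x,t)$, $t>0$. Let $\Delta$ be a finite union of disjoint segments with $0\in\Delta$, let $L_\Delta$ be the truncated generator, and suppose the quasi-potential $B$, with kernel $\Phi(x,y)$, is regular. Then there is $s_0>0$ such that for every $0\le s<s_0$ there is in the space $L^p(\Delta)$ $(p>1)$ one and only one function $\psi(\cdot,s)$ which satisfies $$\bigl((sI-L_\Delta)f,\ \psi(\cdot,s)\bigr)_\Delta=f(0)\qquad\text{for all } f\in C_\Delta,$$ namely $$\psi(x,s)=(I+sB^{\star})^{-1}\Phi(0,x).$$ Here $(g,h)_\Delta=\int_\Delta g(x)\overline{h(x)}\,dx$, and $B^\star$ is the adjoint of $B$, i.e. $B^\star f(x)=\int_\Delta\overline{\Phi(y,x)}f(y)\,dy$.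
   Context: Lévy process: $E\{\exp[izX_t]\}=\mu(z,t)=\exp[-t\lambda(z)]$ with $\lambda(z)=\tfrac12Az^{2}-i\gamma z-\int_{-\infty}^{\infty}(e^{ixz}-1-ixz1_{[-1,1]}(x))\,d\nu(x)$, $A\ge0$, $\gamma\in\mathbb{R}$, $\int\frac{x^2}{1+x^2}d\nu(x)<\infty$. Generator: $Lf=\tfrac12Af''+\gamma f'+\int_{-\infty}^{\infty}(f(x+y)-f(x)-yf'(x)1_{[-1,1]}(y))\,d\nu(y)$. The density is $\rho(x,t)=\frac1{2\pi}\int_{-\infty}^{\infty}e^{-ixz}\mu(z,t)\,dz$, $t>0$. $\Delta=\bigcup_{k=1}^n[a_k,b_k]$ with $a_1<b_1<a_2<b_2<\dots<a_n<b_n$. $C_\Delta$ is the set of functions $g$ on $\Delta$ with $g(a_k)=g(b_k)=g'(a_k)=g'(b_k)=0$ $(1\le k\le n)$ and $g''\in L^p(\Delta)$, $p>1$. $P_\Delta f(x)=f(x)$ for $x\in\Delta$ and $0$ for $x\notin\Delta$; the truncated generator is $L_\Delta=P_\Delta LP_\Delta$. An operator $B$ with domain dense in $L^p(\Delta)$ is called a quasi-potential if the functions $f=Bg$ belong to the domain of $L_\Delta$ and $-L_\Delta f=g$. $B$ is called regular if: (1) $B$ is compact and $Bf=\int_\Delta\Phi(x,y)f(y)\,dy$, $f\in L^p(\Delta)$, $p\ge1$, where $\Phi(x,y)$ can have a discontinuity only when $x=y$; (2) there is a function $\phi$ with $|\Phi(x,y)|\le\phi(x-y)$ and $\int_{-R}^R\phi(x)\,dx<\infty$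 for $0<R<\infty$; (3) $\Phi(x,y)\ge0$ for $x,y\in\Delta$, and $\Phi(a_k,y)=\Phi(b_k,y)=0$, $1\le k\le n$; (4) $Bg\ne0$ if $g\ne0$, $g\in L^p(\Delta)$.
   Formalization: With B and C_Δ in L^p, ψ is found and unique in the dual L^q (1/p+1/q=1), not in L^p unless p=2, since uniqueness in the same L^p can fail; the domain of L_Δ is C_Δ, and the kernel formula for Bf is assumed at every x in Δ. *)

theory Defs
  imports "HOL-Probability.Probability"
begin

definition levy_exponent :: "real \<Rightarrow> real \<Rightarrow> real measure \<Rightarrow> real \<Rightarrow> complex" where
  "levy_exponent A \<gamma> \<nu> z =
     of_real (A * z\<^sup>2 / 2) - \<i> * of_real (\<gamma> * z)
     - (LINT x|\<nu>. exp (\<i> * of_real (x * z)) - 1 - \<i> * of_real (x * z * indicator {-1..1} x))"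

definition levy_mu :: "real \<Rightarrow> real \<Rightarrow> real measure \<Rightarrow> real \<Rightarrow> real \<Rightarrow> complex" where
  "levy_mu A \<gamma> \<nu> z t = exp (- of_real t * levy_exponent A \<gamma> \<nu> z)"

definition levy_triple :: "real \<Rightarrow> real measure \<Rightarrow> bool" where
  "levy_triple A \<nu> \<longleftrightarrow>
     0 \<le> A \<and> sets \<nu> = sets borel \<and> integrable \<nu> (\<lambda>x. x\<^sup>2 / (1 + x\<^sup>2))"

definition levy_process ::
  "'w measure \<Rightarrow> (real \<Rightarrow> 'w \<Rightarrow> real) \<Rightarrow> real \<Rightarrow> real \<Rightarrow> real measure \<Rightarrow> bool" where
  "levy_process M X A \<gamma> \<nu> \<longleftrightarrow>
     prob_space M \<and> levy_triple A \<nu> \<and>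
     (\<forall>t\<ge>0. X t \<in> borel_measurable M) \<and>
     (AE \<omega> in M. X 0 \<omega> = 0) \<and>
     (\<forall>(m::nat) \<tau>. 0 \<le> \<tau> 0 \<and> (\<forall>i<m. \<tau> i \<le> \<tau> (Suc i)) \<longrightarrow>
        prob_space.indep_vars M (\<lambda>_. borel) (\<lambda>i \<omega>. X (\<tau> (Suc i)) \<omega> - X (\<tau> i) \<omega>) {..<m}) \<and>
     (\<forall>s\<ge>0. \<forall>h\<ge>0. distr M borel (\<lambda>\<omega>. X (s + h) \<omega> - X s \<omega>) = distr M borel (\<lambda>\<omega>. X h \<omega> - X 0 \<omega>)) \<and>
     (\<forall>s\<ge>0. \<forall>\<epsilon>>0. ((\<lambda>t. measure M {\<omega> \<in> space M. \<epsilon> < \<bar>X t \<omega> - X s \<omega>\<bar>}) \<longlongrightarrow> 0)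
        (at s within {0..})) \<and>
     (\<forall>t\<ge>0. \<forall>z. (LINT \<omega>|M. exp (\<i> * of_real (z * X t \<omega>))) = levy_mu A \<gamma> \<nu> z t)"

definition levy_density :: "real \<Rightarrow> real \<Rightarrow> real measure \<Rightarrow> real \<Rightarrow> real \<Rightarrow> real" where
  "levy_density A \<gamma> \<nu> x t =
     Re (of_real (1 / (2 * pi)) * (LINT z|lborel. exp (- \<i> * of_real (x * z)) * levy_mu A \<gamma> \<nu> z t))"

(* The Bochner integral in levy_density is 0 where it diverges; the requirement that the result be
   the density of X t (hence of total mass 1) therefore forces levy_mu to be integrable in z. *)
definition continuous_levy_density ::
  "'w measure \<Rightarrow> (real \<Rightarrow> 'w \<Rightarrow> real) \<Rightarrow> real \<Rightarrow> real \<Rightarrow> real measure \<Rightarrow> bool" where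
  "continuous_levy_density M X A \<gamma> \<nu> \<longleftrightarrow>
     (\<forall>t>0. distributed M lborel (X t) (\<lambda>x. ennreal (levy_density A \<gamma> \<nu> x t)) \<and>
            continuous_on UNIV (\<lambda>x. levy_density A \<gamma> \<nu> x t))"

definition levy_generator ::
  "real \<Rightarrow> real \<Rightarrow> real measure \<Rightarrow> (real \<Rightarrow> complex) \<Rightarrow> real \<Rightarrow> complex" where
  "levy_generator A \<gamma> \<nu> f x =
     (let f' = (\<lambda>u. vector_derivative f (at u)) in
        (A / 2) *\<^sub>R vector_derivative f' (at x) + \<gamma> *\<^sub>R f' x
        + (LINT y|\<nu>. f (x + y) - f x - (y * indicator {-1..1} y) *\<^sub>R f' x))"

(* Elements of L^p(S) are represented by functions on the line of which only the values on S matter,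
   modulo equality almost everywhere (eq_ae). *)
definition Lp :: "real \<Rightarrow> real set \<Rightarrow> (real \<Rightarrow> complex) set" where
  "Lp p S = {f \<in> borel_measurable (lebesgue_on S). integrable (lebesgue_on S) (\<lambda>x. norm (f x) powr p)}"

definition Lp_norm :: "real \<Rightarrow> real set \<Rightarrow> (real \<Rightarrow> complex) \<Rightarrow> real" where
  "Lp_norm p S f = (LINT x|lebesgue_on S. norm (f x) powr p) powr (1 / p)"

definition eq_ae :: "real set \<Rightarrow> (real \<Rightarrow> complex) \<Rightarrow> (real \<Rightarrow> complex) \<Rightarrow> bool" where
  "eq_ae S f g \<longleftrightarrow> (AE x in lebesgue_on S. f x = g x)"

definition pairing :: "real set \<Rightarrow> (real \<Rightarrow> complex) \<Rightarrow> (real \<Rightarrow> complex) \<Rightarrow> complex" where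
  "pairing S g h = (LINT x|lebesgue_on S. g x * cnj (h x))"

definition dense_subspace :: "real \<Rightarrow> real set \<Rightarrow> (real \<Rightarrow> complex) set \<Rightarrow> bool" where
  "dense_subspace p S D \<longleftrightarrow>
     D \<subseteq> Lp p S \<and>
     (\<forall>g\<in>D. \<forall>h\<in>D. \<forall>c d. (\<lambda>x. c * g x + d * h x) \<in> D) \<and>
     (\<forall>f\<in>Lp p S. \<forall>\<epsilon>>0. \<exists>g\<in>D. Lp_norm p S (\<lambda>x. f x - g x) < \<epsilon>)"

definition compact_operator :: "real \<Rightarrow> real set \<Rightarrow> ((real \<Rightarrow> complex) \<Rightarrow> real \<Rightarrow> complex) \<Rightarrow> bool" where
  "compact_operator p S T \<longleftrightarrow>
     (\<forall>f\<in>Lp p S. T f \<in> Lp p S) \<and>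
     (\<forall>F :: nat \<Rightarrow> real \<Rightarrow> complex.
        (\<forall>m. F m \<in> Lp p S \<and> Lp_norm p S (F m) \<le> 1) \<longrightarrow>
        (\<exists>r h. strict_mono (r :: nat \<Rightarrow> nat) \<and> h \<in> Lp p S \<and>
           (\<lambda>m. Lp_norm p S (\<lambda>x. T (F (r m)) x - h x)) \<longlonglongrightarrow> 0))"

definition boundedly_invertible :: "real \<Rightarrow> real set \<Rightarrow> ((real \<Rightarrow> complex) \<Rightarrow> real \<Rightarrow> complex) \<Rightarrow> bool" where
  "boundedly_invertible p S T \<longleftrightarrow>
     (\<forall>f\<in>Lp p S. T f \<in> Lp p S) \<and>
     (\<forall>h\<in>Lp p S. \<exists>f\<in>Lp p S. eq_ae S (T f) h \<and> (\<forall>g\<in>Lp p S. eq_ae S (T g) h \<longrightarrow> eq_ae S g f)) \<and>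
     (\<exists>K. \<forall>f\<in>Lp p S. Lp_norm p S f \<le> K * Lp_norm p S (T f))"

definition disjoint_segments :: "nat \<Rightarrow> (nat \<Rightarrow> real) \<Rightarrow> (nat \<Rightarrow> real) \<Rightarrow> bool" where
  "disjoint_segments n a b \<longleftrightarrow>
     1 \<le> n \<and> (\<forall>k\<in>{1..n}. a k < b k) \<and> (\<forall>k\<in>{1..<n}. b k < a (Suc k))"

definition segment_union :: "nat \<Rightarrow> (nat \<Rightarrow> real) \<Rightarrow> (nat \<Rightarrow> real) \<Rightarrow> real set" where
  "segment_union n a b = (\<Union>k\<in>{1..n}. {a k..b k})"

(* g'' in L^p is understood as usual: g' (here g1) is absolutely continuous on every segment,
   i.e. it is differentiable a.e. and is the integral of its a.e. derivative g2, and g2 is in L^p. *)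
definition C_segments :: "real \<Rightarrow> nat \<Rightarrow> (nat \<Rightarrow> real) \<Rightarrow> (nat \<Rightarrow> real) \<Rightarrow> (real \<Rightarrow> complex) set" where
  "C_segments p n a b =
     (let S = segment_union n a b in
      {g. \<exists>g1 g2.
         (\<forall>x\<in>S. (g has_vector_derivative g1 x) (at x within S)) \<and>
         (AE x in lebesgue_on S. (g1 has_vector_derivative g2 x) (at x within S)) \<and>
         (\<forall>k\<in>{1..n}. \<forall>x\<in>{a k..b k}. (g2 has_integral (g1 x - g1 (a k))) {a k..x}) \<and>
         g2 \<in> Lp p S \<and>
         (\<forall>k\<in>{1..n}. g (a k) = 0 \<and> g (b k) = 0 \<and> g1 (a k) = 0 \<and> g1 (b k) = 0)})"

definition truncation :: "real set \<Rightarrow> (real \<Rightarrow> complex) \<Rightarrow> real \<Rightarrow> complex" where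
  "truncation S f x = (if x \<in> S then f x else 0)"

definition truncated_generator ::
  "real \<Rightarrow> real \<Rightarrow> real measure \<Rightarrow> real set \<Rightarrow> (real \<Rightarrow> complex) \<Rightarrow> real \<Rightarrow> complex" where
  "truncated_generator A \<gamma> \<nu> S f = truncation S (levy_generator A \<gamma> \<nu> (truncation S f))"

(* The domain of the truncated generator is C_segments p n a b; for f in this set the extension of f
   by 0 is C^1 on the line and the formula defining the generator converges almost everywhere.
   D is the domain of B as a quasi-potential; a regular B (below) is the extension of this
   densely defined operator to all of L^p, denoted by the same letter. *)
definition quasi_potential ::
  "real \<Rightarrow> real \<Rightarrow> real measure \<Rightarrow> real \<Rightarrow> nat \<Rightarrow> (nat \<Rightarrow> real) \<Rightarrow> (nat \<Rightarrow> real) \<Rightarrow>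
   (real \<Rightarrow> complex) set \<Rightarrow> ((real \<Rightarrow> complex) \<Rightarrow> real \<Rightarrow> complex) \<Rightarrow> bool" where
  "quasi_potential A \<gamma> \<nu> p n a b D B \<longleftrightarrow>
     (let S = segment_union n a b in
      dense_subspace p S D \<and>
      (\<forall>g\<in>D. B g \<in> C_segments p n a b \<and>
              eq_ae S (\<lambda>x. - truncated_generator A \<gamma> \<nu> S (B g) x) g))"

(* The kernel formula for B is understood at every point x of the set: the integral converges there
   and B f denotes the function given by it. *)
definition regular_operator ::
  "real \<Rightarrow> nat \<Rightarrow> (nat \<Rightarrow> real) \<Rightarrow> (nat \<Rightarrow> real) \<Rightarrow>
   ((real \<Rightarrow> complex) \<Rightarrow> real \<Rightarrow> complex) \<Rightarrow> (real \<Rightarrow> real \<Rightarrow> real) \<Rightarrow> bool" where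
  "regular_operator p n a b B \<Phi> \<longleftrightarrow>
     (let S = segment_union n a b in
      compact_operator p S B \<and>
      (\<forall>f\<in>Lp p S. \<forall>x\<in>S. integrable (lebesgue_on S) (\<lambda>y. of_real (\<Phi> x y) * f y) \<and>
                           B f x = (LINT y|lebesgue_on S. of_real (\<Phi> x y) * f y)) \<and>
      continuous_on {(x, y). x \<in> S \<and> y \<in> S \<and> x \<noteq> y} (\<lambda>(x, y). \<Phi> x y) \<and>
      (\<exists>\<phi>. (\<forall>x\<in>S. \<forall>y\<in>S. \<bar>\<Phi> x y\<bar> \<le> \<phi> (x - y)) \<and>
            (\<forall>R>0. integrable (lebesgue_on {-R..R}) \<phi>)) \<and>
      (\<forall>x\<in>S. \<forall>y\<in>S. 0 \<le> \<Phi> x y) \<and>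
      (\<forall>k\<in>{1..n}. \<forall>y\<in>S. \<Phi> (a k) y = 0 \<and> \<Phi> (b k) y = 0) \<and>
      (\<forall>g\<in>Lp p S. \<not> eq_ae S g (\<lambda>_. 0) \<longrightarrow> \<not> eq_ae S (B g) (\<lambda>_. 0)))"

(* For B acting in L^p, the adjoint acts in L^q, 1/p + 1/q = 1, which is paired with L^p by pairing. *)
definition adjoint_kernel_operator ::
  "real set \<Rightarrow> (real \<Rightarrow> real \<Rightarrow> real) \<Rightarrow> (real \<Rightarrow> complex) \<Rightarrow> real \<Rightarrow> complex" where
  "adjoint_kernel_operator S \<Phi> f x = (LINT y|lebesgue_on S. cnj (of_real (\<Phi> y x)) * f y)"

end

theory Submission
  imports Defs
begin

text \<open>The point is that a regular quasi-potential \<open>B\<close> inverts \<open>- L\<close> on all of the test functions,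
  not only on the range of its dense domain: \<open>f = B (- L f)\<close>, also pointwise at \<open>0\<close>. Almost
  everywhere this follows from an a priori estimate \<open>c * \<integral> \<Psi>(f) \<le> \<integral> |L f|\<close> with the convex function
  \<open>\<Psi>(u) = sqrt (1 + u^2) - 1\<close>: convexity gives \<open>\<Psi>'(f) L f \<le> L (\<Psi> f)\<close>, and integrating against a
  weight built from \<open>exp (i z x)\<close> turns \<open>L\<close> into the number \<open>\<lambda>(- z)\<close>, which does not vanish
  because \<open>X\<^sub>t\<close> has a density. At \<open>0\<close> it follows by continuity of \<open>B g\<close> for \<open>g\<close> bounded near \<open>0\<close>,
  and by approximation in general, since \<open>\<Phi>(0, \<cdot>)\<close> lies in \<open>L\<^sup>q\<close> by the converse of Hoelder's
  inequality. The equation for \<open>\<psi>\<close> then reads \<open>\<integral> g (\<psi> + s B* \<psi>) = \<integral> g \<Phi>(0, \<cdot>)\<close> with \<open>g = - L f\<close>,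
  and \<open>I + s B*\<close> is inverted by a Neumann series; uniqueness uses only that the domain of \<open>B\<close> is
  dense.\<close>

text \<open>The hypotheses tie \<open>B\<close> to the generator L only through L (B g) = - g for g
  in a dense set, while the equation is tested on all of \<open>C_segments\<close>. For a test
  function f with g = - L f, approximate g by g' in \<open>D\<close>: then L (B g' - f) = g - g' is
  small in L^p, hence in L^1, and one has to conclude that B g' - f is small. That is why the a
  priori estimate has the L^1 norm of L f over the set alone on its right-hand side. The frequency z
  = 1 / R is taken so that cos (z x) stays above cos 1 > 0 on the set, which lies in [- R, R].

  The second obstacle is the right-hand side f 0: it is the value at one point, about which an
  identity almost everywhere says nothing, and g may be unbounded near 0, so that B g is not known
  to be continuous there.

  Estimates are carried with crude factors such as 2^p; in the Neumann series they only make s0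
  smaller.\<close>

section \<open>Truncation, Jensen and Hoelder inequalities\<close>

text \<open>Above the level t one has u^(p - 1) >= t^(p - 1), so u is at most t^(1 - p) u^p there.
  Leaving t free makes this a one-parameter substitute for Jensen's inequality.\<close>

lemma le_plus_powr:
  fixes u t p :: real
  assumes "0 \<le> u" "0 < t" "1 < p"
  shows "u \<le> t + t powr (1 - p) * u powr p"
proof (cases "u \<le> t")
  case True
  then show ?thesis using assms by (simp add: add_increasing2)
next
  case False
  then have "t powr (p - 1) \<le> u powr (p - 1)" using assms by (intro powr_mono2) auto
  then have "t powr (1 - p) * t powr (p - 1) * u \<le> t powr (1 - p) * u powr (p - 1) * u"
    using assms by (intro mult_right_mono mult_left_mono) auto
  moreover have "t powr (1 - p) * t powr (p - 1) = 1"
    using assms by (simp flip: powr_add)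
  moreover have "u powr (p - 1) * u = u powr p"
    using False assms powr_add[of u "p - 1" 1] by simp
  ultimately show ?thesis using assms by (simp add: mult.assoc)
qed

lemma (in finite_measure) integrable_of_powr:
  fixes u :: "'a \<Rightarrow> 'b::{banach, second_countable_topology}"
  assumes [measurable]: "u \<in> borel_measurable M"
    and "1 < p" and "integrable M (\<lambda>x. norm (u x) powr p)"
  shows "integrable M u"
proof (rule Bochner_Integration.integrable_bound)
  show "integrable M (\<lambda>x. 1 + norm (u x) powr p)" using assms by simp
  show "AE x in M. norm (u x) \<le> norm (1 + norm (u x) powr p)"
    using le_plus_powr[of _ 1 p] assms by (auto intro!: AE_I2)
qed simp

text \<open>Integrate \<open>le_plus_powr\<close> and optimise the level t. This is Jensen's
  inequality up to the factor 2^p, with any bound \<open>C\<close> of the total mass in place of the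
  mass, which suits kernels whose rows have different masses.\<close>

lemma (in finite_measure) integral_powr_le:
  fixes u :: "'a \<Rightarrow> real"
  assumes [measurable]: "u \<in> borel_measurable M" and u0: "\<And>x. 0 \<le> u x"
    and p: "1 < p" and i: "integrable M (\<lambda>x. u x powr p)" and C: "measure M (space M) \<le> C"
  shows "(LINT x|M. u x) powr p \<le> 2 powr p * C powr (p - 1) * (LINT x|M. u x powr p)"
proof -
  define J where "J = (LINT x|M. u x powr p)"
  have iu: "integrable M u" using integrable_of_powr[of u p] i p u0 by simp
  have J0: "0 \<le> J" unfolding J_def by simp
  have C0: "0 \<le> C" using C measure_nonneg[of M "space M"] by linarith
  show ?thesis
  proof (cases "J = 0 \<or> C = 0")
    case True
    then have "(LINT x|M. u x) = 0"
    proof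
      assume "J = 0"
      then have "AE x in M. u x powr p = 0"
        unfolding J_def using integral_nonneg_eq_0_iff_AE[OF i] by simp
      then have "AE x in M. u x = 0" by auto
      then show ?thesis using integral_eq_zero_AE by auto
    next
      assume "C = 0"
      then have "measure M (space M) = 0" using C measure_nonneg[of M "space M"] by linarith
      then have "space M \<in> null_sets M"
        by (simp add: null_sets_def emeasure_eq_measure)
      then have "AE x in M. u x = 0" by (rule AE_I') auto
      then show ?thesis using integral_eq_zero_AE by auto
    qed
    then show ?thesis using p J0 C0 by (simp flip: J_def)
  next
    case False
    then have J: "0 < J" and C': "0 < C" using J0 C0 by auto
    \<comment> \<open>This level balances the two terms: t^p = J / C makes t^(1 - p) J equal to t
      C.\<close>
    define t where "t = (J / C) powr (1 / p)"
    have t: "0 < t" using J C' by (simp add: t_def)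
    have tp: "t powr p = J / C" using J C' p by (simp add: t_def powr_powr)
    have "(LINT x|M. u x) \<le> (LINT x|M. t + t powr (1 - p) * u x powr p)"
      using iu i le_plus_powr[OF u0 t p] by (intro integral_mono) auto
    also have "\<dots> = t * measure M (space M) + t powr (1 - p) * J"
      using i by (simp add: J_def)
    also have "\<dots> \<le> t * C + t powr (1 - p) * J" using C t by simp
    also have "t powr (1 - p) * J = t * C"
      using tp t C' by (simp add: powr_diff field_simps)
    finally have "(LINT x|M. u x) \<le> 2 * (t * C)" by (simp add: mult.commute)
    then have "(LINT x|M. u x) powr p \<le> (2 * (t * C)) powr p"
      using p u0 by (intro powr_mono2) auto
    also have "\<dots> = 2 powr p * (J / C * C powr p)"
      using t C' p tp by (simp add: powr_mult)
    also have "\<dots> = 2 powr p * C powr (p - 1) * J"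
      using C' by (simp add: powr_diff)
    finally show ?thesis by (simp add: J_def)
  qed
qed

lemma Holder_integral:
  fixes u v :: "'a \<Rightarrow> complex"
  assumes [measurable]: "u \<in> borel_measurable M" "v \<in> borel_measurable M"
    and pq: "1 < p" "1 < q" "1 / p + 1 / q = 1"
    and u: "integrable M (\<lambda>x. norm (u x) powr p)" and v: "integrable M (\<lambda>x. norm (v x) powr q)"
  shows "integrable M (\<lambda>x. u x * v x)"
    and "norm (LINT x|M. u x * v x) \<le>
      (LINT x|M. norm (u x) powr p) powr (1 / p) * (LINT x|M. norm (v x) powr q) powr (1 / q)"
proof -
  have Y: "a * b \<le> a powr p / p + b powr q / q" if "0 \<le> a" "0 \<le> b" for a b
    using Youngs_inequality[of p q a b] pq that by simp
  show I: "integrable M (\<lambda>x. u x * v x)"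
  proof (rule Bochner_Integration.integrable_bound)
    show "integrable M (\<lambda>x. norm (u x) powr p / p + norm (v x) powr q / q)" using u v by simp
    show "AE x in M. norm (u x * v x) \<le> norm (norm (u x) powr p / p + norm (v x) powr q / q)"
      using Y pq by (auto intro!: AE_I2 simp: norm_mult abs_of_nonneg)
  qed simp
  define P where "P = (LINT x|M. norm (u x) powr p)"
  define Q where "Q = (LINT x|M. norm (v x) powr q)"
  have PQ: "0 \<le> P" "0 \<le> Q" by (auto simp: P_def Q_def)
  have "(LINT x|M. norm (u x * v x)) \<le> P powr (1 / p) * Q powr (1 / q)"
  proof (cases "P = 0 \<or> Q = 0")
    case True
    then have "AE x in M. norm (u x * v x) = 0"
    proof
      assume "P = 0"
      then have "AE x in M. norm (u x) powr p = 0"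
        unfolding P_def using integral_nonneg_eq_0_iff_AE[OF u] by simp
      then show ?thesis by eventually_elim simp
    next
      assume "Q = 0"
      then have "AE x in M. norm (v x) powr q = 0"
        unfolding Q_def using integral_nonneg_eq_0_iff_AE[OF v] by simp
      then show ?thesis by eventually_elim simp
    qed
    then have "(LINT x|M. norm (u x * v x)) = 0" by (rule integral_eq_zero_AE)
    then show ?thesis by simp
  next
    case False
    define \<alpha> where "\<alpha> = P powr (1 / p)"
    define \<beta> where "\<beta> = Q powr (1 / q)"
    have ab: "0 < \<alpha>" "0 < \<beta>" "\<alpha> powr p = P" "\<beta> powr q = Q"
      using False PQ pq by (auto simp: \<alpha>_def \<beta>_def powr_powr)
    have "(LINT x|M. norm (u x * v x) / (\<alpha> * \<beta>))
        \<le> (LINT x|M. norm (u x) powr p / (p * P) + norm (v x) powr q / (q * Q))"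
    proof (rule integral_mono)
      show "norm (u x * v x) / (\<alpha> * \<beta>) \<le> norm (u x) powr p / (p * P) + norm (v x) powr q / (q * Q)" for x
        using Y[of "norm (u x) / \<alpha>" "norm (v x) / \<beta>"] ab
        by (simp add: norm_mult powr_divide mult.commute)
    qed (use I u v in auto)
    also have "\<dots> = 1 / p + 1 / q"
      using u v False pq by (simp flip: P_def Q_def)
    finally show ?thesis using ab pq by (simp add: field_simps \<alpha>_def \<beta>_def)
  qed
  then show "norm (LINT x|M. u x * v x) \<le>
      (LINT x|M. norm (u x) powr p) powr (1 / p) * (LINT x|M. norm (v x) powr q) powr (1 / q)"
    unfolding P_def Q_def using integral_norm_bound[of M "\<lambda>x. u x * v x"] by linarith
qed

section \<open>Integral operators with kernels on finite measure spaces\<close>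

text \<open>The analogue of \<open>Lp\<close> over an arbitrary measure; \<open>Lp p S\<close> is
  the case of \<open>lebesgue_on S\<close>, but \<open>lborel\<close> occurs as well.\<close>

definition Lspace :: "real \<Rightarrow> 'a measure \<Rightarrow> ('a \<Rightarrow> complex) set" where
  "Lspace r N = {u \<in> borel_measurable N. integrable N (\<lambda>x. norm (u x) powr r)}"

lemma Lspace_measurable: "u \<in> Lspace r N \<Longrightarrow> u \<in> borel_measurable N"
  by (simp add: Lspace_def)

lemma Lspace_integrable: "u \<in> Lspace r N \<Longrightarrow> integrable N (\<lambda>x. norm (u x) powr r)"
  by (simp add: Lspace_def)

lemma powr_add_le:
  fixes a b r :: real
  assumes "0 \<le> a" "0 \<le> b" "0 \<le> r"
  shows "(a + b) powr r \<le> 2 powr r * (a powr r + b powr r)"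
proof -
  have "(a + b) powr r \<le> (2 * max a b) powr r"
    using assms by (intro powr_mono2) auto
  also have "\<dots> = 2 powr r * (max a b) powr r" using assms by (simp add: powr_mult)
  also have "\<dots> \<le> 2 powr r * (a powr r + b powr r)"
    by (intro mult_left_mono) (auto simp: max_def)
  finally show ?thesis .
qed

lemma Lspace_bound:
  assumes u: "u \<in> Lspace r N" and v: "v \<in> borel_measurable N" and r: "0 \<le> r"
    and le: "AE x in N. norm (v x) \<le> norm (u x)"
  shows "v \<in> Lspace r N"
proof -
  note [measurable] = Lspace_measurable[OF u] v
  have "integrable N (\<lambda>x. norm (v x) powr r)"
    by (rule Bochner_Integration.integrable_bound[OF Lspace_integrable[OF u]])
      (use le r in \<open>auto elim!: eventually_mono intro!: powr_mono2\<close>)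
  then show ?thesis using v by (simp add: Lspace_def)
qed

lemma Lspace_add:
  assumes u: "u \<in> Lspace r N" and v: "v \<in> Lspace r N" and r: "0 \<le> r"
  shows "(\<lambda>x. u x + v x) \<in> Lspace r N"
proof -
  note [measurable] = Lspace_measurable[OF u] Lspace_measurable[OF v]
  have "integrable N (\<lambda>x. norm (u x + v x) powr r)"
  proof (rule Bochner_Integration.integrable_bound)
    show "integrable N (\<lambda>x. 2 powr r * (norm (u x) powr r + norm (v x) powr r))"
      using Lspace_integrable[OF u] Lspace_integrable[OF v] by simp
    have "norm (u x + v x) powr r \<le> 2 powr r * (norm (u x) powr r + norm (v x) powr r)" for x
      using powr_add_le[of "norm (u x)" "norm (v x)" r] r norm_triangle_ineq[of "u x" "v x"]
      by (smt (verit) norm_ge_zero powr_mono2)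
    then show "AE x in N. norm (norm (u x + v x) powr r)
        \<le> norm (2 powr r * (norm (u x) powr r + norm (v x) powr r))"
      by (auto simp: abs_mult)
  qed simp
  then show ?thesis by (simp add: Lspace_def)
qed

lemma Lspace_mult:
  assumes "u \<in> Lspace r N"
  shows "(\<lambda>x. c * u x) \<in> Lspace r N"
  using assms by (auto simp: Lspace_def norm_mult powr_mult intro!: borel_measurable_times)

lemma Lspace_diff:
  assumes u: "u \<in> Lspace r N" and v: "v \<in> Lspace r N" and r: "0 \<le> r"
  shows "(\<lambda>x. u x - v x) \<in> Lspace r N"
  using Lspace_add[OF u Lspace_mult[OF v, of "-1"] r] by simp

lemma (in finite_measure) Lspace_integrable_self:
  assumes "u \<in> Lspace r M" "1 < r"
  shows "integrable M u"
  using assms by (auto simp: Lspace_def intro: integrable_of_powr)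

definition kernel_op :: "'a measure \<Rightarrow> ('a \<Rightarrow> 'a \<Rightarrow> real) \<Rightarrow> ('a \<Rightarrow> complex) \<Rightarrow> 'a \<Rightarrow> complex" where
  "kernel_op N k u x = (LINT y|N. of_real (k x y) * u y)"

text \<open>The hypotheses of the Schur test. They are symmetric in the two variables, so by
  \<open>transpose\<close> each result about the operator also serves its adjoint.\<close>

locale schur_kernel = N: finite_measure N for N :: "'a measure" +
  fixes k :: "'a \<Rightarrow> 'a \<Rightarrow> real" and C :: real
  assumes k_meas[measurable]: "(\<lambda>(x, y). k x y) \<in> borel_measurable (N \<Otimes>\<^sub>M N)"
    and k_nonneg: "\<And>x y. 0 \<le> k x y"
    and k_row: "\<And>x. x \<in> space N \<Longrightarrow> (\<integral>\<^sup>+y. k x y \<partial>N) \<le> ennreal C"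
    and k_col: "\<And>y. y \<in> space N \<Longrightarrow> (\<integral>\<^sup>+x. k x y \<partial>N) \<le> ennreal C"
    and C_nonneg: "0 \<le> C"
begin

sublocale NN: pair_sigma_finite N N ..

lemma transpose: "schur_kernel N (\<lambda>x y. k y x) C"
  by unfold_locales (use k_nonneg k_row k_col C_nonneg in \<open>auto intro: measurable_compose[OF measurable_pair_swap' k_meas, unfolded split_beta', simplified] simp: split_beta'\<close>)

lemma k_integrable_snd:
  fixes w :: "'a \<Rightarrow> real"
  assumes w: "integrable N w"
  shows "integrable (N \<Otimes>\<^sub>M N) (\<lambda>(x, y). k x y * w y)"
proof (rule integrableI_bounded)
  note [measurable] = borel_measurable_integrable[OF w]
  show "(\<lambda>(x, y). k x y * w y) \<in> borel_measurable (N \<Otimes>\<^sub>M N)"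
    by (simp add: split_beta')
  have "(\<integral>\<^sup>+z. ennreal (norm (case z of (x, y) \<Rightarrow> k x y * w y)) \<partial>(N \<Otimes>\<^sub>M N))
      = (\<integral>\<^sup>+y. (\<integral>\<^sup>+x. ennreal (norm (k x y * w y)) \<partial>N) \<partial>N)"
    by (subst NN.nn_integral_snd[symmetric]) (simp_all add: split_beta')
  also have "\<dots> = (\<integral>\<^sup>+y. ennreal (norm (w y)) * (\<integral>\<^sup>+x. ennreal (k x y) \<partial>N) \<partial>N)"
    by (auto intro!: nn_integral_cong simp: abs_mult k_nonneg ennreal_mult mult.commute
        simp flip: nn_integral_cmult)
  also have "\<dots> \<le> (\<integral>\<^sup>+y. ennreal (norm (w y)) * ennreal C \<partial>N)"
    by (intro nn_integral_mono mult_left_mono k_col) auto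
  also have "\<dots> < \<infinity>"
    using w by (auto simp: nn_integral_multc integrable_iff_bounded ennreal_mult_less_top)
  finally show "(\<integral>\<^sup>+z. ennreal (norm (case z of (x, y) \<Rightarrow> k x y * w y)) \<partial>(N \<Otimes>\<^sub>M N)) < \<infinity>" .
qed

lemma k_row_integral:
  assumes x: "x \<in> space N"
  shows "integrable N (k x)" "(LINT y|N. k x y) \<le> C"
proof -
  have [measurable]: "k x \<in> borel_measurable N"
    using measurable_compose[OF measurable_Pair1'[OF x] k_meas] by simp
  show i: "integrable N (k x)"
    by (rule integrableI_bounded) (use k_row[OF x] k_nonneg in \<open>auto intro: le_less_trans\<close>)
  show "(LINT y|N. k x y) \<le> C"
    using k_row[OF x] nn_integral_eq_integral[OF i] k_nonneg C_nonneg by simp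
qed

lemma kernel_op_measurable [measurable]:
  assumes [measurable]: "u \<in> borel_measurable N"
  shows "kernel_op N k u \<in> borel_measurable N"
  unfolding kernel_op_def by measurable

lemma k_integral_snd_le:
  fixes w :: "'a \<Rightarrow> real"
  assumes w: "integrable N w" and w0: "\<And>y. 0 \<le> w y"
  shows "(LINT x|N. LINT y|N. k x y * w y) \<le> C * (LINT y|N. w y)"
proof -
  interpret T: schur_kernel N "\<lambda>x y. k y x" C by (rule transpose)
  have "(LINT x|N. LINT y|N. k x y * w y) = (LINT y|N. LINT x|N. k x y * w y)"
    using k_integrable_snd[OF w] by (rule NN.Fubini_integral[symmetric])
  also have "\<dots> \<le> (LINT y|N. C * w y)"
  proof (rule integral_mono)
    show "integrable N (\<lambda>y. LINT x|N. k x y * w y)"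
      using NN.integrable_snd[OF k_integrable_snd[OF w]] by simp
    show "(LINT x|N. k x y * w y) \<le> C * w y" if "y \<in> space N" for y
      using T.k_row_integral[OF that] w0[of y] by (simp add: mult_right_mono)
  qed (use w in simp)
  finally show ?thesis by simp
qed

text \<open>The Schur test. For fixed x, Jensen's inequality for the measure k(x, y) dN(y), of mass
  at most C, contributes C^(r - 1); integrating over x uses the column bound and contributes the
  last factor C. The 2 in 2 C is the loss in \<open>integral_powr_le\<close>.\<close>

lemma kernel_op_Lspace:
  assumes u: "u \<in> Lspace r N" and r: "1 < r"
  shows "AE x in N. integrable N (\<lambda>y. of_real (k x y) * u y :: complex)"
    and "kernel_op N k u \<in> Lspace r N"
    and "(LINT x|N. norm (kernel_op N k u x) powr r) \<le> (2 * C) powr r * (LINT x|N. norm (u x) powr r)"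
proof -
  note [measurable] = Lspace_measurable[OF u]
  define w where "w y = norm (u y) powr r" for y
  have w: "integrable N w" and w0: "\<And>y. 0 \<le> w y"
    unfolding w_def using Lspace_integrable[OF u] by auto
  have iu: "integrable N (\<lambda>y. norm (u y))" using N.Lspace_integrable_self[OF u r] by simp
  show I: "AE x in N. integrable N (\<lambda>y. of_real (k x y) * u y :: complex)"
    using NN.AE_integrable_fst'[OF k_integrable_snd[OF iu]] AE_space
  proof eventually_elim
    case (elim x)
    have [measurable]: "k x \<in> borel_measurable N" using k_row_integral[OF elim(2)] by auto
    show ?case
      by (rule Bochner_Integration.integrable_bound[OF elim(1)]) (auto simp: norm_mult k_nonneg)
  qed
  have iw: "integrable N (\<lambda>x. LINT y|N. k x y * w y)"
    using NN.integrable_fst'[OF k_integrable_snd[OF w]] by simp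
  have B: "AE x in N. norm (kernel_op N k u x) powr r
      \<le> 2 powr r * C powr (r - 1) * (LINT y|N. k x y * w y)"
    using NN.AE_integrable_fst'[OF k_integrable_snd[OF w]] AE_space
  proof eventually_elim
    case (elim x)
    note kx = k_row_integral[OF elim(2)]
    have [measurable]: "k x \<in> borel_measurable N" using kx by auto
    interpret D: finite_measure "density N (\<lambda>y. ennreal (k x y))"
      by (rule finite_measureI)
        (use k_row[OF elim(2)] in \<open>auto simp: emeasure_density top_unique cong: nn_integral_cong\<close>)
    have m: "measure (density N (\<lambda>y. ennreal (k x y))) (space (density N (\<lambda>y. ennreal (k x y)))) \<le> C"
      using k_row[OF elim(2)] C_nonneg
      by (simp add: measure_def emeasure_density enn2real_leI cong: nn_integral_cong)
    have "norm (kernel_op N k u x) \<le> (LINT y|N. k x y * norm (u y))"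
      unfolding kernel_op_def
      using integral_norm_bound[of N "\<lambda>y. of_real (k x y) * u y"] by (simp add: norm_mult k_nonneg)
    then have "norm (kernel_op N k u x) powr r \<le> (LINT y|N. k x y * norm (u y)) powr r"
      using r by (intro powr_mono2) auto
    also have "\<dots> \<le> 2 powr r * C powr (r - 1) * (LINT y|N. k x y * w y)"
      using D.integral_powr_le[of "\<lambda>y. norm (u y)" r C] r m elim(1)
      by (simp add: integral_density integrable_density k_nonneg w_def)
    finally show ?case .
  qed
  have ik: "integrable N (\<lambda>x. norm (kernel_op N k u x) powr r)"
    by (rule Bochner_Integration.integrable_bound
        [where f = "\<lambda>x. 2 powr r * C powr (r - 1) * (LINT y|N. k x y * w y)"])
      (use iw B in \<open>auto elim!: eventually_mono intro: order_trans[OF _ abs_ge_self]\<close>)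
  then show "kernel_op N k u \<in> Lspace r N" by (simp add: Lspace_def)
  have "(LINT x|N. norm (kernel_op N k u x) powr r)
      \<le> (LINT x|N. 2 powr r * C powr (r - 1) * (LINT y|N. k x y * w y))"
    using ik iw B by (intro integral_mono_AE) auto
  also have "\<dots> \<le> 2 powr r * C powr (r - 1) * (C * (LINT y|N. w y))"
    using k_integral_snd_le[OF w w0] by (simp add: mult_left_mono)
  also have "\<dots> = (2 * C) powr r * (LINT y|N. w y)"
    using C_nonneg by (simp add: powr_mult powr_diff)
  finally show "(LINT x|N. norm (kernel_op N k u x) powr r)
      \<le> (2 * C) powr r * (LINT x|N. norm (u x) powr r)"
    by (simp add: w_def)
qed

text \<open>This is Fubini's theorem. Joint integrability comes from Young's inequality under the
  kernel: it separates g and h into two terms, controlled by the column and the row bound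
  respectively.\<close>

lemma kernel_op_dual:
  assumes g: "g \<in> Lspace p N" and h: "h \<in> Lspace q N"
    and pq: "1 < p" "1 < q" "1 / p + 1 / q = 1"
  shows "(LINT x|N. kernel_op N k g x * h x) = (LINT y|N. g y * kernel_op N (\<lambda>x y. k y x) h y)"
proof -
  interpret T: schur_kernel N "\<lambda>x y. k y x" C by (rule transpose)
  note [measurable] = Lspace_measurable[OF g] Lspace_measurable[OF h]
  have "integrable (N \<Otimes>\<^sub>M N) (\<lambda>(x, y). of_real (k x y) * g y * h x)"
  proof (rule Bochner_Integration.integrable_bound)
    have "integrable (N \<Otimes>\<^sub>M N) (\<lambda>(x, y). k x y * (norm (h x) powr q))"
      using NN.integrable_product_swap[OF T.k_integrable_snd[OF Lspace_integrable[OF h]]]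
      by (simp add: split_beta')
    then show "integrable (N \<Otimes>\<^sub>M N)
        (\<lambda>z. (case z of (x, y) \<Rightarrow> k x y * (norm (g y) powr p)) / p
           + (case z of (x, y) \<Rightarrow> k x y * (norm (h x) powr q)) / q)"
      using k_integrable_snd[OF Lspace_integrable[OF g]] by auto
    have "k x y * (norm (g y) * norm (h x))
        \<le> k x y * (norm (g y) powr p / p + norm (h x) powr q / q)" for x y
      using Youngs_inequality[of p q "norm (g y)" "norm (h x)"] pq k_nonneg[of x y]
      by (intro mult_left_mono) auto
    then show "AE z in N \<Otimes>\<^sub>M N. norm (case z of (x, y) \<Rightarrow> of_real (k x y) * g y * h x)
        \<le> norm ((case z of (x, y) \<Rightarrow> k x y * (norm (g y) powr p)) / p
           + (case z of (x, y) \<Rightarrow> k x y * (norm (h x) powr q)) / q)"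
      by (auto simp: norm_mult k_nonneg algebra_simps intro!: AE_I2 order_trans[OF _ abs_ge_self])
  qed (simp add: split_beta')
  from NN.Fubini_integral[OF this]
  have "(LINT y|N. LINT x|N. of_real (k x y) * g y * h x) = (LINT x|N. LINT y|N. of_real (k x y) * g y * h x)"
    by simp
  moreover have "(LINT x|N. of_real (k x y) * g y * h x) = g y * (LINT x|N. of_real (k x y) * h x)" for y
    by (simp add: ac_simps flip: integral_mult_right_zero)
  moreover have "(LINT y|N. of_real (k x y) * g y * h x) = (LINT y|N. of_real (k x y) * g y) * h x" for x
    by (simp flip: integral_mult_left_zero)
  ultimately show ?thesis by (simp add: kernel_op_def)
qed

section \<open>Neumann series for the inverse of I + s K\<close>

text \<open>On L^q the operator s K has norm at most 1 / 4, so d = - s K d bounds the integral of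
  |d|^q by a proper fraction of itself.\<close>

lemma neumann_unique:
  assumes q: "1 < q" and s: "0 \<le> s" "s * (2 * C) \<le> 1 / 4"
    and d: "d \<in> Lspace q N" and eq: "AE x in N. d x + of_real s * kernel_op N k d x = 0"
  shows "AE x in N. d x = 0"
proof -
  note [measurable] = Lspace_measurable[OF d]
  define I where "I = (LINT x|N. norm (d x) powr q)"
  have "AE x in N. norm (d x) powr q = s powr q * norm (kernel_op N k d x) powr q"
    using eq
  proof eventually_elim
    case (elim x)
    then have "norm (d x) = norm (of_real s * kernel_op N k d x)"
      by (metis add_eq_0_iff norm_minus_cancel)
    then show ?case using s by (simp add: norm_mult powr_mult)
  qed
  then have "I = (LINT x|N. s powr q * norm (kernel_op N k d x) powr q)"
    unfolding I_def by (intro integral_cong_AE) auto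
  also have "\<dots> \<le> s powr q * ((2 * C) powr q * I)"
    using kernel_op_Lspace(3)[OF d q] by (simp add: I_def mult_left_mono)
  also have "\<dots> = (s * (2 * C)) powr q * I" using s C_nonneg by (simp add: powr_mult)
  also have "\<dots> \<le> (1 / 4) powr q * I"
    using s C_nonneg q by (intro mult_right_mono powr_mono2) (auto simp: I_def)
  finally have "(1 - (1 / 4) powr q) * I \<le> 0" by (simp add: algebra_simps)
  moreover have "(1 / 4) powr q < (1::real)" using q powr_less_mono2[of q "1 / 4" 1] by simp
  moreover have "0 \<le> I" by (simp add: I_def)
  ultimately have "I = 0" by (simp add: mult_le_0_iff)
  then have "AE x in N. norm (d x) powr q = 0"
    unfolding I_def using integral_nonneg_eq_0_iff_AE[OF Lspace_integrable[OF d]] by simp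
  then show ?thesis by eventually_elim simp
qed

text \<open>The solution is the sum of (- s K)^j h. In place of completeness of L^q, one majorant G
  in L^q is built with |u j| <= 2^(-j) G almost everywhere; it gives pointwise convergence, the norm
  bound, and dominated convergence under the kernel.\<close>

lemma neumann_exists:
  assumes q: "1 < q" and s: "0 \<le> s" "s * (2 * C) \<le> 1 / 4" and h: "h \<in> Lspace q N"
  obtains f where "f \<in> Lspace q N" "AE x in N. f x + of_real s * kernel_op N k f x = h x"
    "(LINT x|N. norm (f x) powr q) \<le> 2 powr (q + 1) * (LINT x|N. norm (h x) powr q)"
proof -
  define I where "I = (LINT x|N. norm (h x) powr q)"
  have I0: "0 \<le> I" by (simp add: I_def)
  define u where "u = rec_nat h (\<lambda>_ v x. - of_real s * kernel_op N k v x)"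
  have u_0: "u 0 = h" and u_Suc: "u (Suc j) = (\<lambda>x. - of_real s * kernel_op N k (u j) x)" for j
    by (simp_all add: u_def)
  have uL: "u j \<in> Lspace q N" for j
  proof (induction j)
    case (Suc j)
    then show ?case using Lspace_mult[OF kernel_op_Lspace(2)[OF Suc q], of "- of_real s"] by (simp add: u_Suc)
  qed (simp add: u_0 h)
  note [measurable] = Lspace_measurable[OF uL] Lspace_measurable[OF h]
  \<comment> \<open>The weight 2^(j q) is what yields the decay 2^(-j) of \<open>u j\<close>
    relative to the majorant. The smallness 1 / 4 of s K pays for it: 2 times 1 / 4 still leaves a
    geometric ratio 1 / 2.\<close>
  define V where "V j x = 2 powr (real j * q) * norm (u j x) powr q" for j x
  have V0: "0 \<le> V j x" for j x by (simp add: V_def)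
  have V_meas[measurable]: "V j \<in> borel_measurable N" for j
    unfolding V_def by measurable
  have iV: "integrable N (V j)" for j
    unfolding V_def using Lspace_integrable[OF uL] by simp
  have uI: "(LINT x|N. norm (u j x) powr q) \<le> ((1 / 4) powr q) ^ j * I" for j
  proof (induction j)
    case (Suc j)
    have "(LINT x|N. norm (u (Suc j) x) powr q) = s powr q * (LINT x|N. norm (kernel_op N k (u j) x) powr q)"
      using s by (simp add: u_Suc norm_mult powr_mult)
    also have "\<dots> \<le> s powr q * ((2 * C) powr q * (LINT x|N. norm (u j x) powr q))"
      using kernel_op_Lspace(3)[OF uL q] by (simp add: mult_left_mono)
    also have "\<dots> = (s * (2 * C)) powr q * (LINT x|N. norm (u j x) powr q)"
      using s C_nonneg by (simp add: powr_mult)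
    also have "\<dots> \<le> (1 / 4) powr q * (((1 / 4) powr q) ^ j * I)"
      using s C_nonneg q Suc by (intro mult_mono powr_mono2) auto
    finally show ?case by simp
  qed (simp add: u_0 I_def)
  have VI: "(LINT x|N. V j x) \<le> (1 / 2) ^ j * I" for j
  proof -
    have "(LINT x|N. V j x) \<le> 2 powr (real j * q) * (((1 / 4) powr q) ^ j * I)"
      using uI[of j] by (simp add: V_def mult_left_mono)
    also have "2 powr (real j * q) = (2 powr q) ^ j"
      by (simp add: powr_powr mult.commute flip: powr_realpow)
    also have "(2 powr q) ^ j * (((1 / 4) powr q) ^ j * I) = ((1 / 2) powr q) ^ j * I"
      by (simp flip: power_mult_distrib powr_mult mult.assoc)
    also have "\<dots> \<le> (1 / 2) ^ j * I"
      using I0 q powr_mono'[of 1 q "1 / 2"] by (intro mult_right_mono power_mono) auto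
    finally show ?thesis .
  qed
  have S: "(\<integral>\<^sup>+x. (\<Sum>j. ennreal (V j x)) \<partial>N) \<le> ennreal (2 * I)"
  proof -
    have "(\<integral>\<^sup>+x. (\<Sum>j. ennreal (V j x)) \<partial>N) = (\<Sum>j. \<integral>\<^sup>+x. ennreal (V j x) \<partial>N)"
      by (rule nn_integral_suminf) simp
    also have "\<dots> = (\<Sum>j. ennreal (LINT x|N. V j x))"
      using nn_integral_eq_integral[OF iV] V0 by simp
    also have "\<dots> \<le> (\<Sum>j. ennreal ((1 / 2) ^ j * I))"
      by (intro suminf_le ennreal_leI VI) auto
    also have "\<dots> = ennreal (2 * I)"
    proof (rule suminf_ennreal_eq)
      show "(\<lambda>j. (1 / 2) ^ j * I) sums (2 * I)"
        using sums_mult2[OF geometric_sums[of "1 / 2 :: real"], of I] by simp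
    qed (use I0 in simp)
    finally show ?thesis .
  qed
  have sV: "AE x in N. summable (\<lambda>j. V j x)"
  proof -
    have "AE x in N. (\<Sum>j. ennreal (V j x)) \<noteq> \<infinity>"
      using S by (intro nn_integral_noteq_infinite) (auto simp: top_unique)
    then show ?thesis
      by eventually_elim (use V0 in \<open>auto intro: summable_suminf_not_top\<close>)
  qed
  define W where "W x = (\<Sum>j. V j x)" for x
  have [measurable]: "W \<in> borel_measurable N" unfolding W_def by measurable
  have W0: "AE x in N. 0 \<le> W x"
    using sV by eventually_elim (auto simp: W_def V0 suminf_nonneg)
  have W_nn: "(\<integral>\<^sup>+x. ennreal (W x) \<partial>N) \<le> ennreal (2 * I)"
  proof -
    have "(\<integral>\<^sup>+x. ennreal (W x) \<partial>N) = (\<integral>\<^sup>+x. (\<Sum>j. ennreal (V j x)) \<partial>N)"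
      using sV by (intro nn_integral_cong_AE) (auto elim!: eventually_mono simp: W_def V0 suminf_ennreal2)
    then show ?thesis using S by simp
  qed
  have iW: "integrable N W"
  proof (rule integrableI_bounded)
    have "(\<integral>\<^sup>+x. ennreal (norm (W x)) \<partial>N) = (\<integral>\<^sup>+x. ennreal (W x) \<partial>N)"
      using W0 by (intro nn_integral_cong_AE) auto
    then show "(\<integral>\<^sup>+x. ennreal (norm (W x)) \<partial>N) < \<infinity>"
      using W_nn by (auto intro: le_less_trans)
  qed simp
  have W_le: "(LINT x|N. W x) \<le> 2 * I"
    using W_nn nn_integral_eq_integral[OF iW W0] I0 by simp
  \<comment> \<open>Each \<open>V j\<close> is at most \<open>W\<close>, and the q-th root of
    \<open>V j\<close> is 2^j |u j|; hence the root of \<open>W\<close> is the common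
    majorant.\<close>
  define G where "G x = W x powr (1 / q)" for x
  have [measurable]: "G \<in> borel_measurable N" unfolding G_def by measurable
  have G0: "0 \<le> G x" for x by (simp add: G_def)
  have Gq: "AE x in N. G x powr q = W x"
    using W0 by eventually_elim (use q in \<open>auto simp: G_def powr_powr\<close>)
  have GL: "(\<lambda>x. of_real (G x)) \<in> Lspace q N"
  proof -
    have "integrable N (\<lambda>x. G x powr q)"
      by (rule integrable_cong_AE_imp[OF iW]) (use Gq in \<open>auto elim: eventually_mono\<close>)
    then show ?thesis by (simp add: Lspace_def G0)
  qed
  have uG: "AE x in N. \<forall>j. norm (u j x) \<le> (1 / 2) ^ j * G x"
    using sV
  proof eventually_elim
    case (elim x)
    show ?case
    proof
      fix j
      have "V j x \<le> W x"
        using sum_le_suminf[OF elim, of "{j}"] V0 by (simp add: W_def)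
      then have "V j x powr (1 / q) \<le> G x"
        unfolding G_def using q V0 by (intro powr_mono2) auto
      then have "2 ^ j * norm (u j x) \<le> G x"
        using q by (simp add: V_def powr_mult powr_powr powr_realpow)
      then show "norm (u j x) \<le> (1 / 2) ^ j * G x"
        by (simp add: field_simps power_divide)
    qed
  qed
  define f where "f x = (\<Sum>j. u j x)" for x
  have [measurable]: "f \<in> borel_measurable N" unfolding f_def by measurable
  have geo: "summable (\<lambda>j. (1 / 2) ^ j * c)" "(\<Sum>j. (1 / 2) ^ j * c) = 2 * c" for c :: real
    using sums_mult2[OF geometric_sums[of "1 / 2 :: real"], of c] by (auto simp: sums_iff)
  have su: "AE x in N. (\<lambda>j. u j x) sums f x"
    using uG
  proof eventually_elim
    case (elim x)
    then have "summable (\<lambda>j. u j x)"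
      by (intro summable_comparison_test'[OF geo(1)]) auto
    then show ?case by (simp add: f_def summable_sums)
  qed
  have part: "AE x in N. \<forall>m. norm (\<Sum>j<m. u j x) \<le> 2 * G x"
    using uG
  proof eventually_elim
    case (elim x)
    show ?case
    proof
      fix m
      have "norm (\<Sum>j<m. u j x) \<le> (\<Sum>j<m. (1 / 2) ^ j * G x)"
        using elim by (intro sum_norm_le) auto
      also have "\<dots> \<le> 2 * G x"
        using sum_le_suminf[OF geo(1)[of "G x"], of "{..<m}"] geo(2)[of "G x"] G0 by simp
      finally show "norm (\<Sum>j<m. u j x) \<le> 2 * G x" .
    qed
  qed
  have fG: "AE x in N. norm (f x) \<le> 2 * G x"
    using part su
  proof eventually_elim
    case (elim x)
    have "(\<lambda>m. norm (\<Sum>j<m. u j x)) \<longlonglongrightarrow> norm (f x)"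
      using elim(2) by (intro tendsto_norm) (simp add: sums_def)
    then show ?case using elim(1) by (intro LIMSEQ_le_const2) auto
  qed
  have fL: "f \<in> Lspace q N"
    by (rule Lspace_bound[OF Lspace_mult[OF GL, of 2]])
      (use fG G0 q in \<open>auto simp: norm_mult\<close>)
  \<comment> \<open>Origin of 2^(q + 1): |f| <= 2 G contributes 2^q, and the integral of
    \<open>W\<close> is at most 2 I.\<close>
  have f_norm: "(LINT x|N. norm (f x) powr q) \<le> 2 powr (q + 1) * I"
  proof -
    have "(LINT x|N. norm (f x) powr q) \<le> (LINT x|N. 2 powr q * W x)"
    proof (rule integral_mono_AE)
      show "AE x in N. norm (f x) powr q \<le> 2 powr q * W x"
        using fG Gq
      proof eventually_elim
        case (elim x)
        have "norm (f x) powr q \<le> (2 * G x) powr q"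
          using elim(1) q by (intro powr_mono2) auto
        then show ?case using elim(2) by (simp add: powr_mult)
      qed
    qed (use iW Lspace_integrable[OF fL] in auto)
    also have "\<dots> \<le> 2 powr q * (2 * I)" using W_le by simp
    also have "\<dots> = 2 powr (q + 1) * I" by (simp add: powr_add)
    finally show ?thesis .
  qed
  have iuj: "AE x in N. \<forall>j. integrable N (\<lambda>y. of_real (k x y) * u j y)"
    using kernel_op_Lspace(1)[OF uL q] by (simp add: AE_all_countable)
  have "AE x in N. f x + of_real s * kernel_op N k f x = h x"
    using iuj kernel_op_Lspace(1)[OF GL q] su AE_space
  proof eventually_elim
    case (elim x)
    have [measurable]: "k x \<in> borel_measurable N" using k_row_integral[OF elim(4)] by auto
    have lim: "(\<lambda>m. LINT y|N. of_real (k x y) * (\<Sum>j<m. u j y)) \<longlonglongrightarrow> kernel_op N k f x"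
      unfolding kernel_op_def
    proof (rule integral_dominated_convergence[where w = "\<lambda>y. 2 * (k x y * G y)"])
      show "integrable N (\<lambda>y. 2 * (k x y * G y))"
        using integrable_norm[OF elim(2)] k_nonneg G0 by (simp add: norm_mult)
      show "AE y in N. (\<lambda>m. of_real (k x y) * (\<Sum>j<m. u j y)) \<longlonglongrightarrow> of_real (k x y) * f y"
        using su by eventually_elim (auto simp: sums_def intro!: tendsto_mult)
      show "AE y in N. norm (of_real (k x y) * (\<Sum>j<m. u j y)) \<le> 2 * (k x y * G y)" for m
        using part
      proof eventually_elim
        case (elim y)
        then have "k x y * norm (\<Sum>j<m. u j y) \<le> k x y * (2 * G y)"
          using k_nonneg by (intro mult_left_mono) auto
        then show ?case by (simp add: norm_mult k_nonneg)
      qed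
    qed measurable
    \<comment> \<open>As \<open>u (Suc j)\<close> is - s K applied to \<open>u j\<close>, applying s
      K to a partial sum shifts the series by one place; in the limit s K f becomes h - f.\<close>
    have "(LINT y|N. of_real (k x y) * (\<Sum>j<m. u j y)) = (\<Sum>j<m. kernel_op N k (u j) x)" for m
      using elim(1) by (simp add: sum_distrib_left kernel_op_def)
    then have "of_real s * (LINT y|N. of_real (k x y) * (\<Sum>j<m. u j y)) = - (\<Sum>j<m. u (Suc j) x)" for m
      by (simp add: u_Suc sum_distrib_left sum_negf)
    with tendsto_mult_left[OF lim, of "of_real s"]
    have "(\<lambda>m. - (\<Sum>j<m. u (Suc j) x)) \<longlonglongrightarrow> of_real s * kernel_op N k f x" by simp
    from tendsto_minus[OF this]
    have "(\<lambda>j. u (Suc j) x) sums (- (of_real s * kernel_op N k f x))" by (simp add: sums_def)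
    moreover have "(\<lambda>j. u (Suc j) x) sums (f x - h x)"
      using sums_Suc_iff[of "\<lambda>j. u j x" "f x - h x"] elim(3) by (simp add: u_0)
    ultimately have "f x - h x = - (of_real s * kernel_op N k f x)" by (rule sums_unique2[symmetric])
    then show ?case by (simp add: algebra_simps)
  qed
  then show ?thesis using that[OF fL _ f_norm[unfolded I_def]] by blast
qed

end

section \<open>Compactly supported functions with integrable second derivative\<close>

text \<open>Taking \<open>f1\<close> as the primitive of \<open>f2\<close> from minus infinity
  encodes its absolute continuity, so that \<open>f2\<close> is only a representative of the second
  derivative up to null sets, whereas f is differentiable at every point of the line.\<close>

definition C1_triple ::
  "real set \<Rightarrow> (real \<Rightarrow> complex) \<Rightarrow> (real \<Rightarrow> complex) \<Rightarrow> (real \<Rightarrow> complex) \<Rightarrow> bool" where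
  "C1_triple S f f1 f2 \<longleftrightarrow>
     integrable lborel f2 \<and> (\<forall>x. x \<notin> S \<longrightarrow> f x = 0 \<and> f2 x = 0) \<and>
     (\<forall>x. f1 x = (LINT t|lborel. indicator {..x} t *\<^sub>R f2 t)) \<and>
     (\<forall>x. (f has_vector_derivative f1 x) (at x))"

lemma C1_tripleD:
  assumes "C1_triple S f f1 f2"
  shows "integrable lborel f2" "f2 \<in> borel_measurable borel"
    "x \<notin> S \<Longrightarrow> f x = 0" "x \<notin> S \<Longrightarrow> f2 x = 0"
    "f1 x = (LINT t|lborel. indicator {..x} t *\<^sub>R f2 t)"
    "(f has_vector_derivative f1 x) (at x)"
  using assms borel_measurable_integrable[of lborel f2] by (auto simp: C1_triple_def)

lemma integrable_indicator_scaleR: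
  fixes f :: "real \<Rightarrow> 'b::{banach, second_countable_topology}"
  assumes "integrable lborel f" "X \<in> sets borel"
  shows "integrable lborel (\<lambda>t. indicator X t *\<^sub>R f t)"
  using integrable_mult_indicator[of X lborel f] assms by simp

lemma indefinite_integral_continuous_on:
  fixes h :: "real \<Rightarrow> 'b::{banach, second_countable_topology}"
  assumes h: "integrable lborel h"
  shows "continuous_on X (\<lambda>x. LINT t|lborel. indicator {..x} t *\<^sub>R h t)"
proof (intro continuous_at_imp_continuous_on ballI)
  fix x
  have [measurable]: "h \<in> borel_measurable borel" using borel_measurable_integrable[OF h] by simp
  have "((\<lambda>n. LINT t|lborel. indicator {..xs n} t *\<^sub>R h t) \<longlongrightarrow> (LINT t|lborel. indicator {..x} t *\<^sub>R h t)) sequentially"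
    if "xs \<longlonglongrightarrow> x" for xs
  proof (rule integral_dominated_convergence[where w = "\<lambda>t. norm (h t)"])
    show "AE t in lborel. (\<lambda>i. indicator {..xs i} t *\<^sub>R h t) \<longlonglongrightarrow> indicator {..x} t *\<^sub>R h t"
      using AE_lborel_singleton[of x]
    proof eventually_elim
      case (elim t)
      have "\<forall>\<^sub>F i in sequentially. indicator {..xs i} t = (indicator {..x} t :: real)"
      proof (cases "t < x")
        case True
        then show ?thesis using order_tendstoD(1)[OF that, of t] by (auto elim!: eventually_mono)
      next
        case False
        then show ?thesis using elim order_tendstoD(2)[OF that, of t] by (auto elim!: eventually_mono)
      qed
      then show ?case by (intro tendsto_eventually) (auto elim!: eventually_mono)
    qed
  qed (use h in \<open>auto simp: indicator_def\<close>)
  then show "isCont (\<lambda>x. LINT t|lborel. indicator {..x} t *\<^sub>R h t) x"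
    by (simp add: continuous_at_sequentially comp_def)
qed

lemma C1_triple_lincomb:
  assumes f: "C1_triple S f f1 f2" and g: "C1_triple S g g1 g2"
  shows "C1_triple S (\<lambda>x. c * f x + d * g x) (\<lambda>x. c * f1 x + d * g1 x) (\<lambda>x. c * f2 x + d * g2 x)"
proof -
  note fD = C1_tripleD[OF f] and gD = C1_tripleD[OF g]
  have "((\<lambda>x. c * f x + d * g x) has_vector_derivative c * f1 x + d * g1 x) (at x)" for x
    by (auto intro!: derivative_eq_intros fD(6) gD(6))
  moreover have "c * f1 x + d * g1 x = (LINT t|lborel. indicator {..x} t *\<^sub>R (c * f2 t + d * g2 t))" for x
  proof -
    have "(LINT t|lborel. indicator {..x} t *\<^sub>R (c * f2 t + d * g2 t))
        = (LINT t|lborel. c * (indicator {..x} t *\<^sub>R f2 t) + d * (indicator {..x} t *\<^sub>R g2 t))"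
      by (intro Bochner_Integration.integral_cong) (auto simp: algebra_simps scaleR_conv_of_real)
    also have "\<dots> = c * f1 x + d * g1 x"
      using integrable_indicator_scaleR[OF fD(1), of "{..x}"] integrable_indicator_scaleR[OF gD(1), of "{..x}"]
      by (simp add: fD(5) gD(5) del: mult_scaleR_right)
    finally show ?thesis ..
  qed
  ultimately show ?thesis using fD gD by (auto simp: C1_triple_def)
qed

lemma C1_triple_Re:
  assumes f: "C1_triple S f f1 f2"
  shows "C1_triple S (\<lambda>x. of_real (Re (f x))) (\<lambda>x. of_real (Re (f1 x))) (\<lambda>x. of_real (Re (f2 x)))"
proof -
  note fD = C1_tripleD[OF f]
  have "((\<lambda>x. complex_of_real (Re (f x))) has_vector_derivative complex_of_real (Re (f1 x))) (at x)" for x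
    using bounded_linear.has_vector_derivative[OF bounded_linear_compose
        [OF bounded_linear_of_real[where 'a = complex] bounded_linear_Re] fD(6)]
    by simp
  moreover have "complex_of_real (Re (f1 x)) = (LINT t|lborel. indicator {..x} t *\<^sub>R complex_of_real (Re (f2 t)))" for x
  proof -
    have "(LINT t|lborel. indicator {..x} t *\<^sub>R complex_of_real (Re (f2 t)))
        = (LINT t|lborel. complex_of_real (Re (indicator {..x} t *\<^sub>R f2 t)))"
      by (intro Bochner_Integration.integral_cong) (auto simp: scaleR_conv_of_real)
    also have "\<dots> = of_real (Re (f1 x))"
      unfolding fD(5)
      by (rule integral_bounded_linear[OF bounded_linear_compose[OF bounded_linear_of_real bounded_linear_Re]
          integrable_indicator_scaleR[OF fD(1), of "{..x}"]]) simp
    finally show ?thesis ..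
  qed
  ultimately show ?thesis using fD by (auto simp: C1_triple_def)
qed

locale bounded_support =
  fixes S :: "real set" and R :: real
  assumes S_compact: "compact S" and S_bound: "S \<subseteq> {- R..R}" and R_pos: "0 < R"
begin

lemma S_borel [measurable]: "S \<in> sets borel"
  using S_compact by (simp add: borel_closed compact_imp_closed)

lemma S_lmeas: "emeasure lborel S \<le> ennreal (2 * R)" "measure lborel S \<le> 2 * R"
  "emeasure lborel S < \<infinity>"
proof -
  have "emeasure lborel S \<le> emeasure lborel {- R..R}"
    using S_bound by (intro emeasure_mono) auto
  also have "\<dots> = ennreal (2 * R)" using R_pos by simp
  finally show *: "emeasure lborel S \<le> ennreal (2 * R)" .
  then show "emeasure lborel S < \<infinity>" by (auto intro: le_less_trans)
  show "measure lborel S \<le> 2 * R"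
    using * R_pos by (simp add: measure_def enn2real_leI)
qed

context
  fixes f f1 f2 :: "real \<Rightarrow> complex"
  assumes tr: "C1_triple S f f1 f2"
begin

lemmas trD = C1_tripleD[OF tr]

lemma f2_borel [measurable]: "f2 \<in> borel_measurable borel"
  by (rule trD(2))

lemma f_cont: "continuous_on X f"
  by (intro continuous_at_imp_continuous_on ballI has_vector_derivative_continuous[OF trD(6)])

lemma f_borel [measurable]: "f \<in> borel_measurable borel"
  by (intro borel_measurable_continuous_onI f_cont)

lemma f1_diff:
  assumes "u \<le> v"
  shows "f1 v - f1 u = (LINT t|lborel. indicator {u<..v} t *\<^sub>R f2 t)"
proof -
  have "f1 v - f1 u = (LINT t|lborel. indicator {..v} t *\<^sub>R f2 t - indicator {..u} t *\<^sub>R f2 t)"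
    using integrable_indicator_scaleR[OF trD(1), of "{..v}"] integrable_indicator_scaleR[OF trD(1), of "{..u}"]
    by (simp add: trD(5))
  also have "\<dots> = (LINT t|lborel. indicator {u<..v} t *\<^sub>R f2 t)"
    using assms by (intro Bochner_Integration.integral_cong) (auto simp: indicator_def)
  finally show ?thesis .
qed

lemma f1_diff_norm:
  assumes "\<bar>z - x\<bar> \<le> a"
  shows "norm (f1 z - f1 x) \<le> (LINT u|lborel. indicator {-a..a} u * norm (f2 (x + u)))"
proof -
  have i: "integrable lborel (\<lambda>t. indicator {x-a..x+a} t * norm (f2 t))"
    using integrable_indicator_scaleR[OF integrable_norm[OF trD(1)], of "{x-a..x+a}"] by simp
  have *: "norm (f1 v - f1 u) \<le> (LINT t|lborel. indicator {x-a..x+a} t * norm (f2 t))"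
    if "u \<le> v" "{u<..v} \<subseteq> {x-a..x+a}" for u v
  proof -
    have "norm (f1 v - f1 u) \<le> (LINT t|lborel. norm (indicator {u<..v} t *\<^sub>R f2 t))"
      unfolding f1_diff[OF that(1)] by (rule integral_norm_bound)
    also have "\<dots> \<le> (LINT t|lborel. indicator {x-a..x+a} t * norm (f2 t))"
    proof (rule integral_mono)
      show "integrable lborel (\<lambda>t. norm (indicator {u<..v} t *\<^sub>R f2 t))"
        by (rule integrable_norm[OF integrable_indicator_scaleR[OF trD(1)]]) simp
      show "norm (indicator {u<..v} t *\<^sub>R f2 t) \<le> indicator {x-a..x+a} t * norm (f2 t)" for t
        using subsetD[OF that(2), of t] by (simp add: indicator_def)
    qed (rule i)
    finally show ?thesis .
  qed
  have "norm (f1 z - f1 x) \<le> (LINT t|lborel. indicator {x-a..x+a} t * norm (f2 t))"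
  proof (cases "x \<le> z")
    case True
    moreover have "{x<..z} \<subseteq> {x-a..x+a}" using True assms by auto
    ultimately show ?thesis by (rule *)
  next
    case False
    then have "z \<le> x" "{z<..x} \<subseteq> {x-a..x+a}" using assms by auto
    then show ?thesis using *[of z x] by (simp only: norm_minus_commute)
  qed
  also have "\<dots> = (LINT u|lborel. indicator {x-a..x+a} (x + 1 * u) * norm (f2 (x + 1 * u)))"
    using lborel_integral_real_affine[of 1 "\<lambda>t. indicator {x-a..x+a} t * norm (f2 t)" x] by simp
  also have "\<dots> = (LINT u|lborel. indicator {-a..a} u * norm (f2 (x + u)))"
    by (intro Bochner_Integration.integral_cong) (auto simp: indicator_def)
  finally show ?thesis .
qed

text \<open>The mean value inequality, with the oscillation of \<open>f1\<close> on the interval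
  estimated by \<open>f2\<close>. The window is translated to the origin so that the bound can be
  integrated in x by \<open>window_integral\<close>, which brings a second factor |y|.\<close>

lemma taylor_bound:
  "norm (f (x + y) - f x - y *\<^sub>R f1 x)
     \<le> \<bar>y\<bar> * (LINT u|lborel. indicator {-\<bar>y\<bar>..\<bar>y\<bar>} u * norm (f2 (x + u)))"
proof -
  have B: "norm (f1 z - f1 x) \<le> (LINT u|lborel. indicator {-\<bar>y\<bar>..\<bar>y\<bar>} u * norm (f2 (x + u)))"
    if "z \<in> cball x \<bar>y\<bar>" for z
    using f1_diff_norm[of z x "\<bar>y\<bar>"] that by (simp add: dist_real_def abs_minus_commute)
  have cs: "closed_segment x (x + y) \<subseteq> cball x \<bar>y\<bar>"
    by (intro closed_segment_subset) (auto simp: dist_real_def)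
  have "norm (f (x + y) - f x - (x + y - x) *\<^sub>R f1 x) \<le> norm (x + y - x) *
      (LINT u|lborel. indicator {-\<bar>y\<bar>..\<bar>y\<bar>} u * norm (f2 (x + u)))"
    by (rule vector_differentiable_bound_linearization[where S = "cball x \<bar>y\<bar>" and f' = f1])
      (use B cs has_vector_derivative_at_within[OF trD(6)] in simp_all)
  then show ?thesis by simp
qed

lemma f1_bound: "norm (f1 x) \<le> (LINT t|lborel. norm (f2 t))"
proof -
  have "norm (f1 x) \<le> (LINT t|lborel. norm (indicator {..x} t *\<^sub>R f2 t))"
    unfolding trD(5)[of x] by (rule integral_norm_bound)
  also have "\<dots> \<le> (LINT t|lborel. norm (f2 t))"
    using integrable_norm[OF integrable_indicator_scaleR[OF trD(1), of "{..x}"]] integrable_norm[OF trD(1)]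
    by (intro integral_mono) (auto simp: indicator_def)
  finally show ?thesis .
qed

lemma f1_zero:
  assumes "x \<notin> S"
  shows "f1 x = 0"
proof -
  have "open (- S)" using S_compact by (simp add: compact_imp_closed open_Compl)
  then have "(f has_vector_derivative 0) (at x)"
    by (rule has_vector_derivative_transform_within_open[where S = "- S" and f = "\<lambda>_. 0",
          OF has_vector_derivative_const])
      (use assms trD(3) in auto)
  then show ?thesis using vector_derivative_unique_at[OF _ trD(6)] by metis
qed

lemma f_bound: "norm (f x) \<le> 2 * (R + 1) * (LINT t|lborel. norm (f2 t))"
proof (cases "x \<in> S")
  case False
  then show ?thesis using trD(3) R_pos by simp
next
  case True
  \<comment> \<open>A point to the left of S, where f and \<open>f1\<close> vanish, at distance at
    most 2 (R + 1) from every point of S.\<close>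
  define a where "a = - R - 1"
  have a: "a \<notin> S" "a < x" "x - a \<le> 2 * (R + 1)" using True S_bound by (auto simp: a_def)
  have "norm (f x - f a - (x - a) *\<^sub>R f1 a) \<le> norm (x - a) * (LINT t|lborel. norm (f2 t))"
    by (rule vector_differentiable_bound_linearization[where S = UNIV and f' = f1])
      (use f1_zero[OF a(1)] f1_bound trD(6) in auto)
  also have "\<dots> \<le> 2 * (R + 1) * (LINT t|lborel. norm (f2 t))"
    using a by (intro mult_right_mono) auto
  finally show ?thesis using f1_zero[OF a(1)] trD(3)[OF a(1)] by simp
qed

lemma f1_cont: "continuous_on X f1"
proof -
  have "f1 = (\<lambda>x. LINT t|lborel. indicator {..x} t *\<^sub>R f2 t)" using trD(5) by blast
  then show ?thesis using indefinite_integral_continuous_on[OF trD(1)] by simp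
qed

lemma f1_borel [measurable]: "f1 \<in> borel_measurable borel"
  by (intro borel_measurable_continuous_onI f1_cont)

lemma bounded_integrable:
  fixes g :: "real \<Rightarrow> 'b::{banach, second_countable_topology}"
  assumes "g \<in> borel_measurable borel" "\<And>x. norm (g x) \<le> K" "\<And>x. x \<notin> S \<Longrightarrow> g x = 0"
  shows "integrable lborel g"
proof (rule Bochner_Integration.integrable_bound)
  show "integrable lborel (\<lambda>x. K * indicator S x :: real)"
    using S_lmeas(3) by simp
  have "norm (g x) \<le> norm (K * indicator S x :: real)" for x
    using assms(2)[of x] assms(3)[of x] by (cases "x \<in> S") auto
  then show "AE x in lborel. norm (g x) \<le> norm (K * indicator S x :: real)" by simp
qed (use assms in simp)

lemma f_integrable: "integrable lborel f"
  by (rule bounded_integrable[OF f_borel f_bound]) (use trD in auto)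

lemma f1_integrable: "integrable lborel f1"
  by (rule bounded_integrable[OF f1_borel f1_bound f1_zero])

text \<open>Integration by parts; \<open>f1\<close> is only absolutely continuous, so this is Fubini's theorem on
  the triangle.\<close>

lemma by_parts:
  fixes u u' :: "real \<Rightarrow> complex"
  assumes u: "\<And>t. (u has_vector_derivative u' t) (at t)" and u': "continuous_on UNIV u'"
    and a: "\<And>t. t < a \<Longrightarrow> t \<notin> S" and ax: "a \<le> x"
  shows "(LINT t|lborel. indicator {a..x} t *\<^sub>R (u' t * f1 t))
      + (LINT t|lborel. indicator {a..x} t *\<^sub>R (u t * f2 t)) = u x * f1 x"
proof -
  have [measurable]: "u' \<in> borel_measurable borel" using u' by (rule borel_measurable_continuous_onI)
  have ucont: "continuous_on X u" for X
    by (intro continuous_at_imp_continuous_on ballI has_vector_derivative_continuous[OF u])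
  have [measurable]: "u \<in> borel_measurable borel" by (rule borel_measurable_continuous_onI[OF ucont])
  have "compact (u' ` {a..x})" "compact (u ` {a..x})"
    using u' ucont by (auto intro!: compact_continuous_image intro: continuous_on_subset)
  then have "\<exists>K. \<forall>t\<in>{a..x}. norm (u' t) \<le> K" "\<exists>K. \<forall>t\<in>{a..x}. norm (u t) \<le> K"
    by (auto dest!: compact_imp_bounded simp: bounded_iff)
  then obtain K K' where K: "\<And>t. t \<in> {a..x} \<Longrightarrow> norm (u' t) \<le> K"
    and K': "\<And>t. t \<in> {a..x} \<Longrightarrow> norm (u t) \<le> K'"
    by blast
  have iu: "integrable lborel (\<lambda>t. indicator {a..x} t *\<^sub>R (u t * f2 t))"
  proof (rule Bochner_Integration.integrable_bound[OF integrable_mult_right[OF integrable_norm[OF trD(1)], of K']])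
    show "AE t in lborel. norm (indicator {a..x} t *\<^sub>R (u t * f2 t)) \<le> norm (K' * norm (f2 t))"
      using K' by (auto simp: indicator_def norm_mult intro!: AE_I2 mult_right_mono order_trans[OF _ abs_ge_self])
  qed simp
  have K0: "0 \<le> K" using order_trans[OF norm_ge_zero K[of a]] ax by simp
  \<comment> \<open>The integrand on the triangle s <= t. Integrating in s first gives u' f1;
    integrating in t first gives (u x - u s) f2 s. Points s < a carry f2 s = 0.\<close>
  define H where "H t s = (if a \<le> t \<and> t \<le> x \<and> s \<le> t then u' t * f2 s else 0)" for t s
  have iH: "integrable (lborel \<Otimes>\<^sub>M lborel) (\<lambda>(t, s). H t s)"
  proof (rule Bochner_Integration.integrable_bound)
    have *: "integrable lborel (\<lambda>t. K * indicator {a..x} t :: real)"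
      by (intro integrable_mult_right integrable_real_indicator) (auto simp: emeasure_lborel_Icc_eq)
    show "integrable (lborel \<Otimes>\<^sub>M lborel) (\<lambda>(t, s). (K * indicator {a..x} t) * norm (f2 s))"
    proof (rule lborel_pair.Fubini_integrable)
      show "integrable lborel (\<lambda>t. LINT s|lborel. norm (case (t, s) of (t, s) \<Rightarrow> (K * indicator {a..x} t) * norm (f2 s)))"
        using integrable_mult_left[OF integrable_abs[OF *], of "LINT s|lborel. norm (f2 s)"]
        by (simp add: abs_mult)
      show "AE t in lborel. integrable lborel (\<lambda>s. case (t, s) of (t, s) \<Rightarrow> (K * indicator {a..x} t) * norm (f2 s))"
        using integrable_norm[OF trD(1)] by simp
    qed measurable
    show "AE z in lborel \<Otimes>\<^sub>M lborel. norm (case z of (t, s) \<Rightarrow> H t s)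
        \<le> norm (case z of (t, s) \<Rightarrow> (K * indicator {a..x} t) * norm (f2 s))"
      using K K0 by (auto simp: H_def indicator_def norm_mult abs_mult intro!: AE_I2 mult_right_mono)
    show "(\<lambda>(t, s). H t s) \<in> borel_measurable (lborel \<Otimes>\<^sub>M lborel)"
      unfolding H_def by measurable
  qed
  have "(LINT t|lborel. LINT s|lborel. H t s) = (LINT s|lborel. LINT t|lborel. H t s)"
    using lborel_pair.Fubini_integral[OF iH] by (simp only: prod.case)
  moreover have "(LINT s|lborel. H t s) = indicator {a..x} t *\<^sub>R (u' t * f1 t)" for t
  proof -
    have "H t s = (indicator {a..x} t *\<^sub>R u' t) * (indicator {..t} s *\<^sub>R f2 s)" for s
      by (auto simp: H_def indicator_def)
    then show ?thesis by (simp add: trD(5) del: mult_scaleR_right)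
  qed
  moreover have "(LINT t|lborel. H t s) = u x * (indicator {..x} s *\<^sub>R f2 s) - indicator {a..x} s *\<^sub>R (u s * f2 s)" for s
  proof (cases "s \<in> {a..x}")
    case True
    have "(LINT t|lborel. H t s) = (LINT t|lborel. (indicator {s..x} t *\<^sub>R u' t) * f2 s)"
      using True by (intro Bochner_Integration.integral_cong) (auto simp: H_def indicator_def)
    also have "\<dots> = (LINT t|lborel. indicator {s..x} t *\<^sub>R u' t) * f2 s"
      by (rule integral_mult_left_zero)
    also have "(LINT t|lborel. indicator {s..x} t *\<^sub>R u' t) = u x - u s"
    proof (rule integral_FTC_atLeastAtMost)
      show "(u has_vector_derivative u' t) (at t within {s..x})" for t
        by (rule has_vector_derivative_at_within[OF u])
      show "continuous_on {s..x} u'" by (rule continuous_on_subset[OF u']) simp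
    qed (use True in simp)
    finally show ?thesis using True by (simp add: left_diff_distrib)
  next
    case False
    have "H t s = 0" for t
    proof (cases "s < a")
      case True
      then show ?thesis using a trD(4) by (simp add: H_def)
    qed (use False in \<open>auto simp: H_def indicator_def\<close>)
    moreover have "indicator {..x} s *\<^sub>R f2 s = 0"
      using False a trD(4) by (auto simp: indicator_def)
    ultimately show ?thesis using False by auto
  qed
  ultimately have "(LINT t|lborel. indicator {a..x} t *\<^sub>R (u' t * f1 t))
      = (LINT s|lborel. u x * (indicator {..x} s *\<^sub>R f2 s) - indicator {a..x} s *\<^sub>R (u s * f2 s))"
    by (simp only:)
  also have "\<dots> = u x * f1 x - (LINT s|lborel. indicator {a..x} s *\<^sub>R (u s * f2 s))"
    unfolding trD(5) integral_mult_right_zero[symmetric]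
    by (intro Bochner_Integration.integral_diff iu integrable_mult_right
        integrable_indicator_scaleR[OF trD(1)]) simp
  finally show ?thesis by (simp only: diff_add_cancel)
qed

end

end

section \<open>The generator on such functions\<close>

text \<open>By the condition on a Levy triple this measure is finite, whereas the Levy measure may
  be infinite near 0. Finiteness is what makes Fubini's theorem and Jensen's inequality available
  for the jump part.\<close>

definition jump_measure :: "real measure \<Rightarrow> real measure" where
  "jump_measure \<nu> = density \<nu> (\<lambda>y. ennreal (y\<^sup>2 / (1 + y\<^sup>2)))"

text \<open>The factor compensates the density of \<open>jump_measure\<close>; at \<open>y = 0\<close> it is \<open>0\<close>, which
  disposes of a possible (even infinite) atom of the Levy measure at the origin.\<close>

definition jump_weight :: "real \<Rightarrow> real" where
  "jump_weight y = (1 + y\<^sup>2) / y\<^sup>2"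

definition increment :: "(real \<Rightarrow> complex) \<Rightarrow> (real \<Rightarrow> complex) \<Rightarrow> real \<Rightarrow> real \<Rightarrow> complex" where
  "increment f f1 x y = jump_weight y *\<^sub>R (f (x + y) - f x - (y * indicator {-1..1} y) *\<^sub>R f1 x)"

text \<open>The generator with the derivatives as arguments: \<open>f2\<close> is determined only up
  to null sets, and linear combinations and compositions come with explicit formulas for their
  derivatives.\<close>

definition levy_op ::
  "real \<Rightarrow> real \<Rightarrow> real measure \<Rightarrow> (real \<Rightarrow> complex) \<Rightarrow> (real \<Rightarrow> complex) \<Rightarrow> (real \<Rightarrow> complex) \<Rightarrow> real \<Rightarrow> complex"
  where
  "levy_op A \<gamma> \<nu> f f1 f2 x =
     (A / 2) *\<^sub>R f2 x + \<gamma> *\<^sub>R f1 x + (LINT y|jump_measure \<nu>. increment f f1 x y)"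

lemma jump_weight_borel [measurable]: "jump_weight \<in> borel_measurable borel"
  unfolding jump_weight_def by measurable

lemma jump_weight_bounds:
  "0 \<le> jump_weight y"
  "\<bar>y\<bar> \<le> 1 \<Longrightarrow> y \<noteq> 0 \<Longrightarrow> jump_weight y * \<bar>y\<bar> \<le> 2 / \<bar>y\<bar>"
  "1 < \<bar>y\<bar> \<Longrightarrow> jump_weight y \<le> 2"
proof -
  show "0 \<le> jump_weight y" by (simp add: jump_weight_def)
  show "jump_weight y * \<bar>y\<bar> \<le> 2 / \<bar>y\<bar>" if "\<bar>y\<bar> \<le> 1" "y \<noteq> 0"
  proof -
    have "y\<^sup>2 \<le> 1" using that by (simp add: abs_square_le_1)
    moreover have "jump_weight y * \<bar>y\<bar> = (1 + y\<^sup>2) / \<bar>y\<bar>"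
      using that by (simp add: jump_weight_def power2_eq_square field_simps flip: abs_mult)
    ultimately show ?thesis by (simp add: divide_right_mono)
  qed
  show "jump_weight y \<le> 2" if "1 < \<bar>y\<bar>"
  proof -
    have "1 \<le> y\<^sup>2" using that by (metis abs_1 less_imp_le abs_le_square_iff one_power2 abs_of_nonneg zero_le_one)
    then show ?thesis by (simp add: jump_weight_def divide_le_eq)
  qed
qed

text \<open>Fubini and translation invariance: all shifts of w have the same integral, and the
  window has length 2 a.\<close>

lemma window_integral:
  fixes w :: "real \<Rightarrow> real"
  assumes w: "integrable lborel w" and w0: "\<And>x. 0 \<le> w x" and a: "0 \<le> a"
  shows "integrable lborel (\<lambda>x. LINT u|lborel. indicator {-a..a} u * w (x + u))"
    and "(LINT x|lborel. LINT u|lborel. indicator {-a..a} u * w (x + u)) = 2 * a * (LINT x|lborel. w x)"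
    and "AE x in lborel. integrable lborel (\<lambda>u. indicator {-a..a} u * w (x + u))"
proof -
  have [measurable]: "w \<in> borel_measurable borel" using borel_measurable_integrable[OF w] by simp
  have wu: "integrable lborel (\<lambda>x. w (x + u))" "(LINT x|lborel. w (x + u)) = (LINT x|lborel. w x)" for u
    using lborel_integrable_real_affine[OF w, of 1 u] lborel_integral_real_affine[of 1 w u]
    by (simp_all add: add.commute)
  have ind: "integrable lborel (indicator {-a..a} :: real \<Rightarrow> real)"
    by (intro integrable_real_indicator) (auto simp: emeasure_lborel_Icc_eq)
  define H where "H u x = indicator {-a..a} u * w (x + u)" for u x
  have H: "integrable (lborel \<Otimes>\<^sub>M lborel) (\<lambda>(u, x). H u x)"
  proof (rule lborel_pair.Fubini_integrable)
    show "(\<lambda>(u, x). H u x) \<in> borel_measurable (lborel \<Otimes>\<^sub>M lborel)"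
      unfolding H_def by measurable
    have "(LINT x|lborel. norm (H u x)) = indicator {-a..a} u * (LINT x|lborel. w x)" for u
      using w0 wu(2)[of u] by (simp add: H_def abs_mult)
    then show "integrable lborel (\<lambda>u. LINT x|lborel. norm (case (u, x) of (u, x) \<Rightarrow> H u x))"
      using integrable_mult_left[OF ind] by simp
    show "AE u in lborel. integrable lborel (\<lambda>x. case (u, x) of (u, x) \<Rightarrow> H u x)"
      using integrable_mult_right[OF wu(1)] by (simp add: H_def)
  qed
  show "integrable lborel (\<lambda>x. LINT u|lborel. indicator {-a..a} u * w (x + u))"
    using lborel_pair.integrable_snd[OF H] by (simp add: H_def)
  show "AE x in lborel. integrable lborel (\<lambda>u. indicator {-a..a} u * w (x + u))"
    using lborel_pair.AE_integrable_snd[OF H] by (simp add: H_def)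
  have "(LINT x|lborel. LINT u|lborel. H u x) = (LINT u|lborel. LINT x|lborel. H u x)"
    using lborel_pair.Fubini_integral[OF H] by (simp only: prod.case)
  also have "\<dots> = (LINT u|lborel. indicator {-a..a} u * (LINT x|lborel. w x))"
    using wu(2) by (simp add: H_def)
  also have "\<dots> = 2 * a * (LINT x|lborel. w x)" using a by simp
  finally show "(LINT x|lborel. LINT u|lborel. indicator {-a..a} u * w (x + u)) = 2 * a * (LINT x|lborel. w x)"
    by (simp add: H_def)
qed

locale levy_bounded_support = bounded_support +
  fixes A \<gamma> :: real and \<nu> :: "real measure"
  assumes levy: "levy_triple A \<nu>"
begin

abbreviation "\<kappa> \<equiv> jump_measure \<nu>"

lemma A_nonneg: "0 \<le> A" and sets_nu [measurable_cong]: "sets \<nu> = sets borel"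
  and int_nu: "integrable \<nu> (\<lambda>x. x\<^sup>2 / (1 + x\<^sup>2))"
  using levy by (auto simp: levy_triple_def)

lemma sets_kappa [measurable_cong, simp]: "sets \<kappa> = sets borel"
  by (simp add: jump_measure_def sets_nu)

lemma space_kappa [simp]: "space \<kappa> = UNIV"
  using sets_eq_imp_space_eq[OF sets_kappa] by simp

sublocale \<kappa>: finite_measure \<kappa>
proof (rule finite_measureI)
  have "emeasure \<kappa> (space \<kappa>) = (\<integral>\<^sup>+y. ennreal (y\<^sup>2 / (1 + y\<^sup>2)) \<partial>\<nu>)"
    unfolding jump_measure_def by (subst emeasure_density) (auto cong: nn_integral_cong_simp)
  also have "\<dots> = ennreal (LINT y|\<nu>. y\<^sup>2 / (1 + y\<^sup>2))"
    by (intro nn_integral_eq_integral int_nu) auto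
  finally show "emeasure \<kappa> (space \<kappa>) \<noteq> \<infinity>" by simp
qed

text \<open>The density of the jump measure and the weight cancel except at 0, where both are 0; the
  condition on \<open>H 0\<close> covers that point.\<close>

lemma nu_to_kappa:
  fixes H :: "real \<Rightarrow> complex"
  assumes [measurable]: "H \<in> borel_measurable borel" and H0: "H 0 = 0"
  shows "(LINT y|\<nu>. H y) = (LINT y|\<kappa>. jump_weight y *\<^sub>R H y)"
    and "integrable \<nu> H \<longleftrightarrow> integrable \<kappa> (\<lambda>y. jump_weight y *\<^sub>R H y)"
proof -
  have [simp]: "1 + y\<^sup>2 \<noteq> 0" for y :: real
    using sum_power2_gt_zero_iff[of 1 y] by simp
  have *: "(y\<^sup>2 / (1 + y\<^sup>2)) *\<^sub>R (jump_weight y *\<^sub>R H y) = H y" for y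
    using H0 by (cases "y = 0") (auto simp: jump_weight_def)
  show "(LINT y|\<nu>. H y) = (LINT y|\<kappa>. jump_weight y *\<^sub>R H y)"
    unfolding jump_measure_def by (subst integral_density) (simp_all add: * del: scaleR_scaleR)
  show "integrable \<nu> H \<longleftrightarrow> integrable \<kappa> (\<lambda>y. jump_weight y *\<^sub>R H y)"
    unfolding jump_measure_def by (subst integrable_density) (simp_all add: * del: scaleR_scaleR)
qed

sublocale L\<kappa>: pair_sigma_finite lborel \<kappa> ..

sublocale \<kappa>L: pair_sigma_finite \<kappa> lborel ..

context
  fixes f f1 f2 :: "real \<Rightarrow> complex"
  assumes tr: "C1_triple S f f1 f2"
begin

lemmas trD = C1_tripleD[OF tr]
lemmas [measurable] = f_borel[OF tr] f1_borel[OF tr] f2_borel[OF tr]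

lemma increment_borel [measurable]:
  "(\<lambda>(x, y). increment f f1 x y) \<in> borel_measurable (borel \<Otimes>\<^sub>M borel)"
  unfolding increment_def by measurable

text \<open>The weight is of order 1 / y^2 and \<open>taylor_bound\<close> supplies one factor |y|.
  The remaining 1 / |y| disappears after integration in x, because the window has length 2
  |y|.\<close>

lemma increment_small:
  assumes "\<bar>y\<bar> \<le> 1"
  shows "norm (increment f f1 x y)
    \<le> 2 / \<bar>y\<bar> * (LINT u|lborel. indicator {-\<bar>y\<bar>..\<bar>y\<bar>} u * norm (f2 (x + u)))"
proof (cases "y = 0")
  case True
  then show ?thesis by (simp add: increment_def jump_weight_def)
next
  case False
  let ?I = "LINT u|lborel. indicator {-\<bar>y\<bar>..\<bar>y\<bar>} u * norm (f2 (x + u))"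
  have I0: "0 \<le> ?I" by simp
  have "norm (increment f f1 x y) = jump_weight y * norm (f (x + y) - f x - y *\<^sub>R f1 x)"
    using assms by (simp add: increment_def jump_weight_bounds(1) abs_le_iff indicator_def)
  also have "\<dots> \<le> jump_weight y * (\<bar>y\<bar> * ?I)"
    by (intro mult_left_mono taylor_bound[OF tr] jump_weight_bounds)
  also have "\<dots> \<le> 2 / \<bar>y\<bar> * ?I"
    using mult_right_mono[OF jump_weight_bounds(2)[OF assms False] I0] by (simp only: mult.assoc)
  finally show ?thesis .
qed

lemma increment_large:
  assumes "1 < \<bar>y\<bar>"
  shows "norm (increment f f1 x y) \<le> 2 * (norm (f (x + y)) + norm (f x))"
proof -
  have "norm (increment f f1 x y) = jump_weight y * norm (f (x + y) - f x)"
    using assms by (auto simp: increment_def jump_weight_bounds(1) indicator_def abs_le_iff)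
  also have "\<dots> \<le> 2 * (norm (f (x + y)) + norm (f x))"
    using jump_weight_bounds(3)[OF assms] by (intro mult_mono norm_triangle_ineq4) auto
  finally show ?thesis .
qed

text \<open>The point is that the bound is uniform in y, so that it is integrable against the finite
  jump measure.\<close>

lemma increment_integrable_x:
  shows "integrable lborel (\<lambda>x. increment f f1 x y)"
    and "(LINT x|lborel. norm (increment f f1 x y))
      \<le> 4 * (LINT x|lborel. norm (f2 x)) + 4 * (LINT x|lborel. norm (f x))"
proof -
  have *: "integrable lborel (\<lambda>x. increment f f1 x y) \<and> (LINT x|lborel. norm (increment f f1 x y)) \<le> c"
    if h: "integrable lborel h" and le: "\<And>x. norm (increment f f1 x y) \<le> h x" and c: "(LINT x|lborel. h x) \<le> c" for h c
  proof
    show i: "integrable lborel (\<lambda>x. increment f f1 x y)"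
    proof (rule Bochner_Integration.integrable_bound[OF h])
      show "AE x in lborel. norm (increment f f1 x y) \<le> norm (h x)"
        using le by (auto intro!: AE_I2 order_trans[OF le])
      show "(\<lambda>x. increment f f1 x y) \<in> borel_measurable lborel"
        unfolding increment_def by measurable
    qed
    show "(LINT x|lborel. norm (increment f f1 x y)) \<le> c"
      using integral_mono[OF integrable_norm[OF i] h le] c by linarith
  qed
  have ff: "0 \<le> (LINT x|lborel. norm (f2 x))" "0 \<le> (LINT x|lborel. norm (f x))" by simp_all
  have "integrable lborel (\<lambda>x. increment f f1 x y) \<and> (LINT x|lborel. norm (increment f f1 x y))
      \<le> 4 * (LINT x|lborel. norm (f2 x)) + 4 * (LINT x|lborel. norm (f x))"
  proof (cases "\<bar>y\<bar> \<le> 1")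
    case True
    note w = window_integral[of "\<lambda>x. norm (f2 x)" "\<bar>y\<bar>", OF integrable_norm[OF trD(1)]]
    show ?thesis
    proof (rule *[OF _ increment_small[OF True]])
      show "integrable lborel (\<lambda>x. 2 / \<bar>y\<bar> * (LINT u|lborel. indicator {-\<bar>y\<bar>..\<bar>y\<bar>} u * norm (f2 (x + u))))"
        using w(1) by (intro integrable_mult_right) auto
      show "(LINT x|lborel. 2 / \<bar>y\<bar> * (LINT u|lborel. indicator {-\<bar>y\<bar>..\<bar>y\<bar>} u * norm (f2 (x + u))))
          \<le> 4 * (LINT x|lborel. norm (f2 x)) + 4 * (LINT x|lborel. norm (f x))"
        using w(2) ff by (cases "y = 0") auto
    qed
  next
    case False
    have i: "integrable lborel (\<lambda>x. norm (f (x + y)))" "(LINT x|lborel. norm (f (x + y))) = (LINT x|lborel. norm (f x))"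
      using lborel_integrable_real_affine[OF integrable_norm[OF f_integrable[OF tr]], of 1 y]
        lborel_integral_real_affine[of 1 "\<lambda>x. norm (f x)" y]
      by (simp_all add: add.commute)
    show ?thesis
    proof (rule *[OF _ increment_large])
      show "integrable lborel (\<lambda>x. 2 * (norm (f (x + y)) + norm (f x)))"
        using i(1) integrable_norm[OF f_integrable[OF tr]]
        by (intro integrable_mult_right Bochner_Integration.integrable_add)
      show "(LINT x|lborel. 2 * (norm (f (x + y)) + norm (f x)))
          \<le> 4 * (LINT x|lborel. norm (f2 x)) + 4 * (LINT x|lborel. norm (f x))"
        using i integrable_norm[OF f_integrable[OF tr]] ff by simp
    qed (use False in simp)
  qed
  then show "integrable lborel (\<lambda>x. increment f f1 x y)"
    "(LINT x|lborel. norm (increment f f1 x y))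
      \<le> 4 * (LINT x|lborel. norm (f2 x)) + 4 * (LINT x|lborel. norm (f x))" by auto
qed

lemma increment_integrable: "integrable (lborel \<Otimes>\<^sub>M \<kappa>) (\<lambda>(x, y). increment f f1 x y)"
proof -
  have "integrable (\<kappa> \<Otimes>\<^sub>M lborel) (\<lambda>(y, x). increment f f1 x y)"
  proof (rule \<kappa>L.Fubini_integrable)
    show "(\<lambda>(y, x). increment f f1 x y) \<in> borel_measurable (\<kappa> \<Otimes>\<^sub>M lborel)"
      unfolding increment_def by measurable
    show "integrable \<kappa> (\<lambda>y. LINT x|lborel. norm (case (y, x) of (y, x) \<Rightarrow> increment f f1 x y))"
    proof (rule \<kappa>.integrable_const_bound)
      show "AE y in \<kappa>. norm (LINT x|lborel. norm (case (y, x) of (y, x) \<Rightarrow> increment f f1 x y))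
          \<le> 4 * (LINT x|lborel. norm (f2 x)) + 4 * (LINT x|lborel. norm (f x))"
        using increment_integrable_x(2) by simp
      show "(\<lambda>y. LINT x|lborel. norm (case (y, x) of (y, x) \<Rightarrow> increment f f1 x y)) \<in> borel_measurable \<kappa>"
        unfolding increment_def by measurable
    qed
    show "AE y in \<kappa>. integrable lborel (\<lambda>x. case (y, x) of (y, x) \<Rightarrow> increment f f1 x y)"
      using increment_integrable_x(1) by simp
  qed
  then show ?thesis
    using \<kappa>L.integrable_product_swap by fastforce
qed

text \<open>The jump integral converges for almost every x. At the exceptional points the Bochner
  integral is 0 by default, which is why identities such as linearity of the generator are stated
  almost everywhere.\<close>

lemma increment_integrable_y: "AE x in lborel. integrable \<kappa> (\<lambda>y. increment f f1 x y)"
  using L\<kappa>.AE_integrable_fst'[OF increment_integrable] by simp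

lemma levy_op_borel [measurable]: "levy_op A \<gamma> \<nu> f f1 f2 \<in> borel_measurable borel"
  unfolding levy_op_def increment_def by measurable

lemma levy_op_integrable: "integrable lborel (levy_op A \<gamma> \<nu> f f1 f2)"
  unfolding levy_op_def
  using L\<kappa>.integrable_fst'[OF increment_integrable] trD(1) f1_integrable[OF tr]
  by (intro Bochner_Integration.integrable_add integrable_scaleR_right) auto

end

end

section \<open>Fourier transform and L^p bound of the generator\<close>

lemma powr_integral_on_le:
  fixes w :: "real \<Rightarrow> real"
  assumes X[measurable]: "X \<in> sets borel" and fin: "emeasure lborel X < \<infinity>" and C: "measure lborel X \<le> C"
    and w[measurable]: "w \<in> borel_measurable borel" and w0: "\<And>x. 0 \<le> w x" and p: "1 < p"
    and i: "integrable lborel (\<lambda>x. indicator X x * w x powr p)"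
  shows "(LINT x|lborel. indicator X x * w x) powr p
    \<le> 2 powr p * C powr (p - 1) * (LINT x|lborel. indicator X x * w x powr p)"
proof -
  let ?D = "density lborel (\<lambda>x. ennreal (indicator X x))"
  have e: "emeasure ?D UNIV = emeasure lborel X"
    by (subst emeasure_density) (auto simp: ennreal_indicator)
  interpret D: finite_measure ?D
    by (rule finite_measureI) (use fin e in simp)
  have "(LINT x|?D. w x) powr p \<le> 2 powr p * C powr (p - 1) * (LINT x|?D. w x powr p)"
  proof (rule D.integral_powr_le)
    show "integrable ?D (\<lambda>x. w x powr p)" using i by (subst integrable_density) auto
    show "measure ?D (space ?D) \<le> C" using e C by (simp add: measure_def)
  qed (use w0 p in auto)
  then show ?thesis by (subst (asm) (1 2) integral_density) auto
qed

context levy_bounded_support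
begin

text \<open>The factor 8^p comes from jumps with |y| <= 1, the second term from larger jumps. What
  matters is that it depends neither on the function nor on y.\<close>

definition increment_const :: "real \<Rightarrow> real" where
  "increment_const p = 8 powr p + 2 * R * (8 * (R + 1)) powr p * (2 powr p * (2 * R) powr (p - 1))"

definition levy_op_const :: "real \<Rightarrow> real" where
  "levy_op_const p = 2 powr p * (A / 2) powr p
    + 4 powr p * (\<bar>\<gamma>\<bar> powr p * (2 * R) * (2 powr p * (2 * R) powr (p - 1)))
    + 4 powr p * (2 powr p * measure \<kappa> UNIV powr (p - 1) * (measure \<kappa> UNIV * increment_const p))"

context
  fixes f f1 f2 :: "real \<Rightarrow> complex"
  assumes tr: "C1_triple S f f1 f2"
begin

lemmas tripleD = C1_tripleD[OF tr]
lemmas [measurable] = f_borel[OF tr] f1_borel[OF tr] f2_borel[OF tr]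

lemma cutoff_triple:
  "indicator {-R-1..R+1} x *\<^sub>R (c * f x) = c * f x"
  "indicator {-R-1..R+1} x *\<^sub>R (c * f1 x) = c * f1 x"
  "indicator {-R-1..R+1} x *\<^sub>R (c * f2 x) = c * f2 x"
proof -
  consider "x \<in> {-R-1..R+1}" | "x \<notin> S" using S_bound by fastforce
  then show "indicator {-R-1..R+1} x *\<^sub>R (c * f x) = c * f x"
    "indicator {-R-1..R+1} x *\<^sub>R (c * f1 x) = c * f1 x"
    "indicator {-R-1..R+1} x *\<^sub>R (c * f2 x) = c * f2 x"
    by (cases; use tripleD(3,4) f1_zero[OF tr] in simp)+
qed

text \<open>The exponential is an eigenfunction of the formal adjoint of the generator. The argument
  - z arises because integrating exp (i z x) against f (x + y) produces the factor exp (- i z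
  y).\<close>

lemma levy_op_fourier:
  fixes z :: real
  defines "E \<equiv> \<lambda>x. exp (\<i> * of_real (z * x))"
  shows "integrable lborel (\<lambda>x. E x * f x)" "integrable lborel (\<lambda>x. E x * levy_op A \<gamma> \<nu> f f1 f2 x)"
    and "(LINT x|lborel. E x * levy_op A \<gamma> \<nu> f f1 f2 x)
      = - levy_exponent A \<gamma> \<nu> (- z) * (LINT x|lborel. E x * f x)"
proof -
  have E_norm: "norm (E x) = 1" for x by (simp add: E_def)
  have E_cont: "continuous_on X E" for X unfolding E_def by (intro continuous_intros)
  have [measurable]: "E \<in> borel_measurable borel" by (rule borel_measurable_continuous_onI[OF E_cont])
  have E_deriv: "(E has_vector_derivative \<i> * of_real z * E t) (at t)" for t
  proof -
    have "((\<lambda>x. exp (x *\<^sub>R (\<i> * of_real z))) has_vector_derivative (\<i> * of_real z) * exp (t *\<^sub>R (\<i> * of_real z))) (at t)"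
      by (rule exp_scaleR_has_vector_derivative_left)
    then show ?thesis by (simp add: E_def scaleR_conv_of_real mult_ac)
  qed
  have iE: "integrable lborel (\<lambda>x. E x * h x)" if "integrable lborel h" for h :: "real \<Rightarrow> complex"
    using that borel_measurable_integrable[OF that]
    by (intro Bochner_Integration.integrable_bound[OF that]) (auto simp: norm_mult E_norm)
  show "integrable lborel (\<lambda>x. E x * f x)" by (intro iE f_integrable[OF tr])
  show "integrable lborel (\<lambda>x. E x * levy_op A \<gamma> \<nu> f f1 f2 x)" by (intro iE levy_op_integrable[OF tr])
  define F where "F = (LINT x|lborel. E x * f x)"
  have out: "- R - 1 \<notin> S" "R + 1 \<notin> S" using S_bound R_pos by auto
  have F1: "(LINT x|lborel. E x * f1 x) = - (\<i> * of_real z) * F"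
  proof -
    have "(LINT x|lborel. indicator {-R-1..R+1} x *\<^sub>R (\<i> * of_real z * E x * f x + E x * f1 x))
        = E (R + 1) * f (R + 1) - E (-R-1) * f (-R-1)"
    proof (rule integral_FTC_atLeastAtMost)
      show "((\<lambda>x. E x * f x) has_vector_derivative \<i> * of_real z * E x * f x + E x * f1 x) (at x within {-R-1..R+1})" for x
        by (rule has_vector_derivative_at_within)
          (use has_vector_derivative_mult[OF E_deriv tripleD(6)] in \<open>simp add: add.commute\<close>)
      show "continuous_on {-R-1..R+1} (\<lambda>x. \<i> * of_real z * E x * f x + E x * f1 x)"
        by (intro continuous_intros E_cont f_cont[OF tr] f1_cont[OF tr])
    qed (use R_pos in simp)
    then have "(LINT x|lborel. \<i> * of_real z * (E x * f x) + E x * f1 x) = 0"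
      unfolding scaleR_add_right cutoff_triple using out tripleD(3) by (simp add: mult.assoc)
    moreover have "(LINT x|lborel. \<i> * of_real z * (E x * f x) + E x * f1 x)
        = \<i> * of_real z * F + (LINT x|lborel. E x * f1 x)"
      using iE[OF f_integrable[OF tr]] iE[OF f1_integrable[OF tr]] by (simp add: F_def)
    ultimately show ?thesis by (simp add: add_eq_0_iff)
  qed
  \<comment> \<open>\<open>F1\<close> was the fundamental theorem of calculus for a C^1 function;
    here \<open>f1\<close> is only absolutely continuous, hence \<open>by_parts\<close>.\<close>
  have F2: "(LINT x|lborel. E x * f2 x) = - (\<i> * of_real z) * (LINT x|lborel. E x * f1 x)"
  proof -
    have "(LINT t|lborel. indicator {-R-1..R+1} t *\<^sub>R ((\<i> * of_real z * E t) * f1 t))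
        + (LINT t|lborel. indicator {-R-1..R+1} t *\<^sub>R (E t * f2 t)) = E (R + 1) * f1 (R + 1)"
    proof (rule by_parts[OF tr E_deriv])
      show "continuous_on UNIV (\<lambda>t. \<i> * of_real z * E t)" by (intro continuous_intros E_cont)
      show "t \<notin> S" if "t < - R - 1" for t using that S_bound by auto
    qed (use R_pos in simp)
    then have "\<i> * of_real z * (LINT t|lborel. E t * f1 t) + (LINT t|lborel. E t * f2 t) = 0"
      unfolding cutoff_triple using f1_zero[OF tr out(2)] by (simp add: mult.assoc)
    then show ?thesis by (simp add: add_eq_0_iff2)
  qed
  define c where "c y = exp (\<i> * of_real (y * - z)) - 1 - \<i> * of_real (y * - z * indicator {-1..1} y)" for y
  have [measurable]: "c \<in> borel_measurable borel" unfolding c_def by measurable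
  \<comment> \<open>Substituting x - y for x turns the shift into a phase, and \<open>F1\<close>
    evaluates the compensator; what remains is the integrand of the Levy exponent at - z.\<close>
  have F3: "(LINT x|lborel. E x * increment f f1 x y) = (jump_weight y *\<^sub>R c y) * F" for y
  proof -
    have ish: "integrable lborel (\<lambda>x. f (x + y))"
      using lborel_integrable_real_affine[OF f_integrable[OF tr], of 1 y] by (simp add: add.commute)
    have "(LINT x|lborel. E x * f (x + y)) = (LINT x|lborel. E (- y + 1 * x) * f (- y + 1 * x + y))"
      by (subst lborel_integral_real_affine[of 1 _ "- y"]) simp_all
    also have "\<dots> = (LINT x|lborel. exp (\<i> * of_real (y * - z)) * (E x * f x))"
      by (intro Bochner_Integration.integral_cong) (auto simp: E_def algebra_simps simp flip: exp_add)
    finally have sh: "(LINT x|lborel. E x * f (x + y)) = exp (\<i> * of_real (y * - z)) * F"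
      by (simp add: F_def)
    have "(LINT x|lborel. E x * increment f f1 x y)
        = (LINT x|lborel. of_real (jump_weight y) * (E x * f (x + y) - E x * f x
            - of_real (y * indicator {-1..1} y) * (E x * f1 x)))"
      by (intro Bochner_Integration.integral_cong) (auto simp: increment_def scaleR_conv_of_real algebra_simps)
    also have "\<dots> = of_real (jump_weight y) * (exp (\<i> * of_real (y * - z)) * F - F
            - of_real (y * indicator {-1..1} y) * (- (\<i> * of_real z) * F))"
      unfolding integral_mult_right_zero
      using iE[OF f_integrable[OF tr]] iE[OF f1_integrable[OF tr]] iE[OF ish] sh F1
      by (simp add: F_def)
    also have "\<dots> = (jump_weight y *\<^sub>R c y) * F"
      by (simp add: c_def scaleR_conv_of_real algebra_simps)
    finally show ?thesis .
  qed
  have F4: "(LINT x|lborel. E x * (LINT y|\<kappa>. increment f f1 x y)) = (LINT y|\<nu>. c y) * F"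
  proof -
    have i: "integrable (lborel \<Otimes>\<^sub>M \<kappa>) (\<lambda>(x, y). E x * increment f f1 x y)"
      by (rule Bochner_Integration.integrable_bound[OF increment_integrable[OF tr]])
        (auto simp: norm_mult E_norm split_beta' increment_def)
    have "(LINT x|lborel. E x * (LINT y|\<kappa>. increment f f1 x y)) = (LINT x|lborel. LINT y|\<kappa>. E x * increment f f1 x y)"
      by simp
    also have "\<dots> = (LINT y|\<kappa>. LINT x|lborel. E x * increment f f1 x y)"
      using L\<kappa>.Fubini_integral[OF i] by (simp only: prod.case)
    also have "\<dots> = (LINT y|\<kappa>. jump_weight y *\<^sub>R c y) * F"
      unfolding F3 by (rule integral_mult_left_zero)
    also have "(LINT y|\<kappa>. jump_weight y *\<^sub>R c y) = (LINT y|\<nu>. c y)"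
      by (rule nu_to_kappa(1)[symmetric]) (auto simp: c_def)
    finally show ?thesis .
  qed
  have ik: "integrable lborel (\<lambda>x. LINT y|\<kappa>. increment f f1 x y)"
    using L\<kappa>.integrable_fst'[OF increment_integrable[OF tr]] by simp
  have "(LINT x|lborel. E x * levy_op A \<gamma> \<nu> f f1 f2 x)
      = (LINT x|lborel. of_real (A / 2) * (E x * f2 x) + of_real \<gamma> * (E x * f1 x)
          + E x * (LINT y|\<kappa>. increment f f1 x y))"
    by (intro Bochner_Integration.integral_cong) (auto simp: levy_op_def scaleR_conv_of_real algebra_simps)
  also have "\<dots> = of_real (A / 2) * (LINT x|lborel. E x * f2 x) + of_real \<gamma> * (LINT x|lborel. E x * f1 x)
          + (LINT x|lborel. E x * (LINT y|\<kappa>. increment f f1 x y))"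
    using iE[OF tripleD(1)] iE[OF f1_integrable[OF tr]] iE[OF ik] by simp
  also have "\<dots> = - levy_exponent A \<gamma> \<nu> (- z) * F"
  proof -
    have "levy_exponent A \<gamma> \<nu> (- z) = of_real (A * z\<^sup>2 / 2) + \<i> * of_real (\<gamma> * z) - (LINT y|\<nu>. c y)"
      unfolding levy_exponent_def c_def by simp
    from this show ?thesis
      unfolding F4 F2 F1 \<open>levy_exponent A \<gamma> \<nu> (- z) = _\<close> by (simp add: power2_eq_square algebra_simps)
  qed
  finally show "(LINT x|lborel. E x * levy_op A \<gamma> \<nu> f f1 f2 x)
      = - levy_exponent A \<gamma> \<nu> (- z) * (LINT x|lborel. E x * f x)" by (simp add: F_def)
qed

context
  fixes p :: real
  assumes p: "1 < p" and f2p: "integrable lborel (\<lambda>x. norm (f2 x) powr p)"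
begin

lemma norm_f2_powr: "(LINT x|lborel. norm (f2 x)) powr p
    \<le> 2 powr p * (2 * R) powr (p - 1) * (LINT x|lborel. norm (f2 x) powr p)"
proof -
  have *: "indicator S x * norm (f2 x) = norm (f2 x)"
    "indicator S x * norm (f2 x) powr p = norm (f2 x) powr p" for x
    using tripleD(4) by (auto simp: indicator_def)
  show ?thesis
    using powr_integral_on_le[OF S_borel S_lmeas(3,2), of "\<lambda>x. norm (f2 x)" p] p f2p
    unfolding * by simp
qed

text \<open>For small jumps apply Jensen's inequality on the window and then integrate in x. For
  large jumps the bound is merely a constant, so the integral has to be restricted to S, which has
  finite measure.\<close>

lemma increment_powr:
  shows "integrable lborel (\<lambda>x. indicator S x * norm (increment f f1 x y) powr p)"
    and "(LINT x|lborel. indicator S x * norm (increment f f1 x y) powr p)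
      \<le> increment_const p * (LINT x|lborel. norm (f2 x) powr p)"
proof -
  define P where "P = (LINT x|lborel. norm (f2 x) powr p)"
  have P0: "0 \<le> P" by (simp add: P_def)
  have *: "integrable lborel (\<lambda>x. indicator S x * norm (increment f f1 x y) powr p)
      \<and> (LINT x|lborel. indicator S x * norm (increment f f1 x y) powr p) \<le> c"
    if h: "integrable lborel h" and le: "AE x in lborel. indicator S x * norm (increment f f1 x y) powr p \<le> h x"
      and c: "(LINT x|lborel. h x) \<le> c" for h c
  proof
    have [measurable]: "(\<lambda>x. increment f f1 x y) \<in> borel_measurable borel"
      unfolding increment_def by measurable
    show i: "integrable lborel (\<lambda>x. indicator S x * norm (increment f f1 x y) powr p)"
    proof (rule Bochner_Integration.integrable_bound[OF h])
      show "AE x in lborel. norm (indicator S x * norm (increment f f1 x y) powr p) \<le> norm (h x)"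
        using le by eventually_elim (auto simp: abs_mult)
    qed measurable
    show "(LINT x|lborel. indicator S x * norm (increment f f1 x y) powr p) \<le> c"
      using integral_mono_AE[OF i h le] c by linarith
  qed
  consider "y = 0" | "y \<noteq> 0" "\<bar>y\<bar> \<le> 1" | "1 < \<bar>y\<bar>" by linarith
  then have "integrable lborel (\<lambda>x. indicator S x * norm (increment f f1 x y) powr p)
      \<and> (LINT x|lborel. indicator S x * norm (increment f f1 x y) powr p) \<le> increment_const p * P"
  proof cases
    case 1
    then show ?thesis
      using P0 R_pos by (simp add: increment_def jump_weight_def increment_const_def)
  next
    case 2
    define a where "a = \<bar>y\<bar>"
    have a: "0 < a" using 2 by (simp add: a_def)
    define W where "W x = (LINT u|lborel. indicator {-a..a} u * norm (f2 (x + u)) powr p)" for x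
    note w = window_integral[of "\<lambda>x. norm (f2 x) powr p" a, OF f2p, folded W_def]
    show ?thesis
    proof (rule *)
      show "integrable lborel (\<lambda>x. (2 / a) powr p * (2 powr p * (2 * a) powr (p - 1)) * W x)"
        using w(1) a by (intro integrable_mult_right) auto
      show "AE x in lborel. indicator S x * norm (increment f f1 x y) powr p
          \<le> (2 / a) powr p * (2 powr p * (2 * a) powr (p - 1)) * W x"
        using w(3)[OF powr_ge_zero less_imp_le[OF a]]
      proof eventually_elim
        case (elim x)
        define m where "m = (LINT u|lborel. indicator {-a..a} u * norm (f2 (x + u)))"
        have m0: "0 \<le> m" by (simp add: m_def)
        have "norm (increment f f1 x y) powr p \<le> (2 / a * m) powr p"
          using increment_small[OF tr 2(2)] p by (intro powr_mono2) (auto simp: a_def m_def)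
        also have "\<dots> = (2 / a) powr p * m powr p" by (rule powr_mult)
        also have "m powr p \<le> 2 powr p * (2 * a) powr (p - 1) * W x"
          unfolding m_def W_def
        proof (rule powr_integral_on_le[OF _ _ _ _ _ p elim])
          show "emeasure lborel {-a..a} < \<infinity>" by (simp add: emeasure_lborel_Icc_eq)
        qed (use a in simp_all)
        finally have "norm (increment f f1 x y) powr p
            \<le> (2 / a) powr p * (2 powr p * (2 * a) powr (p - 1)) * W x"
          by (simp add: mult_left_mono mult.assoc)
        moreover have "indicator S x * norm (increment f f1 x y) powr p \<le> norm (increment f f1 x y) powr p"
          by (auto simp: indicator_def)
        ultimately show ?case by linarith
      qed
      \<comment> \<open>The powers of a cancel: (2 / a)^p from \<open>increment_small\<close>, (2
        a)^(p - 1) from Jensen and 2 a from the length of the window. Hence the bound stays uniform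
        as y tends to 0.\<close>
      have "(2 / a) powr p * (2 powr p * (2 * a) powr (p - 1)) * (2 * a * P) = 8 powr p * P"
      proof -
        have "(2 * a) powr (p - 1) * (2 * a) = (2 * a) powr p" using a by (simp add: powr_diff)
        then have "(2 / a) powr p * (2 powr p * (2 * a) powr (p - 1)) * (2 * a * P)
            = ((2 / a) powr p * (2 powr p * (2 * a) powr p)) * P"
          by (metis mult.assoc)
        moreover have "(2 / a) powr p * (2 powr p * (2 * a) powr p) = 8 powr p"
          using a by (simp flip: powr_mult)
        ultimately show ?thesis by (simp only:)
      qed
      also have "\<dots> \<le> increment_const p * P"
        using P0 R_pos by (intro mult_right_mono) (auto simp: increment_const_def)
      finally show "(LINT x|lborel. (2 / a) powr p * (2 powr p * (2 * a) powr (p - 1)) * W x) \<le> increment_const p * P"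
        using w(2) a by (simp add: P_def)
    qed
  next
    case 3
    define N1 where "N1 = (LINT x|lborel. norm (f2 x))"
    have N1: "0 \<le> N1" by (simp add: N1_def)
    \<comment> \<open>By \<open>f_bound\<close> each value of f is at most 2 (R + 1) N1, and
      \<open>increment_large\<close> doubles the sum of two values.\<close>
    define c where "c = (8 * (R + 1) * N1) powr p"
    have le: "norm (increment f f1 x y) powr p \<le> c" for x
    proof -
      have "norm (increment f f1 x y) \<le> 8 * (R + 1) * N1"
      proof -
        have "norm (increment f f1 x y) \<le> 2 * (2 * (R + 1) * N1 + 2 * (R + 1) * N1)"
          using f_bound[OF tr, of x] f_bound[OF tr, of "x + y"]
          by (intro order_trans[OF increment_large[OF tr 3, of x]] mult_left_mono add_mono)
            (auto simp: N1_def)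
        then show ?thesis by (simp add: algebra_simps)
      qed
      then show ?thesis unfolding c_def using p by (intro powr_mono2) auto
    qed
    show ?thesis
    proof (rule *)
      show "integrable lborel (\<lambda>x. indicator S x * c :: real)"
        using S_lmeas(3) by simp
      show "AE x in lborel. indicator S x * norm (increment f f1 x y) powr p \<le> indicator S x * c"
        using le by (auto simp: indicator_def)
      have "(LINT x|lborel. indicator S x * c :: real) \<le> 2 * R * c"
        using S_lmeas(2,3) by (simp add: mult_right_mono c_def)
      also have "\<dots> = 2 * R * ((8 * (R + 1)) powr p * N1 powr p)"
        unfolding c_def by (simp only: powr_mult)
      also have "\<dots> \<le> 2 * R * ((8 * (R + 1)) powr p * (2 powr p * (2 * R) powr (p - 1) * P))"
        using norm_f2_powr R_pos by (intro mult_left_mono) (auto simp: N1_def P_def)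
      also have "\<dots> \<le> increment_const p * P"
        using P0 by (simp add: increment_const_def algebra_simps)
      finally show "(LINT x|lborel. indicator S x * c :: real) \<le> increment_const p * P" .
    qed
  qed
  then show "integrable lborel (\<lambda>x. indicator S x * norm (increment f f1 x y) powr p)"
    "(LINT x|lborel. indicator S x * norm (increment f f1 x y) powr p)
      \<le> increment_const p * (LINT x|lborel. norm (f2 x) powr p)" by (auto simp: P_def)
qed

text \<open>This continuity of the generator with respect to the L^p norm of the second derivative
  is what later allows a small correction of a test function at the origin. The jump part is
  Jensen's inequality for the finite jump measure followed by Fubini.\<close>

lemma levy_op_powr:
  shows "integrable lborel (\<lambda>x. indicator S x * norm (levy_op A \<gamma> \<nu> f f1 f2 x) powr p)"
    and "(LINT x|lborel. indicator S x * norm (levy_op A \<gamma> \<nu> f f1 f2 x) powr p)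
      \<le> levy_op_const p * (LINT x|lborel. norm (f2 x) powr p)"
proof -
  define P where "P = (LINT x|lborel. norm (f2 x) powr p)"
  have P0: "0 \<le> P" by (simp add: P_def)
  define K where "K = measure \<kappa> UNIV"
  have K0: "0 \<le> K" by (simp add: K_def)
  define H where "H x y = indicator S x * norm (increment f f1 x y) powr p" for x y
  have H0: "0 \<le> H x y" for x y by (simp add: H_def)
  have H_meas: "(\<lambda>(x, y). H x y) \<in> borel_measurable (borel \<Otimes>\<^sub>M borel)"
    unfolding H_def increment_def by measurable
  have iH': "integrable (\<kappa> \<Otimes>\<^sub>M lborel) (\<lambda>(y, x). H x y)"
  proof (rule \<kappa>L.Fubini_integrable)
    show "(\<lambda>(y, x). H x y) \<in> borel_measurable (\<kappa> \<Otimes>\<^sub>M lborel)"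
      unfolding H_def increment_def by measurable
    show "integrable \<kappa> (\<lambda>y. LINT x|lborel. norm (case (y, x) of (y, x) \<Rightarrow> H x y))"
    proof (rule \<kappa>.integrable_const_bound)
      show "AE y in \<kappa>. norm (LINT x|lborel. norm (case (y, x) of (y, x) \<Rightarrow> H x y)) \<le> increment_const p * P"
        using increment_powr(2) H0 by (simp add: H_def P_def abs_mult)
      show "(\<lambda>y. LINT x|lborel. norm (case (y, x) of (y, x) \<Rightarrow> H x y)) \<in> borel_measurable \<kappa>"
        unfolding H_def increment_def by measurable
    qed
    show "AE y in \<kappa>. integrable lborel (\<lambda>x. case (y, x) of (y, x) \<Rightarrow> H x y)"
      using increment_powr(1) by (simp add: H_def)
  qed
  have iH: "integrable (lborel \<Otimes>\<^sub>M \<kappa>) (\<lambda>(x, y). H x y)"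
    using \<kappa>L.integrable_product_swap[OF iH'] by simp
  have HI: "(LINT x|lborel. LINT y|\<kappa>. H x y) \<le> K * (increment_const p * P)"
  proof -
    have "(LINT x|lborel. LINT y|\<kappa>. H x y) = (LINT y|\<kappa>. LINT x|lborel. H x y)"
      using L\<kappa>.Fubini_integral[OF iH] by (simp only: prod.case)
    also have "\<dots> \<le> (LINT y|\<kappa>. increment_const p * P)"
      using L\<kappa>.integrable_snd[OF iH] increment_powr(2)
      by (intro integral_mono) (auto simp: H_def P_def)
    finally show ?thesis by (simp add: K_def)
  qed
  define J where "J x = (LINT y|\<kappa>. increment f f1 x y)" for x
  have [measurable]: "J \<in> borel_measurable borel" unfolding J_def increment_def by measurable
  have J: "AE x in lborel. indicator S x * norm (J x) powr p \<le> 2 powr p * K powr (p - 1) * (LINT y|\<kappa>. H x y)"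
    using L\<kappa>.AE_integrable_fst'[OF iH]
  proof eventually_elim
    case (elim x)
    show ?case
    proof (cases "x \<in> S")
      case True
      have "norm (J x) powr p \<le> (LINT y|\<kappa>. norm (increment f f1 x y)) powr p"
        unfolding J_def using p by (intro powr_mono2 integral_norm_bound) auto
      also have "\<dots> \<le> 2 powr p * K powr (p - 1) * (LINT y|\<kappa>. norm (increment f f1 x y) powr p)"
      proof (rule \<kappa>.integral_powr_le)
        show "(\<lambda>y. norm (increment f f1 x y)) \<in> borel_measurable \<kappa>"
          unfolding increment_def by measurable
        show "integrable \<kappa> (\<lambda>y. norm (increment f f1 x y) powr p)"
          using elim True by (simp add: H_def)
      qed (use p in \<open>auto simp: K_def\<close>)
      finally show ?thesis using True by (simp add: H_def)
    qed (simp add: H_def)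
  qed
  \<comment> \<open>A majorant for the p-th power of the three parts of the generator; splitting
    twice by \<open>powr_add_le\<close> produces 2^p and 4^p. The drift is bounded by a constant
    only, hence the indicator of S.\<close>
  define T where "T x = 2 powr p * (A / 2) powr p * norm (f2 x) powr p
      + indicator S x * (4 powr p * \<bar>\<gamma>\<bar> powr p * (LINT t|lborel. norm (f2 t)) powr p)
      + 4 powr p * (2 powr p * K powr (p - 1) * (LINT y|\<kappa>. H x y))" for x
  have iT: "integrable lborel T"
    unfolding T_def
  proof (intro Bochner_Integration.integrable_add)
    show "integrable lborel (\<lambda>x. 2 powr p * (A / 2) powr p * norm (f2 x) powr p)"
      using f2p by (intro integrable_mult_right) auto
    show "integrable lborel (\<lambda>x. indicator S x * (4 powr p * \<bar>\<gamma>\<bar> powr p * (LINT t|lborel. norm (f2 t)) powr p))"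
      using S_lmeas(3) by (intro integrable_mult_left) auto
    show "integrable lborel (\<lambda>x. 4 powr p * (2 powr p * K powr (p - 1) * (LINT y|\<kappa>. H x y)))"
      using L\<kappa>.integrable_fst'[OF iH] by (intro integrable_mult_right) auto
  qed
  have le: "AE x in lborel. indicator S x * norm (levy_op A \<gamma> \<nu> f f1 f2 x) powr p \<le> T x"
    using J
  proof eventually_elim
    case (elim x)
    show ?case
    proof (cases "x \<in> S")
      case True
      let ?a = "A / 2 * norm (f2 x)" and ?b = "\<bar>\<gamma>\<bar> * norm (f1 x)" and ?c = "norm (J x)"
      have "norm (levy_op A \<gamma> \<nu> f f1 f2 x) \<le> ?a + (?b + ?c)"
        unfolding levy_op_def J_def[symmetric]
        using A_nonneg by (auto intro!: norm_triangle_mono simp: add.assoc)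
      then have "norm (levy_op A \<gamma> \<nu> f f1 f2 x) powr p \<le> (?a + (?b + ?c)) powr p"
        using p by (intro powr_mono2) auto
      also have "\<dots> \<le> 2 powr p * (?a powr p + (?b + ?c) powr p)"
        using A_nonneg p by (intro powr_add_le) auto
      also have "\<dots> \<le> 2 powr p * (?a powr p + 2 powr p * (?b powr p + ?c powr p))"
        using p by (intro mult_left_mono add_left_mono powr_add_le) auto
      also have "\<dots> = 2 powr p * ?a powr p + 4 powr p * ?b powr p + 4 powr p * ?c powr p"
        using powr_mult[of 2 2 p] by (simp add: algebra_simps)
      also have "\<dots> \<le> T x"
      proof -
        have "?a powr p = (A / 2) powr p * norm (f2 x) powr p" by (rule powr_mult)
        moreover have "?b powr p \<le> \<bar>\<gamma>\<bar> powr p * (LINT t|lborel. norm (f2 t)) powr p"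
          using f1_bound[OF tr, of x] p
          by (subst powr_mult) (auto intro!: mult_left_mono powr_mono2)
        moreover have "?c powr p \<le> 2 powr p * K powr (p - 1) * (LINT y|\<kappa>. H x y)"
          using elim True by simp
        ultimately show ?thesis using True by (auto simp: T_def mult.assoc intro!: add_mono mult_left_mono)
      qed
      finally show ?thesis using True by simp
    next
      case False
      then show ?thesis using H0 by (simp add: T_def)
    qed
  qed
  show i: "integrable lborel (\<lambda>x. indicator S x * norm (levy_op A \<gamma> \<nu> f f1 f2 x) powr p)"
  proof (rule Bochner_Integration.integrable_bound[OF iT])
    show "AE x in lborel. norm (indicator S x * norm (levy_op A \<gamma> \<nu> f f1 f2 x) powr p) \<le> norm (T x)"
      using le by eventually_elim (auto simp: abs_mult)
  qed (use levy_op_borel[OF tr] in measurable)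
  have "(LINT x|lborel. indicator S x * norm (levy_op A \<gamma> \<nu> f f1 f2 x) powr p) \<le> (LINT x|lborel. T x)"
    by (rule integral_mono_AE[OF i iT le])
  also have "\<dots> = 2 powr p * (A / 2) powr p * P
      + measure lborel S * (4 powr p * \<bar>\<gamma>\<bar> powr p * (LINT t|lborel. norm (f2 t)) powr p)
      + 4 powr p * (2 powr p * K powr (p - 1) * (LINT x|lborel. LINT y|\<kappa>. H x y))"
    unfolding T_def using f2p S_lmeas(3) L\<kappa>.integrable_fst'[OF iH]
    by (simp add: P_def)
  also have "\<dots> \<le> 2 powr p * (A / 2) powr p * P
      + (2 * R) * (4 powr p * \<bar>\<gamma>\<bar> powr p * (2 powr p * (2 * R) powr (p - 1) * P))
      + 4 powr p * (2 powr p * K powr (p - 1) * (K * (increment_const p * P)))"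
    using HI norm_f2_powr S_lmeas(2) R_pos
    by (intro add_mono mult_mono mult_left_mono order_refl) (auto simp: P_def)
  also have "\<dots> = levy_op_const p * P"
    by (simp add: levy_op_const_def K_def algebra_simps)
  finally show "(LINT x|lborel. indicator S x * norm (levy_op A \<gamma> \<nu> f f1 f2 x) powr p)
      \<le> levy_op_const p * (LINT x|lborel. norm (f2 x) powr p)" by (simp add: P_def)
qed

end

end

end

section \<open>Dissipativity\<close>

text \<open>A smooth substitute for |u|. That psi 0 = 0 keeps the support, |psi'| <= 1 leaves an L^1
  norm of the generator in the estimate, and the bound on psi'' keeps psi (f) in the class
  \<open>C1_triple\<close>.\<close>

definition psi :: "real \<Rightarrow> real" where "psi u = sqrt (1 + u\<^sup>2) - 1"

definition psi' :: "real \<Rightarrow> real" where "psi' u = u / sqrt (1 + u\<^sup>2)"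

definition psi'' :: "real \<Rightarrow> real" where "psi'' u = 1 / ((1 + u\<^sup>2) * sqrt (1 + u\<^sup>2))"

lemma one_plus_square_pos [simp]: "0 < 1 + (u::real)\<^sup>2"
  by (simp add: add_pos_nonneg)

lemma one_plus_square_nonzero [simp]: "1 + (u::real)\<^sup>2 \<noteq> 0" "\<not> 1 + (u::real)\<^sup>2 < 0"
  using one_plus_square_pos[of u] by linarith+

lemma sqrt_one_plus_square_pos [simp]: "0 < sqrt (1 + (u::real)\<^sup>2)"
  by (rule real_sqrt_gt_zero) (rule one_plus_square_pos)

lemma psi_0 [simp]: "psi 0 = 0" "psi' 0 = 0"
  by (simp_all add: psi_def psi'_def)

lemma psi_nonneg [simp]: "0 \<le> psi u"
  by (simp add: psi_def)

lemma psi_eq_0: "psi u = 0 \<longleftrightarrow> u = 0"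
  by (simp add: psi_def)

lemma abs_psi'_le: "\<bar>psi' u\<bar> \<le> 1"
proof -
  have "\<bar>u\<bar> \<le> sqrt (1 + u\<^sup>2)" by (rule real_le_rsqrt) simp
  then show ?thesis by (simp add: psi'_def abs_divide divide_le_eq)
qed

lemma psi''_bounds: "0 \<le> psi'' u" "psi'' u \<le> 1"
proof -
  have "1 * 1 \<le> (1 + u\<^sup>2) * sqrt (1 + u\<^sup>2)" by (intro mult_mono) auto
  then show "0 \<le> psi'' u" "psi'' u \<le> 1"
    by (auto simp: psi''_def divide_le_eq intro!: divide_nonneg_nonneg mult_nonneg_nonneg)
qed

text \<open>Clearing denominators leaves 1 + u v <= sqrt (1 + u^2) sqrt (1 + v^2), the
  Cauchy-Schwarz inequality for the vectors (1, u) and (1, v).\<close>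

lemma psi_convex: "psi' u * (v - u) \<le> psi v - psi u"
proof -
  define a b where "a = sqrt (1 + u\<^sup>2)" and "b = sqrt (1 + v\<^sup>2)"
  have ab: "0 < a" "0 < b" "a\<^sup>2 = 1 + u\<^sup>2" "b\<^sup>2 = 1 + v\<^sup>2"
    by (simp_all add: a_def b_def)
  have "(1 + u * v)\<^sup>2 \<le> (1 + u\<^sup>2) * (1 + v\<^sup>2)"
    using zero_le_power2[of "u - v"] by (simp add: power2_eq_square algebra_simps)
  also have "\<dots> = (a * b)\<^sup>2" by (simp only: power_mult_distrib ab)
  finally have "(1 + u * v)\<^sup>2 \<le> (a * b)\<^sup>2" .
  then have "1 + u * v \<le> a * b"
    by (rule power2_le_imp_le) (use ab(1,2) in simp)
  then have "u * (v - u) \<le> a * (b - a)"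
    using ab(3) by (simp add: algebra_simps power2_eq_square)
  then show ?thesis
    using ab by (simp add: psi_def psi'_def divide_le_eq mult.commute flip: a_def b_def)
qed

lemma psi_diff_le: "psi u - psi v \<le> \<bar>u - v\<bar>"
proof -
  have "psi u - psi v \<le> psi' u * (u - v)" using psi_convex[of u v] by (simp add: algebra_simps)
  also have "\<dots> \<le> \<bar>psi' u\<bar> * \<bar>u - v\<bar>" by (simp flip: abs_mult)
  also have "\<dots> \<le> 1 * \<bar>u - v\<bar>" by (intro mult_right_mono abs_psi'_le) simp
  finally show ?thesis by simp
qed

lemma psi_deriv: "(psi has_real_derivative psi' u) (at u)"
proof -
  have "((\<lambda>u. sqrt (1 + u\<^sup>2) - 1) has_real_derivative inverse (sqrt (1 + u\<^sup>2)) / 2 * (2 * u)) (at u)"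
    by (auto intro!: derivative_eq_intros)
  moreover have "inverse (sqrt (1 + u\<^sup>2)) / 2 * (2 * u) = psi' u"
    by (simp add: psi'_def inverse_eq_divide)
  ultimately show ?thesis by (simp only: psi_def[abs_def])
qed

lemma psi'_deriv: "(psi' has_real_derivative psi'' u) (at u)"
proof -
  define a where "a = sqrt (1 + u\<^sup>2)"
  have a: "0 < a" "a * a = 1 + u\<^sup>2" by (simp_all add: a_def)
  have "((\<lambda>u. u / sqrt (1 + u\<^sup>2)) has_real_derivative
      (1 * sqrt (1 + u\<^sup>2) - u * (inverse (sqrt (1 + u\<^sup>2)) / 2 * (2 * u))) / (sqrt (1 + u\<^sup>2) * sqrt (1 + u\<^sup>2))) (at u)"
    using sqrt_one_plus_square_pos[of u] by (auto intro!: derivative_eq_intros simp del: sqrt_one_plus_square_pos)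
  moreover have "(a - u * (inverse a / 2 * (2 * u))) / (a * a) = 1 / ((1 + u\<^sup>2) * a)"
  proof -
    have "a - u * (inverse a / 2 * (2 * u)) = (a * a - u\<^sup>2) / a"
      using a(1) by (simp add: field_simps power2_eq_square)
    then show ?thesis using a by (simp add: field_simps)
  qed
  ultimately show ?thesis
    by (simp only: psi'_def[abs_def] psi''_def a_def mult_1_left)
qed

lemma psi_continuous: "continuous_on X psi" "continuous_on X psi'" "continuous_on X psi''"
proof -
  show "continuous_on X psi" "continuous_on X psi'"
    by (auto intro!: continuous_at_imp_continuous_on DERIV_isCont psi_deriv psi'_deriv)
  have "(1 + u\<^sup>2) * sqrt (1 + u\<^sup>2) \<noteq> 0" for u :: real
    using one_plus_square_pos[of u] sqrt_one_plus_square_pos[of u] by (metis less_irrefl mult_eq_0_iff)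
  then show "continuous_on X psi''"
    unfolding psi''_def[abs_def] by (intro continuous_intros) auto
qed

lemma psi_borel [measurable]:
  "psi \<in> borel_measurable borel" "psi' \<in> borel_measurable borel" "psi'' \<in> borel_measurable borel"
  by (auto intro!: borel_measurable_continuous_onI psi_continuous)

text \<open>The chain rule for the first derivative is classical. For the second, psi' (f) f1 is a
  product with an absolutely continuous factor, and \<open>by_parts\<close> with u = psi' (f)
  exhibits it as a primitive.\<close>

lemma (in bounded_support) psi_triple:
  assumes tr: "C1_triple S f f1 f2"
  shows "C1_triple S (\<lambda>x. of_real (psi (Re (f x)))) (\<lambda>x. of_real (psi' (Re (f x)) * Re (f1 x)))
    (\<lambda>x. of_real (psi' (Re (f x)) * Re (f2 x) + psi'' (Re (f x)) * (Re (f1 x))\<^sup>2))"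
proof -
  note trD = C1_tripleD[OF tr]
  note [measurable] = f_borel[OF tr] f1_borel[OF tr] f2_borel[OF tr]
  define N1 where "N1 = (LINT x|lborel. norm (f2 x))"
  have f1N: "\<bar>Re (f1 x)\<bar> \<le> N1" for x
    using f1_bound[OF tr, of x] abs_Re_le_cmod[of "f1 x"] by (simp add: N1_def)
  define g2 where "g2 x = psi' (Re (f x)) * Re (f2 x) + psi'' (Re (f x)) * (Re (f1 x))\<^sup>2" for x
  have i1: "integrable lborel (\<lambda>x. psi' (Re (f x)) * Re (f2 x))"
  proof (rule Bochner_Integration.integrable_bound[OF trD(1)])
    have "\<bar>psi' (Re (f x)) * Re (f2 x)\<bar> \<le> 1 * norm (f2 x)" for x
      unfolding abs_mult by (intro mult_mono abs_psi'_le abs_Re_le_cmod) auto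
    then show "AE x in lborel. norm (psi' (Re (f x)) * Re (f2 x)) \<le> norm (f2 x)" by simp
  qed measurable
  have i2: "integrable lborel (\<lambda>x. psi'' (Re (f x)) * (Re (f1 x))\<^sup>2)"
  proof (rule bounded_integrable[OF tr])
    have "\<bar>psi'' (Re (f x)) * (Re (f1 x))\<^sup>2\<bar> \<le> 1 * N1\<^sup>2" for x
      unfolding abs_mult using psi''_bounds[of "Re (f x)"] f1N[of x]
      by (intro mult_mono) (auto simp: power2_le_iff_abs_le intro: order_trans[OF abs_ge_zero])
    then show "norm (psi'' (Re (f x)) * (Re (f1 x))\<^sup>2) \<le> N1\<^sup>2" for x by simp
  qed (use f1_zero[OF tr] in simp_all)
  have ig2: "integrable lborel g2"
    unfolding g2_def[abs_def] by (intro Bochner_Integration.integrable_add i1 i2)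
  have d: "((\<lambda>x. complex_of_real (psi (Re (f x)))) has_vector_derivative of_real (psi' (Re (f x)) * Re (f1 x))) (at x)" for x
  proof -
    have "((\<lambda>x. Re (f x)) has_real_derivative Re (f1 x)) (at x)"
      using bounded_linear.has_vector_derivative[OF bounded_linear_Re trD(6)] by (simp add: has_real_derivative_iff_has_vector_derivative)
    from DERIV_chain2[OF psi_deriv this]
    show ?thesis by (intro has_vector_derivative_of_real) (simp add: has_real_derivative_iff_has_vector_derivative)
  qed
  have "complex_of_real (psi' (Re (f x)) * Re (f1 x)) = (LINT t|lborel. indicator {..x} t *\<^sub>R complex_of_real (g2 t))" for x
  proof -
    \<comment> \<open>To the left of S and not to the right of x: integration from minus infinity
      and integration from a agree.\<close>
    define a where "a = min x (- R - 1)"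
    have aS: "t \<notin> S" if "t < a" for t using that S_bound by (auto simp: a_def)
    have ax: "a \<le> x" by (simp add: a_def)
    have ud: "((\<lambda>t. complex_of_real (psi' (Re (f t)))) has_vector_derivative of_real (psi'' (Re (f t)) * Re (f1 t))) (at t)" for t
    proof -
      have "((\<lambda>x. Re (f x)) has_real_derivative Re (f1 t)) (at t)"
        using bounded_linear.has_vector_derivative[OF bounded_linear_Re trD(6)] by (simp add: has_real_derivative_iff_has_vector_derivative)
      from DERIV_chain2[OF psi'_deriv this]
      show ?thesis by (intro has_vector_derivative_of_real) (simp add: has_real_derivative_iff_has_vector_derivative)
    qed
    have uc: "continuous_on UNIV (\<lambda>t. complex_of_real (psi'' (Re (f t)) * Re (f1 t)))"
      by (intro continuous_intros f_cont[OF tr] f1_cont[OF tr] continuous_on_compose2[OF psi_continuous(3)[of UNIV]]) auto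
    have z: "g2 t = 0" if "t \<notin> S" for t
      using trD(4)[OF that] f1_zero[OF tr that] by (simp add: g2_def)
    have "(LINT t|lborel. indicator {..x} t *\<^sub>R complex_of_real (g2 t))
        = (LINT t|lborel. indicator {a..x} t *\<^sub>R complex_of_real (psi'' (Re (f t)) * (Re (f1 t))\<^sup>2)
            + indicator {a..x} t *\<^sub>R complex_of_real (psi' (Re (f t)) * Re (f2 t)))"
    proof (intro Bochner_Integration.integral_cong refl)
      fix t
      show "indicator {..x} t *\<^sub>R complex_of_real (g2 t)
          = indicator {a..x} t *\<^sub>R complex_of_real (psi'' (Re (f t)) * (Re (f1 t))\<^sup>2)
            + indicator {a..x} t *\<^sub>R complex_of_real (psi' (Re (f t)) * Re (f2 t))"
      proof (cases "t < a")
        case True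
        then show ?thesis using z[OF aS] by simp
      next
        case False
        then show ?thesis by (auto simp: indicator_def g2_def)
      qed
    qed
    also have "\<dots> = (LINT t|lborel. indicator {a..x} t *\<^sub>R complex_of_real (psi'' (Re (f t)) * (Re (f1 t))\<^sup>2))
            + (LINT t|lborel. indicator {a..x} t *\<^sub>R complex_of_real (psi' (Re (f t)) * Re (f2 t)))"
      by (intro Bochner_Integration.integral_add integrable_indicator_scaleR integrable_of_real i1 i2) auto
    also have "\<dots> = of_real (psi' (Re (f x))) * of_real (Re (f1 x))"
      using by_parts[OF C1_triple_Re[OF tr] ud uc aS ax] by (simp add: power2_eq_square mult.assoc)
    finally show ?thesis by simp
  qed
  then show ?thesis
    unfolding C1_triple_def using trD(3,4) f1_zero[OF tr] d integrable_of_real[OF ig2]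
    unfolding g2_def by auto
qed

context levy_bounded_support
begin

text \<open>The first derivative of psi (f) is psi' (f) f1, so drift and compensator agree on both
  sides. Jumps are compared by \<open>psi_convex\<close> under the nonnegative weight, and the
  diffusion part gains (A / 2) psi'' (f) f1^2 >= 0.\<close>

lemma levy_op_psi_le:
  assumes tr: "C1_triple S f f1 f2"
  shows "AE x in lborel. psi' (Re (f x)) * Re (levy_op A \<gamma> \<nu> f f1 f2 x)
    \<le> Re (levy_op A \<gamma> \<nu> (\<lambda>x. of_real (psi (Re (f x)))) (\<lambda>x. of_real (psi' (Re (f x)) * Re (f1 x)))
      (\<lambda>x. of_real (psi' (Re (f x)) * Re (f2 x) + psi'' (Re (f x)) * (Re (f1 x))\<^sup>2)) x)"
proof -
  define g g1 g2 where "g x = complex_of_real (psi (Re (f x)))"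
    and "g1 x = complex_of_real (psi' (Re (f x)) * Re (f1 x))"
    and "g2 x = complex_of_real (psi' (Re (f x)) * Re (f2 x) + psi'' (Re (f x)) * (Re (f1 x))\<^sup>2)" for x
  have tg: "C1_triple S g g1 g2"
    using psi_triple[OF tr] by (simp add: g_def[abs_def] g1_def[abs_def] g2_def[abs_def])
  have "AE x in lborel. psi' (Re (f x)) * Re (levy_op A \<gamma> \<nu> f f1 f2 x) \<le> Re (levy_op A \<gamma> \<nu> g g1 g2 x)"
    using increment_integrable_y[OF tr] increment_integrable_y[OF tg]
  proof eventually_elim
    case (elim x)
    let ?p = "psi' (Re (f x))"
    have le: "?p * Re (increment f f1 x y) \<le> Re (increment g g1 x y)" for y
    proof -
      have "?p * Re (increment f f1 x y) = jump_weight y * (?p * (Re (f (x + y)) - Re (f x))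
          - (y * indicator {-1..1} y) * (?p * Re (f1 x)))"
        by (simp add: increment_def algebra_simps)
      also have "\<dots> \<le> jump_weight y * ((psi (Re (f (x + y))) - psi (Re (f x)))
          - (y * indicator {-1..1} y) * (?p * Re (f1 x)))"
        by (intro mult_left_mono diff_right_mono psi_convex jump_weight_bounds)
      also have "\<dots> = Re (increment g g1 x y)"
        by (simp add: increment_def g_def g1_def)
      finally show ?thesis .
    qed
    have "?p * Re (LINT y|\<kappa>. increment f f1 x y) = (LINT y|\<kappa>. ?p * Re (increment f f1 x y))"
      using elim(1) by simp
    also have "\<dots> \<le> (LINT y|\<kappa>. Re (increment g g1 x y))"
      using elim le by (intro integral_mono integrable_mult_right integrable_Re) auto
    also have "\<dots> = Re (LINT y|\<kappa>. increment g g1 x y)" using elim(2) by simp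
    finally have j: "?p * Re (LINT y|\<kappa>. increment f f1 x y) \<le> Re (LINT y|\<kappa>. increment g g1 x y)" .
    have "A / 2 * (?p * Re (f2 x)) \<le> A / 2 * (?p * Re (f2 x) + psi'' (Re (f x)) * (Re (f1 x))\<^sup>2)"
      using A_nonneg psi''_bounds(1) by (intro mult_left_mono) auto
    then show ?case
      using j by (simp add: levy_op_def g1_def g2_def algebra_simps)
  qed
  then show ?thesis by (simp add: g_def[abs_def] g1_def[abs_def] g2_def[abs_def])
qed

text \<open>Integrate against the weight \<open>1 + Re (\<alpha> exp (i z x))\<close>: the adjoint generator maps it to
  \<open>- Re (\<alpha> \<lambda>(-z) exp (i z x))\<close>, which is negative on the support for suitable \<open>\<alpha>\<close>.\<close>

lemma dissipative:
  assumes tr: "C1_triple S f f1 f2"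
  shows "norm (levy_exponent A \<gamma> \<nu> (- (1 / R))) * cos 1 * (LINT x|lborel. psi (Re (f x)))
    \<le> 2 * (LINT x|lborel. indicator S x * norm (levy_op A \<gamma> \<nu> f f1 f2 x))"
proof -
  note trD = C1_tripleD[OF tr]
  note [measurable] = f_borel[OF tr] levy_op_borel[OF tr]
  define g g1 g2 where "g x = complex_of_real (psi (Re (f x)))"
    and "g1 x = complex_of_real (psi' (Re (f x)) * Re (f1 x))"
    and "g2 x = complex_of_real (psi' (Re (f x)) * Re (f2 x) + psi'' (Re (f x)) * (Re (f1 x))\<^sup>2)" for x
  have tg: "C1_triple S g g1 g2"
    using psi_triple[OF tr] by (simp add: g_def[abs_def] g1_def[abs_def] g2_def[abs_def])
  define Lf where "Lf = levy_op A \<gamma> \<nu> f f1 f2"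
  define Lg where "Lg = levy_op A \<gamma> \<nu> g g1 g2"
  have Lfg: "AE x in lborel. psi' (Re (f x)) * Re (Lf x) \<le> Re (Lg x)"
    using levy_op_psi_le[OF tr] by (simp add: Lf_def Lg_def g_def[abs_def] g1_def[abs_def] g2_def[abs_def])
  have [measurable]: "Lf \<in> borel_measurable borel" unfolding Lf_def by measurable
  have iLf: "integrable lborel Lf" unfolding Lf_def by (rule levy_op_integrable[OF tr])
  have iLg: "integrable lborel Lg" unfolding Lg_def by (rule levy_op_integrable[OF tg])
  \<comment> \<open>At frequency 1 / R the argument x / R lies in [- 1, 1] on S, so cos (x / R) is
    at least cos 1 > 0 there.\<close>
  define \<Lambda> where "\<Lambda> = levy_exponent A \<gamma> \<nu> (- (1 / R))"
  \<comment> \<open>The phase that rotates \<Lambda> onto the positive axis. For \<Lambda> = 0 it is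
    0 by the convention on division, and both properties below persist.\<close>
  define \<alpha> where "\<alpha> = cnj \<Lambda> / of_real (norm \<Lambda>)"
  have \<alpha>: "norm \<alpha> \<le> 1" "\<alpha> * \<Lambda> = of_real (norm \<Lambda>)"
    by (auto simp: \<alpha>_def norm_divide complex_norm_square[symmetric] power2_eq_square mult.commute[of "cnj \<Lambda>"])
  define E where "E x = exp (\<i> * of_real (1 / R * x))" for x
  have E_norm: "norm (E x) = 1" for x by (simp add: E_def)
  have [measurable]: "E \<in> borel_measurable borel" unfolding E_def by measurable
  note FE = levy_op_fourier[OF tg, of "1 / R", folded E_def Lg_def \<Lambda>_def]
  define w where "w x = 1 + Re (\<alpha> * E x)" for x
  have [measurable]: "w \<in> borel_measurable borel" unfolding w_def by measurable
  have w: "0 \<le> w x" "w x \<le> 2" for x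
    using abs_Re_le_cmod[of "\<alpha> * E x"] \<alpha>(1) by (auto simp: w_def norm_mult E_norm)
  \<comment> \<open>The exponent vanishes at 0, so the constant 1, added to make the weight
    nonnegative, contributes nothing to the integral.\<close>
  have F0: "(LINT x|lborel. Lg x) = 0"
    using levy_op_fourier(3)[OF tg, of 0] by (simp add: levy_exponent_def Lg_def)
  have LgR: "Im (Lg x) = 0" for x
  proof -
    have "Lg x = of_real (Re (Lg x))"
    proof -
      have "increment g g1 x y = of_real (Re (increment g g1 x y))" for y
        by (simp add: increment_def g_def g1_def scaleR_conv_of_real)
      then have "(LINT y|\<kappa>. increment g g1 x y) = of_real (LINT y|\<kappa>. Re (increment g g1 x y))"
        by (metis (mono_tags, lifting) Bochner_Integration.integral_cong integral_complex_of_real)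
      then show ?thesis
        by (simp add: Lg_def levy_op_def g1_def g2_def scaleR_conv_of_real complex_eq_iff)
    qed
    then show ?thesis by (metis Im_complex_of_real)
  qed
  have wL: "w x * Re (Lg x) = Re (Lg x + \<alpha> * (E x * Lg x))" for x
    using LgR[of x] by (simp add: w_def algebra_simps)
  have "(LINT x|lborel. w x * Re (Lg x)) = Re (LINT x|lborel. Lg x + \<alpha> * (E x * Lg x))"
    unfolding wL using iLg FE(2) by (intro integral_Re) auto
  also have "\<dots> = Re (\<alpha> * (- \<Lambda> * (LINT x|lborel. E x * g x)))"
    using iLg FE(2,3) F0 by simp
  also have "\<dots> = - norm \<Lambda> * Re (LINT x|lborel. E x * g x)"
  proof -
    have "\<alpha> * (- \<Lambda> * I) = of_real (- norm \<Lambda>) * I" for I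
      using \<alpha>(2) by (simp flip: mult.assoc)
    then show ?thesis by (simp only: times_complex.sel Re_complex_of_real Im_complex_of_real mult_zero_left diff_zero)
  qed
  also have "Re (LINT x|lborel. E x * g x) = (LINT x|lborel. Re (E x * g x))"
    by (rule integral_Re[OF FE(1), symmetric])
  finally have wLg: "(LINT x|lborel. w x * Re (Lg x)) = - norm \<Lambda> * (LINT x|lborel. Re (E x * g x))" .
  have "cos 1 * (LINT x|lborel. psi (Re (f x))) = (LINT x|lborel. cos 1 * Re (g x))"
    by (simp add: g_def)
  also have "\<dots> \<le> (LINT x|lborel. Re (E x * g x))"
  proof (rule integral_mono)
    show "integrable lborel (\<lambda>x. cos 1 * Re (g x))"
      using f_integrable[OF tg] by simp
    show "integrable lborel (\<lambda>x. Re (E x * g x))" by (rule integrable_Re[OF FE(1)])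
    show "cos 1 * Re (g x) \<le> Re (E x * g x)" for x
    proof (cases "x \<in> S")
      case True
      then have "\<bar>x / R\<bar> \<le> 1" using S_bound R_pos by (auto simp: abs_le_iff field_simps)
      then have "cos 1 \<le> cos \<bar>x / R\<bar>"
        using pi_ge_two by (intro cos_monotone_0_pi_le) auto
      then have "cos 1 * psi (Re (f x)) \<le> cos (x / R) * psi (Re (f x))"
        unfolding cos_abs_real by (rule mult_right_mono) simp
      then show ?thesis by (simp add: g_def E_def Re_exp)
    qed (use trD(3) in \<open>simp add: g_def\<close>)
  qed
  finally have "norm \<Lambda> * (cos 1 * (LINT x|lborel. psi (Re (f x)))) \<le> norm \<Lambda> * (LINT x|lborel. Re (E x * g x))"
    by (rule mult_left_mono) simp
  also have "\<dots> = - (LINT x|lborel. w x * Re (Lg x))" using wLg by simp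
  also have "\<dots> \<le> - (LINT x|lborel. w x * (psi' (Re (f x)) * Re (Lf x)))"
  proof -
    have "(LINT x|lborel. w x * (psi' (Re (f x)) * Re (Lf x))) \<le> (LINT x|lborel. w x * Re (Lg x))"
    proof (rule integral_mono_AE)
      show "integrable lborel (\<lambda>x. w x * Re (Lg x))"
        unfolding wL using iLg FE(2) by (intro integrable_Re Bochner_Integration.integrable_add integrable_mult_right) auto
      show "integrable lborel (\<lambda>x. w x * (psi' (Re (f x)) * Re (Lf x)))"
      proof (rule Bochner_Integration.integrable_bound[OF integrable_norm[OF integrable_mult_right[OF iLf, of 2]]])
        have "\<bar>w x * (psi' (Re (f x)) * Re (Lf x))\<bar> \<le> 2 * (1 * norm (Lf x))" for x
          unfolding abs_mult using w[of x] by (intro mult_mono abs_psi'_le abs_Re_le_cmod) auto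
        then show "AE x in lborel. norm (w x * (psi' (Re (f x)) * Re (Lf x))) \<le> norm (norm (2 * Lf x))"
          by (simp add: norm_mult)
      qed measurable
      show "AE x in lborel. w x * (psi' (Re (f x)) * Re (Lf x)) \<le> w x * Re (Lg x)"
        using Lfg by eventually_elim (simp add: mult_left_mono w)
    qed
    then show ?thesis by simp
  qed
  also have "\<dots> \<le> \<bar>LINT x|lborel. w x * (psi' (Re (f x)) * Re (Lf x))\<bar>" by simp
  also have "\<dots> \<le> (LINT x|lborel. 2 * (indicator S x * norm (Lf x)))"
  proof (rule integral_abs_bound[THEN order_trans], rule integral_mono_AE')
    show "integrable lborel (\<lambda>x. 2 * (indicator S x * norm (Lf x)))"
      using integrable_indicator_scaleR[OF integrable_norm[OF iLf] S_borel] by simp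
    \<comment> \<open>Outside S the function f, and with it psi' (f), is 0. This discards the
      generator off S, so that only its truncation enters the estimate.\<close>
    have "\<bar>w x * (psi' (Re (f x)) * Re (Lf x))\<bar> \<le> 2 * (indicator S x * norm (Lf x))" for x
    proof (cases "x \<in> S")
      case True
      have "\<bar>w x * (psi' (Re (f x)) * Re (Lf x))\<bar> \<le> 2 * (1 * norm (Lf x))"
        unfolding abs_mult using w[of x] by (intro mult_mono abs_psi'_le abs_Re_le_cmod) auto
      then show ?thesis using True by simp
    qed (use trD(3) in simp)
    then show "AE x in lborel. \<bar>w x * (psi' (Re (f x)) * Re (Lf x))\<bar> \<le> 2 * (indicator S x * norm (Lf x))"
      by simp
  qed simp
  finally show ?thesis by (simp add: \<Lambda>_def Lf_def mult.assoc)
qed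

end

section \<open>The class of test functions and the Levy exponent\<close>

text \<open>Bridge between the completed measure of the statement and \<open>lborel\<close>, on
  which the product measures above are formed.\<close>

lemma integrable_lebesgue_on_iff:
  fixes h :: "real \<Rightarrow> 'b::{banach, second_countable_topology}"
  assumes [measurable]: "S \<in> sets borel" "h \<in> borel_measurable borel"
  shows "integrable (lebesgue_on S) h \<longleftrightarrow> integrable lborel (\<lambda>x. indicator S x *\<^sub>R h x)"
  by (subst integrable_restrict_space) (auto intro!: integrable_completion)

lemma integral_lebesgue_on_eq:
  fixes h :: "real \<Rightarrow> 'b::{banach, second_countable_topology}"
  assumes [measurable]: "S \<in> sets borel" "h \<in> borel_measurable borel"
  shows "(LINT x|lebesgue_on S. h x) = (LINT x|lborel. indicator S x *\<^sub>R h x)"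
  by (subst integral_restrict_space) (auto intro!: integral_completion)

lemma AE_lebesgue_on_iff:
  assumes "S \<in> sets borel"
  shows "(AE x in lebesgue_on S. P x) \<longleftrightarrow> (AE x in lborel. x \<in> S \<longrightarrow> P x)"
  using assms by (subst AE_restrict_space_iff) (auto simp: AE_completion_iff)

text \<open>Completeness of Lebesgue measure. It gives measurability of (s I - L) f, which is
  identified with a measurable function only almost everywhere.\<close>

lemma borel_measurable_lebesgue_on_AE:
  fixes f g :: "real \<Rightarrow> complex"
  assumes S: "S \<in> sets borel" and f: "f \<in> borel_measurable (lebesgue_on S)"
    and ae: "AE x in lebesgue_on S. f x = g x"
  shows "g \<in> borel_measurable (lebesgue_on S)"
proof -
  have S': "S \<inter> space lebesgue \<in> sets lebesgue" using S by auto
  have "(\<lambda>x. indicator S x *\<^sub>R f x) \<in> borel_measurable lebesgue"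
    using f borel_measurable_restrict_space_iff[OF S'] by blast
  moreover have "AE x in lebesgue. indicator S x *\<^sub>R f x = indicator S x *\<^sub>R g x"
    using ae unfolding AE_restrict_space_iff[OF S'] by eventually_elim (auto simp: indicator_def)
  ultimately have "(\<lambda>x. indicator S x *\<^sub>R g x) \<in> borel_measurable lebesgue"
    by (rule borel_measurable_AE)
  then show ?thesis using borel_measurable_restrict_space_iff[OF S'] by blast
qed

text \<open>A zero of the exponent makes the characteristic function of X 1 equal to 1 at z, so cos
  (z X 1) = 1 almost surely and X 1 lives on a lattice. A lattice is a Lebesgue null set, which
  contradicts the density.\<close>

lemma levy_exponent_nonzero:
  assumes lp: "levy_process M X A \<gamma> \<nu>" and dens: "continuous_levy_density M X A \<gamma> \<nu>" and z: "z \<noteq> 0"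
  shows "levy_exponent A \<gamma> \<nu> z \<noteq> 0"
proof
  assume 0: "levy_exponent A \<gamma> \<nu> z = 0"
  interpret prob_space M using lp by (simp add: levy_process_def)
  have [measurable]: "X 1 \<in> borel_measurable M" using lp by (simp add: levy_process_def)
  have ch: "(LINT \<omega>|M. exp (\<i> * of_real (z * X 1 \<omega>))) = 1"
    using lp 0 by (simp add: levy_process_def levy_mu_def)
  have i: "integrable M (\<lambda>\<omega>. exp (\<i> * complex_of_real (z * X 1 \<omega>)))"
    by (rule integrable_const_bound[where B = 1]) auto
  have "(LINT \<omega>|M. Re (exp (\<i> * complex_of_real (z * X 1 \<omega>)))) = 1"
    using integral_Re[OF i] ch by simp
  then have c: "(LINT \<omega>|M. cos (z * X 1 \<omega>)) = 1" by (simp add: Re_exp)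
  have ic: "integrable M (\<lambda>\<omega>. cos (z * X 1 \<omega>))"
    by (rule integrable_const_bound[where B = 1]) auto
  have "(LINT \<omega>|M. 1 - cos (z * X 1 \<omega>)) = 0" using ic c by (simp add: prob_space)
  then have ae: "AE \<omega> in M. 1 - cos (z * X 1 \<omega>) = 0"
    using ic by (subst (asm) integral_nonneg_eq_0_iff_AE) auto
  define d where "d x = ennreal (levy_density A \<gamma> \<nu> x 1)" for x
  have D: "distributed M lborel (X 1) d"
    using dens by (simp add: continuous_levy_density_def d_def[abs_def])
  have eq: "distr M lborel (X 1) = density lborel d"
    and [measurable]: "d \<in> borel_measurable borel"
    using distributed_distr_eq_density[OF D] distributed_borel_measurable[OF D] by auto
  have "AE x in distr M lborel (X 1). 1 - cos (z * x) = 0"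
    using ae by (subst AE_distr_iff) auto
  then have "AE x in lborel. 0 < d x \<longrightarrow> 1 - cos (z * x) = 0"
    unfolding eq by (subst (asm) AE_density) auto
  moreover have "AE x in lborel. cos (z * x) \<noteq> 1"
  proof -
    have "{x. cos (z * x) = 1} \<subseteq> range (\<lambda>n::int. n * 2 * pi / z)"
      using z by (auto simp: cos_one_2pi_int image_iff field_simps)
    then have "countable {x. cos (z * x) = 1}"
      by (rule countable_subset) auto
    then have "{x. cos (z * x) = 1} \<in> null_sets lborel"
      by (rule countable_imp_null_set_lborel)
    then show ?thesis by (rule AE_I') auto
  qed
  ultimately have "AE x in lborel. d x = 0"
    by eventually_elim (auto simp: not_gr_zero)
  then have "(\<integral>\<^sup>+x. d x \<partial>lborel) = 0"
    by (subst nn_integral_0_iff_AE) auto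
  moreover have "emeasure (distr M lborel (X 1)) UNIV = 1"
    using emeasure_space_1 by (subst emeasure_distr) auto
  then have "(\<integral>\<^sup>+x. d x \<partial>lborel) = 1"
    unfolding eq by (subst (asm) emeasure_density) auto
  ultimately show False by simp
qed

lemma disjoint_segments_less:
  assumes "disjoint_segments n a b" "j \<in> {1..n}" "k \<in> {1..n}" "j < k"
  shows "b j < a k"
proof -
  have *: "\<forall>k\<in>{1..n}. a k < b k" "\<forall>k\<in>{1..<n}. b k < a (Suc k)"
    using assms(1) by (auto simp: disjoint_segments_def)
  have "j + Suc d \<le> n \<Longrightarrow> b j < a (j + Suc d)" for d
  proof (induction d)
    case 0
    then show ?case using * assms(2) by auto
  next
    case (Suc d)
    then have "b j < a (j + Suc d)" "a (j + Suc d) < b (j + Suc d)" "b (j + Suc d) < a (Suc (j + Suc d))"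
      using * assms(2) by auto
    then show ?case by simp
  qed
  from this[of "k - j - 1"] show ?thesis using assms by auto
qed

lemma segment_union_compact: "compact (segment_union n a b)"
  unfolding segment_union_def by (intro compact_UN) auto

lemma segment_union_interior:
  assumes "disjoint_segments n a b" "k \<in> {1..n}" "a k < x" "x < b k"
  shows "at x within segment_union n a b = at x" "\<forall>\<^sub>F y in nhds x. y \<in> segment_union n a b"
proof -
  have sub: "{a k<..<b k} \<subseteq> segment_union n a b"
    using assms(2) by (force simp: segment_union_def)
  show "at x within segment_union n a b = at x"
    using assms sub by (intro at_within_interior) (meson greaterThanLessThan_iff interiorI open_greaterThanLessThan)
  show "\<forall>\<^sub>F y in nhds x. y \<in> segment_union n a b"
    using assms sub unfolding eventually_nhds by (intro exI[of _ "{a k<..<b k}"]) auto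
qed

text \<open>Outside S the truncated function is 0 and hence agrees with its linear approximation, so
  a derivative 0 from within S suffices. This is the gluing at the endpoints.\<close>

lemma truncation_has_derivative_0:
  fixes f :: "real \<Rightarrow> complex"
  assumes "(f has_vector_derivative 0) (at x within S)" "f x = 0"
  shows "(truncation S f has_vector_derivative 0) (at x)"
  using assms
  unfolding has_vector_derivative_def has_derivative_within_alt truncation_def
  by (auto; meson)

context
  fixes p :: real and n :: nat and a b :: "nat \<Rightarrow> real" and S :: "real set" and R :: real
    and A \<gamma> :: real and \<nu> :: "real measure"
  assumes p: "1 < p" and seg: "disjoint_segments n a b" and S: "S = segment_union n a b"
    and lbs: "levy_bounded_support S R A \<nu>"
begin

interpretation levy_bounded_support S R A \<gamma> \<nu> by (rule lbs)

text \<open>The boundary conditions make the extension by 0 work: f and its derivative vanish at all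
  endpoints, so the extension is C^1; the second derivative has integral 0 over each whole segment,
  so one primitive from minus infinity restricts to the given derivative on every segment.\<close>

lemma C_segments_triple:
  assumes f: "f \<in> C_segments p n a b"
  obtains f1 f2 where "C1_triple S (truncation S f) f1 f2"
    "integrable lborel (\<lambda>x. norm (f2 x) powr p)"
    "AE x in lebesgue_on S. truncated_generator A \<gamma> \<nu> S f x = levy_op A \<gamma> \<nu> (truncation S f) f1 f2 x"
proof -
  from f obtain g1 g2 where d1: "\<And>x. x \<in> S \<Longrightarrow> (f has_vector_derivative g1 x) (at x within S)"
    and d2: "AE x in lebesgue_on S. (g1 has_vector_derivative g2 x) (at x within S)"
    and int: "\<And>k x. k \<in> {1..n} \<Longrightarrow> x \<in> {a k..b k} \<Longrightarrow> (g2 has_integral (g1 x - g1 (a k))) {a k..x}"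
    and g2: "g2 \<in> Lp p S"
    and bd: "\<And>k. k \<in> {1..n} \<Longrightarrow> f (a k) = 0 \<and> f (b k) = 0 \<and> g1 (a k) = 0 \<and> g1 (b k) = 0"
    unfolding C_segments_def S[symmetric] Let_def by fast
  have ab: "a k < b k" if "k \<in> {1..n}" for k using seg that by (auto simp: disjoint_segments_def)
  have S': "S \<inter> space lebesgue \<in> sets lebesgue" by auto
  have g2m: "(\<lambda>x. indicator S x *\<^sub>R g2 x) \<in> borel_measurable lebesgue"
    using g2 borel_measurable_restrict_space_iff[OF S'] unfolding Lp_def by blast
  \<comment> \<open>The second derivative is given as a Lebesgue measurable function; the product
    measurability behind Fubini is used for Borel functions, so a Borel representative is
    chosen.\<close>
  obtain gr gi where gr: "gr \<in> borel_measurable lborel" "AE x in lborel. Re (indicator S x *\<^sub>R g2 x) = gr x"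
    and gi: "gi \<in> borel_measurable lborel" "AE x in lborel. Im (indicator S x *\<^sub>R g2 x) = gi x"
    using completion_ex_borel_measurable_real[of "\<lambda>x. Re (indicator S x *\<^sub>R g2 x)" lborel]
      completion_ex_borel_measurable_real[of "\<lambda>x. Im (indicator S x *\<^sub>R g2 x)" lborel]
      measurable_compose[OF g2m borel_measurable_Re] measurable_compose[OF g2m borel_measurable_Im] by blast
  define f2 where "f2 x = (if x \<in> S then Complex (gr x) (gi x) else 0)" for x
  have [measurable]: "f2 \<in> borel_measurable borel"
  proof -
    have "f2 = (\<lambda>x. indicator S x * (of_real (gr x) + \<i> * of_real (gi x)))"
      by (auto simp: f2_def fun_eq_iff complex_eq_iff)
    then show ?thesis using gr(1) gi(1) by simp
  qed
  have f2g2: "AE x in lborel. f2 x = indicator S x *\<^sub>R g2 x"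
    using gr(2) gi(2) by eventually_elim (auto simp: f2_def complex_eq_iff indicator_def)
  have f2p: "integrable lborel (\<lambda>x. norm (f2 x) powr p)"
  proof -
    have "integrable (lebesgue_on S) (\<lambda>x. norm (g2 x) powr p)" using g2 by (simp add: Lp_def)
    then have "integrable lebesgue (\<lambda>x. indicator S x *\<^sub>R (norm (g2 x) powr p))"
      by (subst (asm) integrable_restrict_space) auto
    moreover have "(\<lambda>x. norm (f2 x) powr p) \<in> borel_measurable lebesgue"
      by (intro measurable_completion) simp
    ultimately have "integrable lebesgue (\<lambda>x. norm (f2 x) powr p)"
      by (rule integrable_cong_AE_imp)
        (use AE_completion[OF f2g2] in \<open>auto elim!: eventually_mono simp: indicator_def split: if_splits\<close>)
    then show ?thesis by (subst (asm) integrable_completion) auto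
  qed
  have f2S: "f2 x = 0" if "x \<notin> S" for x using that by (simp add: f2_def)
  have f2i: "integrable lborel f2"
  proof (rule Bochner_Integration.integrable_bound)
    show "integrable lborel (\<lambda>x. indicator S x + norm (f2 x) powr p :: real)"
      using f2p S_lmeas(3) by (intro Bochner_Integration.integrable_add integrable_real_indicator) auto
    have "norm (f2 x) \<le> indicator S x + norm (f2 x) powr p" for x
      using le_plus_powr[of "norm (f2 x)" 1 p] p f2S[of x] by (cases "x \<in> S") auto
    then show "AE x in lborel. norm (f2 x) \<le> norm (indicator S x + norm (f2 x) powr p :: real)"
      by (auto intro!: AE_I2 order_trans[OF _ abs_ge_self])
  qed measurable
  have seg_int: "(LINT t|lborel. indicator {a k..x} t *\<^sub>R f2 t) = g1 x"
    if k: "k \<in> {1..n}" and x: "x \<in> {a k..b k}" for k x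
  proof -
    have sub: "{a k..x} \<subseteq> S" using k x by (force simp: S segment_union_def)
    let ?h = "\<lambda>t. indicator {a k..x} t *\<^sub>R f2 t"
    let ?h' = "\<lambda>t. indicator {a k..x} t *\<^sub>R g2 t"
    have eq: "AE t in lebesgue. ?h t = ?h' t"
      using AE_completion[OF f2g2] by eventually_elim (use sub in \<open>auto simp: indicator_def\<close>)
    have ih: "integrable lebesgue ?h"
      using integrable_indicator_scaleR[OF f2i, of "{a k..x}"] by (subst integrable_completion) auto
    have h'm: "?h' \<in> borel_measurable lebesgue"
      by (rule borel_measurable_AE[OF borel_measurable_integrable[OF ih] eq])
    have ih': "integrable lebesgue ?h'"
      by (rule integrable_cong_AE_imp[OF ih h'm]) (use eq in \<open>auto elim: eventually_mono\<close>)
    have "(?h' has_integral (LINT t|lebesgue. ?h' t)) UNIV"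
      by (rule has_integral_integral_lebesgue[OF ih'])
    moreover have "(?h' has_integral (g1 x - g1 (a k))) UNIV"
    proof -
      have "?h' = (\<lambda>t. if t \<in> {a k..x} then g2 t else 0)" by (auto simp: fun_eq_iff)
      then show ?thesis using int[OF k x] by (simp only: has_integral_restrict_UNIV)
    qed
    ultimately have "(LINT t|lebesgue. ?h' t) = g1 x - g1 (a k)" by (rule has_integral_unique)
    moreover have "(LINT t|lebesgue. ?h' t) = (LINT t|lebesgue. ?h t)"
      by (rule integral_cong_AE) (use eq h'm ih in \<open>auto elim: eventually_mono\<close>)
    moreover have "(LINT t|lebesgue. ?h t) = (LINT t|lborel. ?h t)"
      by (rule integral_completion) simp
    ultimately show ?thesis using bd[OF k] by simp
  qed
  define f1 where "f1 x = (LINT t|lborel. indicator {..x} t *\<^sub>R f2 t)" for x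
  have disj: "k = j" if "k \<in> {1..n}" "j \<in> {1..n}" "t \<in> {a k..b k}" "t \<in> {a j..b j}" for k j t
    using disjoint_segments_less[OF seg, of k j] disjoint_segments_less[OF seg, of j k] that
    by (cases k j rule: linorder_cases) auto
  \<comment> \<open>Segments to the right of x contribute nothing, and complete segments to the left
    contribute g1 (b k) = 0; only the segment that contains x remains.\<close>
  have f1_sum: "f1 x = (\<Sum>k\<in>{1..n}. if x \<in> {a k..b k} then g1 x else 0)" for x
  proof -
    have "f2 t = (\<Sum>k\<in>{1..n}. indicator {a k..b k} t *\<^sub>R f2 t)" for t
    proof (cases "t \<in> S")
      case True
      then obtain k where k: "k \<in> {1..n}" "t \<in> {a k..b k}" by (auto simp: S segment_union_def)
      have "(\<Sum>j\<in>{1..n}. indicator {a j..b j} t *\<^sub>R f2 t) = (\<Sum>j\<in>{1..n}. if j = k then f2 t else 0)"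
      proof (rule sum.cong[OF refl])
        fix j assume j: "j \<in> {1..n}"
        show "indicator {a j..b j} t *\<^sub>R f2 t = (if j = k then f2 t else 0)"
          using disj[OF k(1) j k(2)] k(2) by (cases "t \<in> {a j..b j}") auto
      qed
      then show ?thesis using k by simp
    qed (simp add: f2S)
    then have "f1 x = (LINT t|lborel. indicator {..x} t *\<^sub>R (\<Sum>k\<in>{1..n}. indicator {a k..b k} t *\<^sub>R f2 t))"
      unfolding f1_def by (metis (mono_tags, lifting))
    also have "\<dots> = (LINT t|lborel. (\<Sum>k\<in>{1..n}. indicator {..x} t *\<^sub>R indicator {a k..b k} t *\<^sub>R f2 t))"
      by (simp only: scaleR_sum_right)
    also have "\<dots> = (\<Sum>k\<in>{1..n}. LINT t|lborel. indicator {..x} t *\<^sub>R indicator {a k..b k} t *\<^sub>R f2 t)"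
      by (intro Bochner_Integration.integral_sum integrable_indicator_scaleR f2i) auto
    also have "\<dots> = (\<Sum>k\<in>{1..n}. if x \<in> {a k..b k} then g1 x else 0)"
    proof (rule sum.cong[OF refl])
      fix k assume k: "k \<in> {1..n}"
      let ?I = "LINT t|lborel. indicator {..x} t *\<^sub>R indicator {a k..b k} t *\<^sub>R f2 t"
      consider "x < a k" | "x \<in> {a k..b k}" | "b k < x" by fastforce
      then show "?I = (if x \<in> {a k..b k} then g1 x else 0)"
      proof cases
        case 1
        then have "indicator {..x} t *\<^sub>R indicator {a k..b k} t *\<^sub>R f2 t = 0" for t
          by (auto simp: indicator_def)
        then have "?I = 0" by (simp only: Bochner_Integration.integral_zero)
        then show ?thesis using 1 by simp
      next
        case 2
        then have "?I = (LINT t|lborel. indicator {a k..x} t *\<^sub>R f2 t)"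
          by (intro Bochner_Integration.integral_cong) (auto simp: indicator_def)
        then show ?thesis using 2 seg_int[OF k 2] by simp
      next
        case 3
        then have "?I = (LINT t|lborel. indicator {a k..b k} t *\<^sub>R f2 t)"
          by (intro Bochner_Integration.integral_cong) (auto simp: indicator_def)
        then show ?thesis using 3 seg_int[OF k, of "b k"] bd[OF k] ab[OF k] by simp
      qed
    qed
    finally show ?thesis .
  qed
  have f1_g1: "f1 x = (if x \<in> S then g1 x else 0)" for x
  proof (cases "x \<in> S")
    case True
    then obtain k where k: "k \<in> {1..n}" "x \<in> {a k..b k}" by (auto simp: S segment_union_def)
    have "f1 x = (\<Sum>j\<in>{1..n}. if x \<in> {a j..b j} then g1 x else 0)" by (rule f1_sum)
    also have "\<dots> = (\<Sum>j\<in>{1..n}. if j = k then g1 x else 0)"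
    proof (rule sum.cong[OF refl])
      fix j assume j: "j \<in> {1..n}"
      show "(if x \<in> {a j..b j} then g1 x else 0) = (if j = k then g1 x else 0)"
      proof (cases "j = k")
        case True
        then show ?thesis using k(2) by (simp only: if_True refl)
      next
        case False
        then have "x \<notin> {a j..b j}" using disj[OF k(1) j k(2)] by blast
        then show ?thesis using False by (simp only: if_False)
      qed
    qed
    finally show ?thesis using k True by simp
  next
    case False
    then have "x \<notin> {a k..b k}" if "k \<in> {1..n}" for k using that by (auto simp: S segment_union_def)
    then have "(\<Sum>k\<in>{1..n}. if x \<in> {a k..b k} then g1 x else 0) = 0"
      by (intro sum.neutral) auto
    then show ?thesis using False f1_sum[of x] by simp
  qed
  have seg_sub: "{a k<..<b k} \<subseteq> S" if "k \<in> {1..n}" for k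
    using that by (force simp: S segment_union_def)
  let ?F = "truncation S f"
  have F_deriv: "(?F has_vector_derivative f1 x) (at x)" for x
  proof (cases "x \<in> S")
    case False
    have "open (- S)" using S_compact by (simp add: compact_imp_closed open_Compl)
    then have "(?F has_vector_derivative 0) (at x)"
      by (rule has_vector_derivative_transform_within_open[where S = "- S" and f = "\<lambda>_. 0",
            OF has_vector_derivative_const])
        (use False in \<open>auto simp: truncation_def\<close>)
    then show ?thesis using False by (simp add: f1_g1)
  next
    case True
    then obtain k where k: "k \<in> {1..n}" "x \<in> {a k..b k}" by (auto simp: S segment_union_def)
    consider "x = a k \<or> x = b k" | "a k < x" "x < b k" using k(2) by fastforce
    then show ?thesis
    proof cases
      case 1
      then have "f x = 0" "g1 x = 0" using bd[OF k(1)] by auto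
      then show ?thesis using truncation_has_derivative_0[of f x S] d1[OF True] True by (simp add: f1_g1)
    next
      case 2
      have "(f has_vector_derivative g1 x) (at x)"
        using d1[OF True] segment_union_interior(1)[OF seg k(1) 2] by (simp add: S)
      then have "(?F has_vector_derivative g1 x) (at x)"
        by (rule has_vector_derivative_transform_within_open[where S = "{a k<..<b k}"])
          (use 2 seg_sub[OF k(1)] in \<open>auto simp: truncation_def subset_iff\<close>)
      then show ?thesis using True by (simp add: f1_g1)
    qed
  qed
  have tr: "C1_triple S ?F f1 f2"
    using f2i f2S F_deriv by (auto simp: C1_triple_def f1_def truncation_def)
  have "AE x in lebesgue_on S. truncated_generator A \<gamma> \<nu> S f x = levy_op A \<gamma> \<nu> ?F f1 f2 x"
  proof -
    have d2': "AE x in lborel. x \<in> S \<longrightarrow> (g1 has_vector_derivative g2 x) (at x within S)"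
      using d2 by (simp add: AE_lebesgue_on_iff)
    \<comment> \<open>At an endpoint the derivative within S is one-sided. There are finitely many
      of these points, so they may be dropped.\<close>
    have "finite (a ` {1..n} \<union> b ` {1..n})" by simp
    then have "a ` {1..n} \<union> b ` {1..n} \<in> null_sets lborel"
      by (rule finite_imp_null_set_lborel)
    then have ends: "AE x in lborel. x \<notin> a ` {1..n} \<union> b ` {1..n}" by (rule AE_not_in)
    have "AE x in lborel. x \<in> S \<longrightarrow> truncated_generator A \<gamma> \<nu> S f x = levy_op A \<gamma> \<nu> ?F f1 f2 x"
      using d2' ends f2g2
    proof eventually_elim
      case (elim x)
      show ?case
      proof
        assume x: "x \<in> S"
        then obtain k where k: "k \<in> {1..n}" "x \<in> {a k..b k}" by (auto simp: S segment_union_def)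
        have xk: "a k < x" "x < b k" using k elim(2) by (auto simp: less_le)
        have "(g1 has_vector_derivative f2 x) (at x)"
          using elim(1,3) x segment_union_interior(1)[OF seg k(1) xk] by (simp add: S)
        then have D2: "(f1 has_vector_derivative f2 x) (at x)"
          by (rule has_vector_derivative_transform_within_open[where S = "{a k<..<b k}"])
            (use xk seg_sub[OF k(1)] in \<open>auto simp: f1_g1 subset_iff\<close>)
        have D1: "(\<lambda>u. vector_derivative ?F (at u)) = f1"
          using vector_derivative_at[OF F_deriv] by auto
        have [measurable]: "?F \<in> borel_measurable borel" by (rule f_borel[OF tr])
        \<comment> \<open>The integrand vanishes at y = 0, as the passage to the jump measure
          demands.\<close>
        have "(LINT y|\<nu>. ?F (x + y) - ?F x - (y * indicator {-1..1} y) *\<^sub>R f1 x)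
            = (LINT y|\<kappa>. increment ?F f1 x y)"
          unfolding increment_def by (rule nu_to_kappa(1)) simp_all
        then show "truncated_generator A \<gamma> \<nu> S f x = levy_op A \<gamma> \<nu> ?F f1 f2 x"
          using x by (simp add: truncated_generator_def truncation_def[of S "levy_generator A \<gamma> \<nu> ?F" x]
              levy_generator_def D1 vector_derivative_at[OF D2] levy_op_def)
      qed
    qed
    then show ?thesis by (simp add: AE_lebesgue_on_iff)
  qed
  then show ?thesis by (rule that[OF tr f2p])
qed

end

section \<open>Regular operators\<close>

text \<open>If h^q had infinite integral, some f in L^p would make the integral of h f infinite. It
  is built from truncations of h^q, normalised to mass 1 and added with weights 2^(-j); f is the
  p-th root of the sum.\<close>

lemma (in finite_measure) converse_Holder:
  fixes h :: "'a \<Rightarrow> real"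
  assumes [measurable]: "h \<in> borel_measurable M" and h0: "\<And>x. x \<in> space M \<Longrightarrow> 0 \<le> h x"
    and pq: "1 < p" "1 < q" "1 / p + 1 / q = 1"
    and i: "\<And>f. f \<in> Lspace p M \<Longrightarrow> integrable M (\<lambda>x. of_real (h x) * f x)"
  shows "integrable M (\<lambda>x. h x powr q)"
proof (rule ccontr)
  assume ni: "\<not> integrable M (\<lambda>x. h x powr q)"
  define H where "H m x = (if h x \<le> real m then h x powr q else 0)" for m x
  have [measurable]: "H m \<in> borel_measurable M" for m unfolding H_def by measurable
  have H0: "0 \<le> H m x" for m x by (simp add: H_def)
  have iH: "integrable M (H m)" for m
  proof (rule integrable_const_bound)
    show "AE x in M. norm (H m x) \<le> real m powr q"
      using AE_space by eventually_elim (use h0 pq in \<open>auto simp: H_def intro!: powr_mono2\<close>)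
  qed simp
  have top: "(\<integral>\<^sup>+x. ennreal (h x powr q) \<partial>M) = \<infinity>"
    using ni by (auto simp: integrable_iff_bounded less_top[symmetric])
  have lim: "(\<lambda>m. \<integral>\<^sup>+x. ennreal (H m x) \<partial>M) \<longlonglongrightarrow> \<infinity>"
  proof -
    have "(\<lambda>m. \<integral>\<^sup>+x. ennreal (H m x) \<partial>M) \<longlonglongrightarrow> (\<integral>\<^sup>+x. ennreal (h x powr q) \<partial>M)"
    proof (rule nn_integral_LIMSEQ)
      show "incseq (\<lambda>m x. ennreal (H m x))"
        by (auto simp: incseq_def le_fun_def H_def)
      show "(\<lambda>m. ennreal (H m x)) \<longlonglongrightarrow> ennreal (h x powr q)" for x
      proof (rule tendsto_eventually)
        show "\<forall>\<^sub>F m in sequentially. ennreal (H m x) = ennreal (h x powr q)"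
          using eventually_ge_at_top[of "nat \<lceil>h x\<rceil>"]
          by eventually_elim (auto simp: H_def nat_le_iff ceiling_le_iff)
      qed
    qed simp
    then show ?thesis by (simp add: top)
  qed
  have ex: "\<exists>m. c \<le> (LINT x|M. H m x)" for c :: real
  proof -
    have "\<forall>\<^sub>F m in sequentially. ennreal c < (\<integral>\<^sup>+x. ennreal (H m x) \<partial>M)"
      using order_tendstoD(1)[OF lim] by simp
    then obtain m where "ennreal c < (\<integral>\<^sup>+x. ennreal (H m x) \<partial>M)"
      by (auto simp: eventually_sequentially)
    then have "ennreal c < ennreal (LINT x|M. H m x)"
      using nn_integral_eq_integral[OF iH] H0 by simp
    then have "c \<le> (LINT x|M. H m x)"
      by (metis ennreal_leI linorder_not_less less_imp_le linear)
    then show ?thesis ..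
  qed
  \<comment> \<open>Truncation levels. The mass 4^(j q) is chosen so that its q-th root 4^j
    outweighs the loss 2^(-j) from the weights.\<close>
  define \<nu> where "\<nu> j = (SOME m. 4 powr (real j * q) \<le> (LINT x|M. H m x))" for j :: nat
  define J where "J j = (LINT x|M. H (\<nu> j) x)" for j
  have J: "4 powr (real j * q) \<le> J j" for j
    unfolding J_def \<nu>_def by (rule someI_ex[OF ex])
  have J1: "1 \<le> J j" for j
    using J[of j] pq powr_mono[of 0 "real j * q" 4] by simp
  define g where "g j x = (1 / 2) ^ j * (H (\<nu> j) x / J j)" for j x
  have g0: "0 \<le> g j x" for j x using J1[of j] H0 by (simp add: g_def)
  have [measurable]: "g j \<in> borel_measurable M" for j unfolding g_def by measurable
  have ig: "integrable M (g j)" for j unfolding g_def using iH by simp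
  have Ig: "(LINT x|M. g j x) = (1 / 2) ^ j" for j
    using J1[of j] by (simp add: g_def flip: J_def)
  have sg: "summable (\<lambda>j. g j x)" if "x \<in> space M" for x
  proof (rule summable_comparison_test'[where N = 0])
    show "summable (\<lambda>j. (1 / 2) ^ j * h x powr q)" by (intro summable_mult2 summable_geometric) simp
    show "norm (g j x) \<le> (1 / 2) ^ j * h x powr q" for j
    proof -
      have "H (\<nu> j) x / J j \<le> h x powr q / 1"
        using J1[of j] by (intro frac_le) (auto simp: H_def)
      then have "g j x \<le> (1 / 2) ^ j * h x powr q"
        unfolding g_def by (intro mult_left_mono) auto
      then show ?thesis using g0[of j x] by simp
    qed
  qed
  define G where "G x = (\<Sum>j. g j x)" for x
  have [measurable]: "G \<in> borel_measurable M" unfolding G_def by measurable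
  have iG: "integrable M G"
    unfolding G_def
  proof (rule integrable_suminf[OF ig])
    show "AE x in M. summable (\<lambda>j. norm (g j x))"
      using sg g0 by (auto intro!: AE_I2)
    show "summable (\<lambda>j. LINT x|M. norm (g j x))"
      using g0 Ig by (simp add: summable_geometric)
  qed
  have G0: "0 \<le> G x" if "x \<in> space M" for x
    unfolding G_def using sg[OF that] g0 by (rule suminf_nonneg)
  define f where "f x = complex_of_real (G x powr (1 / p))" for x
  have "f \<in> Lspace p M"
  proof -
    have "integrable M (\<lambda>x. norm (f x) powr p)"
      by (rule Bochner_Integration.integrable_cong[THEN iffD1, OF refl _ iG])
        (use G0 pq in \<open>auto simp: f_def powr_powr\<close>)
    then show ?thesis unfolding Lspace_def f_def by simp
  qed
  from i[OF this] have "integrable M (\<lambda>x. of_real (h x * G x powr (1 / p)) :: complex)"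
    by (simp add: f_def)
  then have ihG: "integrable M (\<lambda>x. h x * G x powr (1 / p))"
    by (simp only: complex_of_real_integrable_eq)
  \<comment> \<open>Keep only the j-th term of G. As h (h^q)^(1 / p) = h^q, the integral is at least
    (2^(-j) / J)^(1 / p) J = 2^(-j / p) J^(1 / q), which is at least 2^(-j) 4^j.\<close>
  have big: "2 ^ j \<le> (LINT x|M. h x * G x powr (1 / p))" for j
  proof -
    define c where "c = ((1 / 2) ^ j / J j) powr (1 / p)"
    have "2 ^ j \<le> c * J j"
    proof -
      have "c = (1 / 2) powr (real j / p) * (1 / J j) powr (1 / p)"
      proof -
        have "c = ((1 / 2) powr real j * (1 / J j)) powr (1 / p)"
          by (simp add: c_def powr_realpow)
        then show ?thesis by (simp only: powr_mult powr_powr) simp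
      qed
      then have "c * J j = (1 / 2) powr (real j / p) * ((1 / J j) powr (1 / p) * J j)"
        by simp
      also have "(1 / J j) powr (1 / p) * J j = J j powr (1 / q)"
      proof -
        have "1 / q = 1 - 1 / p" using pq(3) by simp
        then have "J j powr (1 / q) = J j / J j powr (1 / p)"
          using J1[of j] by (simp add: powr_diff)
        then show ?thesis using J1[of j] by (simp add: powr_divide)
      qed
      finally have eq: "c * J j = (1 / 2) powr (real j / p) * J j powr (1 / q)" .
      have "4 powr real j = (4 powr (real j * q)) powr (1 / q)"
        using pq by (simp add: powr_powr)
      also have "\<dots> \<le> J j powr (1 / q)" using J[of j] pq by (intro powr_mono2) auto
      finally have "4 ^ j \<le> J j powr (1 / q)" by (simp add: powr_realpow)
      moreover have "(1 / 2) ^ j \<le> (1 / 2 :: real) powr (real j / p)"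
      proof -
        have "(1 / 2 :: real) powr real j \<le> (1 / 2) powr (real j / p)"
          using pq by (intro powr_mono') (auto simp: divide_le_eq mult_le_cancel_left1)
        then show ?thesis by (simp add: powr_realpow)
      qed
      ultimately have "(1 / 2) ^ j * 4 ^ j \<le> c * J j"
        unfolding eq by (intro mult_mono) auto
      then show ?thesis by (simp flip: power_mult_distrib)
    qed
    also have "c * J j = (LINT x|M. c * H (\<nu> j) x)" by (simp add: J_def)
    also have "\<dots> \<le> (LINT x|M. h x * G x powr (1 / p))"
    proof (rule integral_mono[OF integrable_mult_right[OF iH] ihG])
      fix x assume x: "x \<in> space M"
      show "c * H (\<nu> j) x \<le> h x * G x powr (1 / p)"
      proof (cases "h x \<le> real (\<nu> j)")
        case True
        have gG: "g j x \<le> G x"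
          unfolding G_def using sum_le_suminf[OF sg[OF x], of "{j}"] g0 by simp
        have "q = 1 + q / p" using pq by (simp add: field_simps)
        then have "h x powr q = h x powr (1 + q / p)" by (rule arg_cong)
        also have "\<dots> = h x * (h x powr q) powr (1 / p)"
          using h0[OF x] by (cases "h x = 0") (simp_all add: powr_powr powr_add)
        finally have "c * H (\<nu> j) x = c * (h x * (h x powr q) powr (1 / p))"
          using True by (simp only: H_def if_True)
        also have "\<dots> = h x * (((1 / 2) ^ j / J j) * h x powr q) powr (1 / p)"
          unfolding c_def by (simp only: powr_mult mult.left_commute)
        also have "\<dots> = h x * g j x powr (1 / p)"
          using True by (simp add: g_def H_def)
        also have "\<dots> \<le> h x * G x powr (1 / p)"
          using gG g0 pq h0[OF x] by (intro mult_left_mono powr_mono2) auto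
        finally show ?thesis .
      qed (use h0[OF x] in \<open>simp add: H_def\<close>)
    qed
    finally show ?thesis .
  qed
  obtain j where "(LINT x|M. h x * G x powr (1 / p)) < 2 ^ j"
    using real_arch_pow[of 2] by auto
  then show False using big[of j] by simp
qed

text \<open>The endpoint r = 1 of the Schur test, where Tonelli and the column bound suffice. The a
  priori estimate is in L^1, so errors are compared there.\<close>

lemma (in schur_kernel) kernel_op_L1:
  assumes u: "integrable N u"
  shows "integrable N (kernel_op N k u)"
    and "(LINT x|N. norm (kernel_op N k u x)) \<le> C * (LINT x|N. norm (u x))"
proof -
  note [measurable] = borel_measurable_integrable[OF u]
  have i: "integrable N (\<lambda>x. LINT y|N. k x y * norm (u y))"
    using NN.integrable_fst'[OF k_integrable_snd[OF integrable_norm[OF u]]] by simp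
  have le: "norm (kernel_op N k u x) \<le> (LINT y|N. k x y * norm (u y))" for x
    unfolding kernel_op_def
    using integral_norm_bound[of N "\<lambda>y. of_real (k x y) * u y"] by (simp add: norm_mult k_nonneg)
  show I: "integrable N (kernel_op N k u)"
    by (rule Bochner_Integration.integrable_bound[OF i])
      (auto intro!: AE_I2 order_trans[OF le])
  have "(LINT x|N. norm (kernel_op N k u x)) \<le> (LINT x|N. LINT y|N. k x y * norm (u y))"
    by (rule integral_mono[OF integrable_norm[OF I] i le])
  also have "\<dots> \<le> C * (LINT x|N. norm (u x))"
    by (rule k_integral_snd_le[OF integrable_norm[OF u]]) simp
  finally show "(LINT x|N. norm (kernel_op N k u x)) \<le> C * (LINT x|N. norm (u x))" .
qed

lemma Lp_eq_Lspace: "Lp p S = Lspace p (lebesgue_on S)"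
  by (simp add: Lp_def Lspace_def)

locale regular_kernel = bounded_support +
  fixes p q :: real and n :: nat and a b :: "nat \<Rightarrow> real"
    and B :: "(real \<Rightarrow> complex) \<Rightarrow> real \<Rightarrow> complex" and \<Phi> :: "real \<Rightarrow> real \<Rightarrow> real"
  assumes pq: "1 < p" "1 < q" "1 / p + 1 / q = 1"
    and seg: "disjoint_segments n a b" and S_eq: "S = segment_union n a b"
    and reg: "regular_operator p n a b B \<Phi>"
begin

abbreviation "N \<equiv> lebesgue_on S"

text \<open>Clearing the diagonal, where \<Phi> may be discontinuous, makes the kernel jointly
  Borel; the value 0 off S makes it nonnegative everywhere. The diagonal is null in each variable,
  so the operators do not change.\<close>

definition ker :: "real \<Rightarrow> real \<Rightarrow> real" where
  "ker x y = (if x \<in> S \<and> y \<in> S \<and> x \<noteq> y then \<Phi> x y else 0)"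

lemma regD:
  shows "f \<in> Lp p S \<Longrightarrow> B f \<in> Lp p S"
    and "f \<in> Lp p S \<Longrightarrow> x \<in> S \<Longrightarrow> integrable N (\<lambda>y. of_real (\<Phi> x y) * f y)"
    and "f \<in> Lp p S \<Longrightarrow> x \<in> S \<Longrightarrow> B f x = (LINT y|N. of_real (\<Phi> x y) * f y)"
    and "continuous_on {(x, y). x \<in> S \<and> y \<in> S \<and> x \<noteq> y} (\<lambda>(x, y). \<Phi> x y)"
    and "x \<in> S \<Longrightarrow> y \<in> S \<Longrightarrow> 0 \<le> \<Phi> x y"
    and "j \<in> {1..n} \<Longrightarrow> y \<in> S \<Longrightarrow> \<Phi> (a j) y = 0" "j \<in> {1..n} \<Longrightarrow> y \<in> S \<Longrightarrow> \<Phi> (b j) y = 0"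
  using reg unfolding regular_operator_def compact_operator_def S_eq Let_def by blast+

definition dom :: "real \<Rightarrow> real" where
  "dom = (SOME \<phi>. (\<forall>x\<in>S. \<forall>y\<in>S. \<bar>\<Phi> x y\<bar> \<le> \<phi> (x - y)) \<and> (\<forall>r>0. integrable (lebesgue_on {-r..r}) \<phi>))"

lemma dom:
  shows "x \<in> S \<Longrightarrow> y \<in> S \<Longrightarrow> \<bar>\<Phi> x y\<bar> \<le> dom (x - y)"
    and "0 < r \<Longrightarrow> integrable (lebesgue_on {-r..r}) dom"
proof -
  have "\<exists>\<phi>. (\<forall>x\<in>S. \<forall>y\<in>S. \<bar>\<Phi> x y\<bar> \<le> \<phi> (x - y)) \<and> (\<forall>r>0. integrable (lebesgue_on {-r..r}) \<phi>)"
    using reg unfolding regular_operator_def S_eq Let_def by blast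
  from someI_ex[OF this] show "x \<in> S \<Longrightarrow> y \<in> S \<Longrightarrow> \<bar>\<Phi> x y\<bar> \<le> dom (x - y)"
    and "0 < r \<Longrightarrow> integrable (lebesgue_on {-r..r}) dom"
    unfolding dom_def[symmetric] by blast+
qed

lemma N_meas: "borel_measurable borel \<subseteq> borel_measurable N"
  by (auto intro!: measurable_restrict_space1 measurable_completion)

lemma id_N [measurable]: "(\<lambda>x. x) \<in> borel_measurable N"
  using id_borel_measurable_lebesgue_on[of S] by (simp add: id_def)

lemma ker_borel: "(\<lambda>(x, y). ker x y) \<in> borel_measurable borel"
proof -
  let ?O = "{(x, y). x \<in> S \<and> y \<in> S \<and> x \<noteq> y}"
  have "?O = (S \<times> S) - {z. fst z = snd z}" by auto
  moreover have "S \<times> S \<in> sets borel"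
    using S_compact by (intro borel_closed closed_Times compact_imp_closed)
  moreover have "{z :: real \<times> real. fst z = snd z} \<in> sets borel"
    by (intro borel_closed closed_Collect_eq continuous_intros)
  ultimately have "?O \<in> sets borel" by (simp add: sets.Diff)
  from borel_measurable_continuous_on_indicator[OF this regD(4)]
  have "(\<lambda>z. indicator ?O z *\<^sub>R (case z of (x, y) \<Rightarrow> \<Phi> x y)) \<in> borel_measurable borel" .
  moreover have "(\<lambda>z. indicator ?O z *\<^sub>R (case z of (x, y) \<Rightarrow> \<Phi> x y)) = (\<lambda>(x, y). ker x y)"
    by (auto simp: fun_eq_iff ker_def indicator_def)
  ultimately show ?thesis by simp
qed

lemma ker_N: "(\<lambda>(x, y). ker x y) \<in> borel_measurable (N \<Otimes>\<^sub>M N)"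
proof -
  have "(\<lambda>z. (fst z, snd z)) \<in> N \<Otimes>\<^sub>M N \<rightarrow>\<^sub>M borel \<Otimes>\<^sub>M borel"
    using measurable_compose[OF measurable_fst id_N] measurable_compose[OF measurable_snd id_N]
    by (intro measurable_Pair) auto
  moreover have "(\<lambda>(x, y). ker x y) \<in> borel_measurable (borel \<Otimes>\<^sub>M borel)"
    using ker_borel by (simp only: borel_prod)
  ultimately have "(\<lambda>z. case (fst z, snd z) of (x, y) \<Rightarrow> ker x y) \<in> borel_measurable (N \<Otimes>\<^sub>M N)"
    by (rule measurable_compose)
  then show ?thesis by (simp only: prod.collapse)
qed

definition ker_mass :: "real \<Rightarrow> real" where
  "ker_mass r = (LINT u|lebesgue_on {-r..r}. \<bar>dom u\<bar>)"

text \<open>Stated with a window X for two uses: X = UNIV gives the Schur bounds, and a short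
  interval around 0 gives the smallness of the kernel near the diagonal.\<close>

lemma ker_window:
  fixes X :: "real set"
  assumes r: "0 < r" and X: "X \<in> sets borel"
  shows "x \<in> S \<Longrightarrow> (\<And>y. y \<in> X \<Longrightarrow> y \<in> S \<Longrightarrow> \<bar>x - y\<bar> \<le> r) \<Longrightarrow>
      (\<integral>\<^sup>+y. ennreal (indicator X y * ker x y) \<partial>N) \<le> ennreal (ker_mass r)"
    and "y \<in> S \<Longrightarrow> (\<And>x. x \<in> X \<Longrightarrow> x \<in> S \<Longrightarrow> \<bar>x - y\<bar> \<le> r) \<Longrightarrow>
      (\<integral>\<^sup>+x. ennreal (indicator X x * ker x y) \<partial>N) \<le> ennreal (ker_mass r)"
proof -
  define w where "w u = ennreal (indicator {-r..r} u * \<bar>dom u\<bar>)" for u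
  have dm: "integrable lebesgue (\<lambda>u. indicator {-r..r} u *\<^sub>R \<bar>dom u\<bar>)"
    using integrable_abs[OF dom(2)[OF r]] by (subst (asm) integrable_restrict_space) auto
  have wm: "w \<in> borel_measurable lebesgue"
    unfolding w_def using borel_measurable_integrable[OF dm] by simp
  have "(\<integral>\<^sup>+u. w u \<partial>lebesgue) = ennreal (LINT u|lebesgue. indicator {-r..r} u *\<^sub>R \<bar>dom u\<bar>)"
    unfolding w_def using nn_integral_eq_integral[OF dm] by simp
  also have "(LINT u|lebesgue. indicator {-r..r} u *\<^sub>R \<bar>dom u\<bar>) = ker_mass r"
    unfolding ker_mass_def by (subst integral_restrict_space) auto
  finally have W: "(\<integral>\<^sup>+u. w u \<partial>lebesgue) = ennreal (ker_mass r)" .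
  have S': "S \<inter> space lebesgue \<in> sets lebesgue" by auto
  have pt: "ennreal (X' * ker x y) \<le> w (x - y)"
    if "x \<in> S" "y \<in> S" "X' = 0 \<or> X' = 1 \<and> \<bar>x - y\<bar> \<le> r" for x y and X' :: real
    using that dom(1)[OF that(1,2)] unfolding w_def by (intro ennreal_leI) (auto simp: ker_def indicator_def abs_le_iff)
  show "(\<integral>\<^sup>+y. ennreal (indicator X y * ker x y) \<partial>N) \<le> ennreal (ker_mass r)"
    if x: "x \<in> S" and b: "\<And>y. y \<in> X \<Longrightarrow> y \<in> S \<Longrightarrow> \<bar>x - y\<bar> \<le> r"
  proof -
    have "(\<integral>\<^sup>+y. ennreal (indicator X y * ker x y) \<partial>N) = (\<integral>\<^sup>+y. ennreal (indicator X y * ker x y) * indicator S y \<partial>lebesgue)"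
      by (rule nn_integral_restrict_space[OF S'])
    also have "\<dots> \<le> (\<integral>\<^sup>+y. w (x + (-1) * y) \<partial>lebesgue)"
    proof (rule nn_integral_mono)
      show "ennreal (indicator X y * ker x y) * indicator S y \<le> w (x + (-1) * y)" for y
        using pt[OF x, of y "indicator X y"] b[of y] by (cases "y \<in> S"; cases "y \<in> X") simp_all
    qed
    also have "\<dots> = ennreal (ker_mass r)"
      using nn_integral_real_affine_lebesgue[OF wm, of "-1" x] W by simp
    finally show ?thesis .
  qed
  show "(\<integral>\<^sup>+x. ennreal (indicator X x * ker x y) \<partial>N) \<le> ennreal (ker_mass r)"
    if y: "y \<in> S" and b: "\<And>x. x \<in> X \<Longrightarrow> x \<in> S \<Longrightarrow> \<bar>x - y\<bar> \<le> r"
  proof -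
    have "(\<integral>\<^sup>+x. ennreal (indicator X x * ker x y) \<partial>N) = (\<integral>\<^sup>+x. ennreal (indicator X x * ker x y) * indicator S x \<partial>lebesgue)"
      by (rule nn_integral_restrict_space[OF S'])
    also have "\<dots> \<le> (\<integral>\<^sup>+x. w (- y + 1 * x) \<partial>lebesgue)"
    proof (rule nn_integral_mono)
      show "ennreal (indicator X x * ker x y) * indicator S x \<le> w (- y + 1 * x)" for x
        using pt[OF _ y, of x "indicator X x"] b[of x] by (cases "x \<in> S"; cases "x \<in> X") simp_all
    qed
    also have "\<dots> = ennreal (ker_mass r)"
      using nn_integral_real_affine_lebesgue[OF wm, of 1 "- y"] W by simp
    finally show ?thesis .
  qed
qed

text \<open>Differences of points of S lie in [- 2 R, 2 R], whence the constant.\<close>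

sublocale K: schur_kernel N ker "ker_mass (2 * R)"
proof (intro schur_kernel.intro schur_kernel_axioms.intro)
  show "finite_measure N"
    by (rule finite_measure_lebesgue_on) (use S_compact lmeasurable_compact in blast)
  have d: "\<bar>x - y\<bar> \<le> 2 * R" if "x \<in> S" "y \<in> S" for x y
    using subsetD[OF S_bound that(1)] subsetD[OF S_bound that(2)] by auto
  show "0 \<le> ker x y" for x y using regD(5) by (simp add: ker_def)
  show "(\<integral>\<^sup>+y. ker x y \<partial>N) \<le> ennreal (ker_mass (2 * R))" if "x \<in> space N" for x
    using ker_window(1)[of "2 * R" UNIV x] d that R_pos by simp
  show "(\<integral>\<^sup>+x. ker x y \<partial>N) \<le> ennreal (ker_mass (2 * R))" if "y \<in> space N" for y
    using ker_window(2)[of "2 * R" UNIV y] d that R_pos by simp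
qed (use ker_N in \<open>auto simp: ker_mass_def\<close>)

lemma AE_neq: "AE y in N. y \<noteq> x"
  using AE_lborel_singleton[of x] by (subst AE_lebesgue_on_iff) (auto elim: eventually_mono)

lemma B_eq:
  assumes f: "f \<in> Lp p S" and x: "x \<in> S"
  shows "B f x = kernel_op N ker f x"
proof -
  have xN: "x \<in> space N" using x by simp
  have [measurable]: "ker x \<in> borel_measurable N" using K.k_row_integral[OF xN] by auto
  have [measurable]: "f \<in> borel_measurable N" using f by (simp add: Lp_def)
  show ?thesis
    unfolding regD(3)[OF f x] kernel_op_def
  proof (rule integral_cong_AE)
    show "(\<lambda>y. of_real (\<Phi> x y) * f y) \<in> borel_measurable N" using regD(2)[OF f x] by auto
    show "AE y in N. of_real (\<Phi> x y) * f y = of_real (ker x y) * f y"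
      using AE_neq[of x] AE_space by eventually_elim (use x in \<open>auto simp: ker_def\<close>)
  qed measurable
qed

lemma Phi_measurable:
  assumes x: "x \<in> S"
  shows "\<Phi> x \<in> borel_measurable N" "(\<lambda>y. \<Phi> y x) \<in> borel_measurable N"
proof -
  interpret T: schur_kernel N "\<lambda>x y. ker y x" "ker_mass (2 * R)" by (rule K.transpose)
  have xN: "x \<in> space N" using x by simp
  have [measurable]: "ker x \<in> borel_measurable N" "(\<lambda>y. ker y x) \<in> borel_measurable N"
    using K.k_row_integral[OF xN] T.k_row_integral[OF xN] by auto
  have "(\<lambda>y. if y = x then \<Phi> x x else ker x y) \<in> borel_measurable N" by measurable
  then show "\<Phi> x \<in> borel_measurable N"
    by (rule measurable_cong[THEN iffD1, rotated]) (use x in \<open>auto simp: ker_def\<close>)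
  have "(\<lambda>y. if y = x then \<Phi> x x else ker y x) \<in> borel_measurable N" by measurable
  then show "(\<lambda>y. \<Phi> y x) \<in> borel_measurable N"
    by (rule measurable_cong[THEN iffD1, rotated]) (use x in \<open>auto simp: ker_def\<close>)
qed

lemma adjoint_eq:
  assumes [measurable]: "f \<in> borel_measurable N" and x: "x \<in> S"
  shows "adjoint_kernel_operator S \<Phi> f x = kernel_op N (\<lambda>x y. ker y x) f x"
proof -
  interpret T: schur_kernel N "\<lambda>x y. ker y x" "ker_mass (2 * R)" by (rule K.transpose)
  have xN: "x \<in> space N" using x by simp
  have [measurable]: "(\<lambda>y. ker y x) \<in> borel_measurable N" using T.k_row_integral[OF xN] by auto
  note [measurable] = Phi_measurable(2)[OF x]
  show ?thesis
    unfolding adjoint_kernel_operator_def kernel_op_def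
  proof (rule integral_cong_AE)
    show "AE y in N. cnj (of_real (\<Phi> y x)) * f y = of_real (ker y x) * f y"
      using AE_neq[of x] AE_space by eventually_elim (use x in \<open>auto simp: ker_def\<close>)
  qed (simp_all, measurable)
qed

lemma Phi_Lspace:
  assumes x: "x \<in> S"
  shows "(\<lambda>y. of_real (\<Phi> x y)) \<in> Lspace q N"
proof -
  note [measurable] = Phi_measurable(1)[OF x]
  have "integrable N (\<lambda>y. \<Phi> x y powr q)"
  proof (rule K.N.converse_Holder[OF _ _ pq])
    show "integrable N (\<lambda>y. of_real (\<Phi> x y) * f y)" if "f \<in> Lspace p N" for f :: "real \<Rightarrow> complex"
      using regD(2)[OF _ x] that by (simp add: Lp_eq_Lspace)
  qed (use regD(5)[OF x] in auto)
  then have "integrable N (\<lambda>y. norm (complex_of_real (\<Phi> x y)) powr q)"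
    by (rule Bochner_Integration.integrable_cong[THEN iffD1, OF refl, rotated]) (use regD(5)[OF x] in auto)
  then show ?thesis by (simp add: Lspace_def)
qed

end

section \<open>The quasi-potential inverts the generator\<close>

lemma (in levy_bounded_support) levy_op_lincomb:
  assumes f: "C1_triple S f f1 f2" and g: "C1_triple S g g1 g2"
  shows "AE x in lborel. levy_op A \<gamma> \<nu> (\<lambda>x. c * f x + d * g x) (\<lambda>x. c * f1 x + d * g1 x) (\<lambda>x. c * f2 x + d * g2 x) x
    = c * levy_op A \<gamma> \<nu> f f1 f2 x + d * levy_op A \<gamma> \<nu> g g1 g2 x"
  using increment_integrable_y[OF f] increment_integrable_y[OF g]
proof eventually_elim
  case (elim x)
  have "(LINT y|\<kappa>. increment (\<lambda>x. c * f x + d * g x) (\<lambda>x. c * f1 x + d * g1 x) x y)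
      = (LINT y|\<kappa>. c * increment f f1 x y + d * increment g g1 x y)"
    by (intro Bochner_Integration.integral_cong) (auto simp: increment_def scaleR_conv_of_real algebra_simps)
  also have "\<dots> = c * (LINT y|\<kappa>. increment f f1 x y) + d * (LINT y|\<kappa>. increment g g1 x y)"
    using elim by simp
  finally show ?case by (simp add: levy_op_def scaleR_conv_of_real algebra_simps)
qed

lemma (in levy_bounded_support) levy_op_Lp:
  assumes tr: "C1_triple S f f1 f2" and p: "1 < p" and f2p: "integrable lborel (\<lambda>x. norm (f2 x) powr p)"
  shows "(\<lambda>x. - levy_op A \<gamma> \<nu> f f1 f2 x) \<in> Lp p S"
    and "(LINT x|lebesgue_on S. norm (levy_op A \<gamma> \<nu> f f1 f2 x) powr p)
      \<le> levy_op_const p * (LINT x|lborel. norm (f2 x) powr p)"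
proof -
  note [measurable] = levy_op_borel[OF tr]
  have m: "(\<lambda>x. - levy_op A \<gamma> \<nu> f f1 f2 x) \<in> borel_measurable (lebesgue_on S)"
    by (intro measurable_restrict_space1 measurable_completion) simp
  have "integrable (lebesgue_on S) (\<lambda>x. norm (levy_op A \<gamma> \<nu> f f1 f2 x) powr p)"
    using levy_op_powr(1)[OF tr p f2p] by (subst integrable_lebesgue_on_iff) auto
  then show "(\<lambda>x. - levy_op A \<gamma> \<nu> f f1 f2 x) \<in> Lp p S"
    using m by (simp add: Lp_def)
  show "(LINT x|lebesgue_on S. norm (levy_op A \<gamma> \<nu> f f1 f2 x) powr p)
      \<le> levy_op_const p * (LINT x|lborel. norm (f2 x) powr p)"
    using levy_op_powr(2)[OF tr p f2p] by (subst integral_lebesgue_on_eq) auto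
qed

context regular_kernel
begin

lemma Lp_lincomb:
  assumes "u \<in> Lp r S" "w \<in> Lp r S" "1 < r"
  shows "(\<lambda>x. c * u x + d * w x) \<in> Lp r S"
  using assms Lspace_add[OF Lspace_mult[of u r N c] Lspace_mult[of w r N d]]
  by (simp add: Lp_eq_Lspace)

lemma B_lincomb:
  assumes u: "u \<in> Lp p S" and w: "w \<in> Lp p S" and x: "x \<in> S"
  shows "B (\<lambda>x. c * u x + d * w x) x = c * B u x + d * B w x"
proof -
  have "B (\<lambda>x. c * u x + d * w x) x = (LINT y|N. c * (of_real (\<Phi> x y) * u y) + d * (of_real (\<Phi> x y) * w y))"
    unfolding regD(3)[OF Lp_lincomb[OF u w pq(1)] x] by (simp add: algebra_simps)
  also have "\<dots> = c * B u x + d * B w x"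
    using regD(2)[OF u x] regD(2)[OF w x] by (simp add: regD(3)[OF u x] regD(3)[OF w x])
  finally show ?thesis .
qed

lemma B_cong_AE:
  assumes u: "u \<in> Lp p S" and w: "w \<in> Lp p S" and x: "x \<in> S" and ae: "AE y in N. u y = w y"
  shows "B u x = B w x"
  unfolding regD(3)[OF u x] regD(3)[OF w x]
proof (rule integral_cong_AE)
  show "AE y in N. of_real (\<Phi> x y) * u y = of_real (\<Phi> x y) * w y"
    using ae by eventually_elim simp
qed (use regD(2)[OF u x] regD(2)[OF w x] in \<open>auto intro: borel_measurable_integrable\<close>)

definition L1_const :: "real \<Rightarrow> real" where
  "L1_const r = (2 powr r * measure N S powr (r - 1)) powr (1 / r)"

lemma L1_le_Lp_norm:
  assumes u: "u \<in> Lp r S" and r: "1 < r"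
  shows "(LINT x|N. norm (u x)) \<le> L1_const r * Lp_norm r S u"
proof -
  have [measurable]: "u \<in> borel_measurable N" using u by (simp add: Lp_def)
  have "(LINT x|N. norm (u x)) powr r \<le> 2 powr r * measure N S powr (r - 1) * (LINT x|N. norm (u x) powr r)"
    using u r by (intro K.N.integral_powr_le) (auto simp: Lp_def)
  then have "((LINT x|N. norm (u x)) powr r) powr (1 / r)
      \<le> (2 powr r * measure N S powr (r - 1) * (LINT x|N. norm (u x) powr r)) powr (1 / r)"
    using r by (intro powr_mono2) auto
  also have "((LINT x|N. norm (u x)) powr r) powr (1 / r) = (LINT x|N. norm (u x))"
    using r by (simp add: powr_powr)
  finally show ?thesis by (simp only: L1_const_def Lp_norm_def powr_mult)
qed

end

locale regular_quasi_potential =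
  levy_bounded_support S R A \<gamma> \<nu> + regular_kernel S R p q n a b B \<Phi>
  for S R A \<gamma> \<nu> p q n a b B \<Phi> +
  fixes D :: "(real \<Rightarrow> complex) set"
  assumes qp: "quasi_potential A \<gamma> \<nu> p n a b D B"
    and exponent_nonzero: "levy_exponent A \<gamma> \<nu> (- (1 / R)) \<noteq> 0"
begin

lemma D_Lp: "g \<in> D \<Longrightarrow> g \<in> Lp p S"
  and D_dense: "f \<in> Lp p S \<Longrightarrow> 0 < e \<Longrightarrow> \<exists>g\<in>D. Lp_norm p S (\<lambda>x. f x - g x) < e"
  and D_range: "g \<in> D \<Longrightarrow> B g \<in> C_segments p n a b"
  and D_eq: "g \<in> D \<Longrightarrow> AE x in N. - truncated_generator A \<gamma> \<nu> S (B g) x = g x"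
  using qp unfolding quasi_potential_def dense_subspace_def eq_ae_def S_eq Let_def by blast+

lemmas triple_of_C_segments =
  C_segments_triple[OF pq(1) seg S_eq levy_bounded_support_axioms]

context
  fixes F F1 F2 :: "real \<Rightarrow> complex"
  assumes tr: "C1_triple S F F1 F2" and F2p: "integrable lborel (\<lambda>x. norm (F2 x) powr p)"
begin

text \<open>With g' in \<open>D\<close> close to g, compare B g and F through B g'. The generator of
  H = B g' - F is g - g', so dissipativity makes psi (Re H) small in L^1; and B g - B g' is small in
  L^1 by the Schur test. Hence psi (Re (B g - F)) has integral 0. Only the real part appears because
  psi is a function of a real variable.\<close>

lemma potential_of_levy_op_Re:
  "AE x in N. Re (B (\<lambda>x. - levy_op A \<gamma> \<nu> F F1 F2 x) x - F x) = 0"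
proof -
  define g where "g x = - levy_op A \<gamma> \<nu> F F1 F2 x" for x
  have gL: "g \<in> Lp p S" unfolding g_def by (rule levy_op_Lp(1)[OF tr pq(1) F2p])
  define v where "v x = B g x - F x" for x
  define c0 where "c0 = norm (levy_exponent A \<gamma> \<nu> (- (1 / R))) * cos 1"
  have c0: "0 < c0" using exponent_nonzero pi_gt3 by (simp add: c0_def cos_gt_zero_pi)
  note [measurable] = f_borel[OF tr]
  have iF: "integrable N F"
    using integrable_indicator_scaleR[OF f_integrable[OF tr] S_borel] by (subst integrable_lebesgue_on_iff) auto
  have iv: "integrable N v"
    unfolding v_def using K.N.Lspace_integrable_self[of "B g" p] regD(1)[OF gL] pq(1) iF
    by (simp add: Lp_eq_Lspace)
  have [measurable]: "v \<in> borel_measurable N" using iv by auto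
  have ipsi: "integrable N (\<lambda>x. psi (Re (v x)))"
  proof (rule Bochner_Integration.integrable_bound[OF iv])
    have "psi (Re (v x)) \<le> norm (v x)" for x
      using psi_diff_le[of "Re (v x)" 0] abs_Re_le_cmod[of "v x"] by simp
    then show "AE x in N. norm (psi (Re (v x))) \<le> norm (v x)" by simp
  qed measurable
  let ?c = "(2 / c0 + ker_mass (2 * R)) * L1_const p"
  have small: "(LINT x|N. psi (Re (v x))) \<le> ?c * e" if e: "0 < e" for e
  proof -
    obtain g' where g': "g' \<in> D" "Lp_norm p S (\<lambda>x. g x - g' x) < e"
      using D_dense[OF gL e] by blast
    have g'L: "g' \<in> Lp p S" by (rule D_Lp[OF g'(1)])
    define u where "u x = 1 * g x + (- 1) * g' x" for x
    have uL: "u \<in> Lp p S" unfolding u_def by (rule Lp_lincomb[OF gL g'L pq(1)])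
    have iu: "integrable N u" using K.N.Lspace_integrable_self uL pq(1) by (simp add: Lp_eq_Lspace)
    define \<delta> where "\<delta> = (LINT x|N. norm (u x))"
    have \<delta>: "\<delta> \<le> L1_const p * e"
    proof -
      have "\<delta> \<le> L1_const p * Lp_norm p S u" unfolding \<delta>_def by (rule L1_le_Lp_norm[OF uL pq(1)])
      also have "\<dots> \<le> L1_const p * e"
        using g'(2) by (intro mult_left_mono) (auto simp: u_def[abs_def] L1_const_def)
      finally show ?thesis .
    qed
    obtain h1 h2 where th: "C1_triple S (truncation S (B g')) h1 h2"
      and eqh: "AE x in N. truncated_generator A \<gamma> \<nu> S (B g') x = levy_op A \<gamma> \<nu> (truncation S (B g')) h1 h2 x"
      using triple_of_C_segments[OF D_range[OF g'(1)]] by blast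
    define H where "H = (\<lambda>x. 1 * truncation S (B g') x + (- 1) * F x)"
    define H1 where "H1 = (\<lambda>x. 1 * h1 x + (- 1) * F1 x)"
    define H2 where "H2 = (\<lambda>x. 1 * h2 x + (- 1) * F2 x)"
    have td: "C1_triple S H H1 H2"
      unfolding H_def H1_def H2_def by (rule C1_triple_lincomb[OF th tr])
    have Ld: "AE x in N. norm (levy_op A \<gamma> \<nu> H H1 H2 x) = norm (u x)"
    proof -
      have "AE x in N. levy_op A \<gamma> \<nu> H H1 H2 x
          = 1 * levy_op A \<gamma> \<nu> (truncation S (B g')) h1 h2 x + (- 1) * levy_op A \<gamma> \<nu> F F1 F2 x"
        unfolding AE_lebesgue_on_iff[OF S_borel]
        unfolding H_def H1_def H2_def
        using levy_op_lincomb[OF th tr, of 1 "- 1"] by eventually_elim blast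
      then show ?thesis
        using eqh D_eq[OF g'(1)]
      proof eventually_elim
        case (elim x)
        have "levy_op A \<gamma> \<nu> (truncation S (B g')) h1 h2 x = - g' x"
          using elim(2,3) by (metis minus_minus)
        then have "levy_op A \<gamma> \<nu> H H1 H2 x = u x"
          unfolding elim(1) by (simp add: u_def g_def)
        then show ?case by simp
      qed
    qed
    note [measurable] = f_borel[OF td] levy_op_borel[OF td]
    have "(LINT x|lborel. psi (Re (H x))) = (LINT x|lborel. indicator S x *\<^sub>R psi (Re (H x)))"
      using C1_tripleD(3)[OF td] by (intro Bochner_Integration.integral_cong) (auto simp: indicator_def)
    also have "\<dots> = (LINT x|N. psi (Re (H x)))"
      by (rule integral_lebesgue_on_eq[symmetric]) measurable
    finally have hN: "(LINT x|lborel. psi (Re (H x))) = (LINT x|N. psi (Re (H x)))" .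
    have "c0 * (LINT x|lborel. psi (Re (H x)))
        \<le> 2 * (LINT x|lborel. indicator S x * norm (levy_op A \<gamma> \<nu> H H1 H2 x))"
      unfolding c0_def by (rule dissipative[OF td])
    also have "(LINT x|lborel. indicator S x * norm (levy_op A \<gamma> \<nu> H H1 H2 x))
        = (LINT x|N. norm (levy_op A \<gamma> \<nu> H H1 H2 x))"
      by (subst integral_lebesgue_on_eq) auto
    also have "\<dots> = \<delta>"
      unfolding \<delta>_def
    proof (rule integral_cong_AE[OF _ _ Ld])
      show "(\<lambda>x. norm (levy_op A \<gamma> \<nu> H H1 H2 x)) \<in> borel_measurable N"
        by (intro subsetD[OF N_meas]) measurable
    qed (use iu in measurable)
    finally have hd: "(LINT x|N. psi (Re (H x))) \<le> 2 / c0 * \<delta>"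
      using c0 by (simp only: hN) (simp add: field_simps)
    have ih: "integrable N (\<lambda>x. psi (Re (H x)))"
    proof -
      have i: "integrable N H"
        using integrable_indicator_scaleR[OF f_integrable[OF td] S_borel] f_borel[OF td]
        by (subst integrable_lebesgue_on_iff) auto
      have "psi (Re z) \<le> norm z" for z
        using psi_diff_le[of "Re z" 0] abs_Re_le_cmod[of z] by simp
      then show ?thesis
        using borel_measurable_integrable[OF i]
        by (intro Bochner_Integration.integrable_bound[OF i]) auto
    qed
    have ik: "integrable N (\<lambda>x. norm (kernel_op N ker u x))"
      using K.kernel_op_L1(1)[OF iu] by simp
    have "(LINT x|N. psi (Re (v x))) \<le> (LINT x|N. psi (Re (H x)) + norm (kernel_op N ker u x))"
    proof (rule integral_mono[OF ipsi Bochner_Integration.integrable_add[OF ih ik]])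
      fix x assume "x \<in> space N"
      then have x: "x \<in> S" by simp
      \<comment> \<open>The difference is B (g - g'), and psi is 1-Lipschitz, so passing from v to H
        costs only the L^1 norm of B (g - g').\<close>
      have "v x - H x = kernel_op N ker u x"
        using x B_lincomb[OF gL g'L x, of 1 "- 1"] B_eq[OF uL x]
        by (simp add: v_def truncation_def u_def[abs_def] H_def)
      then have "\<bar>Re (v x) - Re (H x)\<bar> \<le> norm (kernel_op N ker u x)"
        by (metis abs_Re_le_cmod minus_complex.sel(1))
      then show "psi (Re (v x)) \<le> psi (Re (H x)) + norm (kernel_op N ker u x)"
        using psi_diff_le[of "Re (v x)" "Re (H x)"] by linarith
    qed
    also have "\<dots> \<le> 2 / c0 * \<delta> + ker_mass (2 * R) * \<delta>"
      using hd K.kernel_op_L1(2)[OF iu] by (simp add: Bochner_Integration.integral_add[OF ih ik] \<delta>_def)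
    also have "\<dots> = (2 / c0 + ker_mass (2 * R)) * \<delta>" by (simp add: algebra_simps)
    also have "\<dots> \<le> (2 / c0 + ker_mass (2 * R)) * (L1_const p * e)"
      using \<delta> c0 K.C_nonneg by (intro mult_left_mono) auto
    finally show ?thesis by (simp add: mult.assoc)
  qed
  have "(LINT x|N. psi (Re (v x))) \<le> 0"
  proof (rule field_le_epsilon)
    fix e :: real assume e: "0 < e"
    have c: "0 \<le> ?c" using c0 K.C_nonneg by (simp add: L1_const_def)
    have "(LINT x|N. psi (Re (v x))) \<le> ?c * (e / (?c + 1))"
      using c e by (intro small) auto
    also have "\<dots> \<le> e" using c e by (simp add: divide_le_eq mult.commute mult_left_mono)
    finally show "(LINT x|N. psi (Re (v x))) \<le> 0 + e" by simp
  qed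
  then have "(LINT x|N. psi (Re (v x))) = 0" by (simp add: order_antisym)
  then have "AE x in N. psi (Re (v x)) = 0"
    using integral_nonneg_eq_0_iff_AE[OF ipsi] by simp
  then show ?thesis by (simp add: psi_eq_0 v_def g_def[abs_def])
qed

end

lemma potential_of_levy_op:
  assumes tr: "C1_triple S F F1 F2" and F2p: "integrable lborel (\<lambda>x. norm (F2 x) powr p)"
  shows "AE x in N. B (\<lambda>x. - levy_op A \<gamma> \<nu> F F1 F2 x) x = F x"
proof -
  define g where "g x = - levy_op A \<gamma> \<nu> F F1 F2 x" for x
  have gL: "g \<in> Lp p S" unfolding g_def by (rule levy_op_Lp(1)[OF tr pq(1) F2p])
  \<comment> \<open>The real part of - i w is the imaginary part of w, so the preceding lemma for -
    i F gives the other half. The zero summand only matches the form of the linearity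
    lemmas.\<close>
  let ?F = "\<lambda>x. - \<i> * F x + 0 * F x"
  let ?F1 = "\<lambda>x. - \<i> * F1 x + 0 * F1 x"
  let ?F2 = "\<lambda>x. - \<i> * F2 x + 0 * F2 x"
  have tr': "C1_triple S ?F ?F1 ?F2" by (rule C1_triple_lincomb[OF tr tr])
  have F2p': "integrable lborel (\<lambda>x. norm (?F2 x) powr p)" using F2p by (simp add: norm_mult)
  define g' where "g' x = - levy_op A \<gamma> \<nu> ?F ?F1 ?F2 x" for x
  have g'L: "g' \<in> Lp p S" unfolding g'_def by (rule levy_op_Lp(1)[OF tr' pq(1) F2p'])
  have gg: "AE x in N. g' x = - \<i> * g x + 0 * g x"
    unfolding AE_lebesgue_on_iff[OF S_borel] g'_def g_def
    using levy_op_lincomb[OF tr tr, of "- \<i>" 0] by eventually_elim (auto simp: algebra_simps)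
  have Bg': "B g' x = - \<i> * B g x" if x: "x \<in> S" for x
  proof -
    have L: "(\<lambda>x. - \<i> * g x + 0 * g x) \<in> Lp p S" by (rule Lp_lincomb[OF gL gL pq(1)])
    have "B g' x = B (\<lambda>x. - \<i> * g x + 0 * g x) x"
      by (rule B_cong_AE[OF g'L L x gg])
    then show ?thesis using B_lincomb[OF gL gL x, of "- \<i>" 0] by simp
  qed
  show ?thesis
    using potential_of_levy_op_Re[OF tr F2p, folded g_def] potential_of_levy_op_Re[OF tr' F2p', folded g'_def] AE_space
  proof eventually_elim
    case (elim x)
    then have "x \<in> S" by simp
    then show ?case
      using elim(1,2) Bg'[of x] by (simp add: complex_eq_iff g_def[abs_def])
  qed
qed

end

section \<open>Estimates near the origin\<close>

text \<open>Here f x is the integral of (x - t) h t over t <= x. The remainder f y - f x - (y - x)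
  f1 x is the integral of (y - t) h t between x and y, at most |y - x| times the increment of the
  continuous function \<open>G\<close>.\<close>

lemma second_antiderivative:
  fixes h :: "real \<Rightarrow> complex"
  assumes h: "integrable lborel h" and th: "integrable lborel (\<lambda>t. t *\<^sub>R h t)"
    and f1: "\<And>x. f1 x = (LINT t|lborel. indicator {..x} t *\<^sub>R h t)"
    and f: "\<And>x. f x = x *\<^sub>R f1 x - (LINT t|lborel. indicator {..x} t *\<^sub>R (t *\<^sub>R h t))"
  shows "(f has_vector_derivative f1 x) (at x)"
proof -
  define G where "G y = (LINT t|lborel. indicator {..y} t *\<^sub>R norm (h t))" for y
  have Gc: "isCont G x"
    using indefinite_integral_continuous_on[OF integrable_norm[OF h], of UNIV]
    by (simp add: G_def[abs_def] continuous_on_eq_continuous_at)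
  note ih = integrable_indicator_scaleR[OF h] and ith = integrable_indicator_scaleR[OF th]
    and inh = integrable_indicator_scaleR[OF integrable_norm[OF h]]
  have bound: "norm (f y - f x - (y - x) *\<^sub>R f1 x) \<le> norm (G y - G x) * norm (y - x)" for y
  proof -
    let ?s = "\<lambda>t. indicator {..y} t - indicator {..x} t :: real"
    have i1: "integrable lborel (\<lambda>t. y *\<^sub>R (indicator {..y} t *\<^sub>R h t - indicator {..x} t *\<^sub>R h t))"
      using ih by auto
    have i2: "integrable lborel (\<lambda>t. indicator {..y} t *\<^sub>R (t *\<^sub>R h t) - indicator {..x} t *\<^sub>R (t *\<^sub>R h t))"
      using ith by auto
    have "f y - f x - (y - x) *\<^sub>R f1 x = y *\<^sub>R (f1 y - f1 x)
        - ((LINT t|lborel. indicator {..y} t *\<^sub>R (t *\<^sub>R h t)) - (LINT t|lborel. indicator {..x} t *\<^sub>R (t *\<^sub>R h t)))"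
      by (simp add: f algebra_simps)
    also have "y *\<^sub>R (f1 y - f1 x) = (LINT t|lborel. y *\<^sub>R (indicator {..y} t *\<^sub>R h t - indicator {..x} t *\<^sub>R h t))"
      unfolding f1 integral_scaleR_right
      by (subst Bochner_Integration.integral_diff) (auto intro: ih)
    also have "(LINT t|lborel. indicator {..y} t *\<^sub>R (t *\<^sub>R h t)) - (LINT t|lborel. indicator {..x} t *\<^sub>R (t *\<^sub>R h t))
        = (LINT t|lborel. indicator {..y} t *\<^sub>R (t *\<^sub>R h t) - indicator {..x} t *\<^sub>R (t *\<^sub>R h t))"
      by (intro Bochner_Integration.integral_diff[symmetric] ith) simp_all
    also have "(LINT t|lborel. y *\<^sub>R (indicator {..y} t *\<^sub>R h t - indicator {..x} t *\<^sub>R h t)) - \<dots>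
        = (LINT t|lborel. y *\<^sub>R (indicator {..y} t *\<^sub>R h t - indicator {..x} t *\<^sub>R h t)
            - (indicator {..y} t *\<^sub>R (t *\<^sub>R h t) - indicator {..x} t *\<^sub>R (t *\<^sub>R h t)))"
      by (rule Bochner_Integration.integral_diff[OF i1 i2, symmetric])
    also have "\<dots> = (LINT t|lborel. (?s t * (y - t)) *\<^sub>R h t)"
      by (intro Bochner_Integration.integral_cong refl) (auto simp: indicator_def scaleR_diff_left)
    also have "norm \<dots> \<le> (LINT t|lborel. norm ((?s t * (y - t)) *\<^sub>R h t))"
      by (rule integral_norm_bound)
    also have "\<dots> \<le> (LINT t|lborel. \<bar>y - x\<bar> * (\<bar>?s t\<bar> * norm (h t)))"
    proof (rule integral_mono')
      have "integrable lborel (\<lambda>t. norm (?s t *\<^sub>R h t))"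
        unfolding scaleR_diff_left using ih by (intro integrable_norm Bochner_Integration.integrable_diff) auto
      then show "integrable lborel (\<lambda>t. \<bar>y - x\<bar> * (\<bar>?s t\<bar> * norm (h t)))" by simp
      show "norm ((?s t * (y - t)) *\<^sub>R h t) \<le> \<bar>y - x\<bar> * (\<bar>?s t\<bar> * norm (h t))" for t
        by (auto simp: indicator_def mult_right_mono)
    qed simp
    also have "\<dots> = \<bar>y - x\<bar> * (LINT t|lborel. \<bar>?s t\<bar> * norm (h t))" by simp
    also have "(LINT t|lborel. \<bar>?s t\<bar> * norm (h t)) = norm (G y - G x)"
    proof -
      have "(LINT t|lborel. ?s t * norm (h t)) = G y - G x"
      proof -
        have "(LINT t|lborel. ?s t * norm (h t))
            = (LINT t|lborel. indicator {..y} t *\<^sub>R norm (h t) - indicator {..x} t *\<^sub>R norm (h t))"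
          by (simp add: left_diff_distrib)
        also have "\<dots> = G y - G x"
          unfolding G_def by (intro Bochner_Integration.integral_diff inh) simp_all
        finally show ?thesis .
      qed
      moreover have "(LINT t|lborel. \<bar>?s t\<bar> * norm (h t)) = \<bar>LINT t|lborel. ?s t * norm (h t)\<bar>"
      proof (cases "x \<le> y")
        case True
        then have "\<bar>?s t\<bar> = ?s t" for t by (auto simp: indicator_def)
        then show ?thesis using True by (simp only:) (auto intro!: abs_of_nonneg[symmetric] integral_nonneg simp: indicator_def)
      next
        case False
        then have *: "\<bar>?s t\<bar> * norm (h t) = - (?s t * norm (h t))" for t by (auto simp: indicator_def)
        have "0 \<le> (LINT t|lborel. \<bar>?s t\<bar> * norm (h t))" by simp
        then show ?thesis unfolding * by simp
      qed
      ultimately show ?thesis by simp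
    qed
    finally show ?thesis by (simp add: mult.commute)
  qed
  show ?thesis
    unfolding has_vector_derivative_def has_derivative_within_alt2
  proof (intro conjI allI impI)
    show "bounded_linear (\<lambda>y. y *\<^sub>R f1 x)" by (rule bounded_linear_scaleR_left)
    fix e :: real assume "0 < e"
    then have "\<forall>\<^sub>F y in at x. dist (G y) (G x) < e"
      using Gc by (simp add: isCont_def tendsto_iff)
    then show "\<forall>\<^sub>F y in at x. norm (f y - f x - (y - x) *\<^sub>R f1 x) \<le> e * norm (y - x)"
    proof eventually_elim
      case (elim y)
      have "norm (G y - G x) * norm (y - x) \<le> e * norm (y - x)"
        using elim by (intro mult_right_mono) (auto simp: dist_norm)
      then show ?case using bound[of y] by linarith
    qed
  qed
qed

text \<open>Jumps with |y| <= d see \<open>f2\<close> only on |x + u| <= 2 d, where it is bounded.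
  For d < |y| <= 1 the weight is at most 2 / d^2, and for |y| > 1 at most 2, so there boundedness of
  f and \<open>f1\<close> is enough.\<close>

lemma (in levy_bounded_support) levy_op_bounded_near_0:
  assumes tr: "C1_triple S f f1 f2" and d: "0 < d" "d \<le> 1"
    and K: "\<And>x. \<bar>x\<bar> \<le> 2 * d \<Longrightarrow> norm (f2 x) \<le> K"
  shows "\<exists>M. \<forall>x. \<bar>x\<bar> \<le> d \<longrightarrow> norm (levy_op A \<gamma> \<nu> f f1 f2 x) \<le> M"
proof -
  define N1 where "N1 = (LINT t|lborel. norm (f2 t))"
  define F0 where "F0 = 2 * (R + 1) * N1"
  have N1: "0 \<le> N1" by (simp add: N1_def)
  have F0: "0 \<le> F0" using N1 R_pos by (simp add: F0_def)
  have K0: "0 \<le> K" using K[of 0] d norm_ge_zero[of "f2 0"] by linarith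
  define M where "M = 4 * K + 2 / d\<^sup>2 * (2 * F0 + N1) + 4 * F0"
  have M0: "0 \<le> M" using K0 N1 F0 by (simp add: M_def)
  have inc: "norm (increment f f1 x y) \<le> M" if x: "\<bar>x\<bar> \<le> d" for x y
  proof -
    consider "y = 0" | "y \<noteq> 0" "\<bar>y\<bar> \<le> d" | "d < \<bar>y\<bar>" "\<bar>y\<bar> \<le> 1" | "1 < \<bar>y\<bar>" by linarith
    then show ?thesis
    proof cases
      case 1
      then show ?thesis using M0 by (simp add: increment_def jump_weight_def)
    next
      case 2
      have "(LINT u|lborel. indicator {-\<bar>y\<bar>..\<bar>y\<bar>} u * norm (f2 (x + u))) \<le> (LINT u|lborel. indicator {-\<bar>y\<bar>..\<bar>y\<bar>} u * K)"
      proof (rule integral_mono')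
        show "integrable lborel (\<lambda>u. indicator {-\<bar>y\<bar>..\<bar>y\<bar>} u * K)"
          by (intro integrable_mult_left integrable_real_indicator) (auto simp: emeasure_lborel_Icc_eq)
        show "indicator {-\<bar>y\<bar>..\<bar>y\<bar>} u * norm (f2 (x + u)) \<le> indicator {-\<bar>y\<bar>..\<bar>y\<bar>} u * K" for u
        proof (cases "u \<in> {-\<bar>y\<bar>..\<bar>y\<bar>}")
          case True
          then have "\<bar>x + u\<bar> \<le> 2 * d" using x 2 by auto
          then show ?thesis using K True by simp
        qed simp
      qed (use K0 in simp)
      also have "\<dots> = 2 * \<bar>y\<bar> * K" by simp
      finally have "2 / \<bar>y\<bar> * (LINT u|lborel. indicator {-\<bar>y\<bar>..\<bar>y\<bar>} u * norm (f2 (x + u))) \<le> 2 / \<bar>y\<bar> * (2 * \<bar>y\<bar> * K)"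
        by (intro mult_left_mono) auto
      also have "\<dots> = 4 * K" using 2 by simp
      also have "\<dots> \<le> M" using N1 F0 by (simp add: M_def)
      finally show ?thesis using increment_small[OF tr, of y x] 2 d by linarith
    next
      case 3
      have jw: "jump_weight y \<le> 2 / d\<^sup>2"
      proof -
        have y0: "y \<noteq> 0" using 3 d by auto
        have "jump_weight y \<le> 2 / \<bar>y\<bar> / \<bar>y\<bar>"
          using jump_weight_bounds(2)[OF 3(2) y0] y0 by (subst pos_le_divide_eq) auto
        also have "\<dots> = 2 / \<bar>y\<bar>\<^sup>2" by (simp add: power2_eq_square)
        also have "\<dots> \<le> 2 / d\<^sup>2" using 3 d by (intro divide_left_mono power_mono) auto
        finally show ?thesis .
      qed
      have "norm (f (x + y) - f x - (y * indicator {-1..1} y) *\<^sub>R f1 x) \<le> (F0 + F0) + 1 * N1"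
      proof (intro order_trans[OF norm_triangle_ineq4] add_mono)
        show "norm (f (x + y)) \<le> F0" "norm (f x) \<le> F0" using f_bound[OF tr] by (auto simp: F0_def N1_def)
        show "norm ((y * indicator {-1..1} y) *\<^sub>R f1 x) \<le> 1 * N1"
          unfolding norm_scaleR using f1_bound[OF tr, of x] 3
          by (intro mult_mono) (auto simp: N1_def indicator_def)
      qed
      then have "norm (increment f f1 x y) \<le> 2 / d\<^sup>2 * ((F0 + F0) + 1 * N1)"
        unfolding increment_def norm_scaleR using jw jump_weight_bounds(1)[of y]
        by (intro mult_mono) auto
      also have "\<dots> \<le> M" using K0 F0 by (simp add: M_def)
      finally show ?thesis .
    next
      case 4
      have "norm (increment f f1 x y) \<le> 2 * (F0 + F0)"
        using f_bound[OF tr, of x] f_bound[OF tr, of "x + y"]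
        by (intro order_trans[OF increment_large[OF tr 4]] mult_left_mono add_mono) (auto simp: F0_def N1_def)
      also have "\<dots> \<le> M" using K0 N1 F0 by (simp add: M_def)
      finally show ?thesis .
    qed
  qed
  show ?thesis
  proof (intro exI allI impI)
    fix x assume x: "\<bar>x\<bar> \<le> d"
    have "norm (LINT y|\<kappa>. increment f f1 x y) \<le> (LINT y|\<kappa>. norm (increment f f1 x y))"
      by (rule integral_norm_bound)
    also have "\<dots> \<le> (LINT y|\<kappa>. M)" using inc[OF x] M0 by (intro integral_mono') auto
    also have "\<dots> = measure \<kappa> UNIV * M" by simp
    finally have "norm (LINT y|\<kappa>. increment f f1 x y) \<le> measure \<kappa> UNIV * M" .
    moreover have "norm ((A / 2) *\<^sub>R f2 x) \<le> A / 2 * K"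
      using A_nonneg K[of x] x d by (simp add: mult_left_mono)
    moreover have "norm (\<gamma> *\<^sub>R f1 x) \<le> \<bar>\<gamma>\<bar> * N1"
      using f1_bound[OF tr, of x] by (simp add: N1_def mult_left_mono)
    ultimately show "norm (levy_op A \<gamma> \<nu> f f1 f2 x) \<le> A / 2 * K + \<bar>\<gamma>\<bar> * N1 + measure \<kappa> UNIV * M"
      unfolding levy_op_def by (intro norm_triangle_mono)
  qed
qed

context regular_kernel
begin

text \<open>Absolute continuity of the integral of the dominating function: the kernel has uniformly
  small mass near the diagonal.\<close>

lemma ker_mass_tendsto_0: "(\<lambda>m. ker_mass (1 / real (Suc m))) \<longlonglongrightarrow> 0"
proof -
  have eq: "ker_mass r = (LINT u|lebesgue. indicator {-r..r} u *\<^sub>R \<bar>dom u\<bar>)" for r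
    unfolding ker_mass_def by (subst integral_restrict_space) auto
  have i: "integrable lebesgue (\<lambda>u. indicator {-r..r} u *\<^sub>R \<bar>dom u\<bar>)" if "0 < r" for r
    using integrable_abs[OF dom(2)[OF that]] by (subst (asm) integrable_restrict_space) auto
  have "(\<lambda>m. LINT u|lebesgue. indicator {-(1 / real (Suc m))..1 / real (Suc m)} u *\<^sub>R \<bar>dom u\<bar>) \<longlonglongrightarrow> (LINT u::real|lebesgue. 0)"
  proof (rule integral_dominated_convergence)
    show "integrable lebesgue (\<lambda>u. indicator {-1..1} u *\<^sub>R \<bar>dom u\<bar>)" using i[of 1] by simp
    show "(\<lambda>u. indicator {-(1 / real (Suc m))..1 / real (Suc m)} u *\<^sub>R \<bar>dom u\<bar>) \<in> borel_measurable lebesgue" for m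
      by (rule borel_measurable_integrable[OF i]) simp
    have "AE u in lebesgue. u \<noteq> (0::real)"
      using AE_lborel_singleton[of 0] by (rule AE_completion)
    then show "AE u in lebesgue. (\<lambda>m. indicator {-(1 / real (Suc m))..1 / real (Suc m)} u *\<^sub>R \<bar>dom u\<bar>) \<longlonglongrightarrow> 0"
    proof eventually_elim
      case (elim u)
      have "\<forall>\<^sub>F m in sequentially. 1 / real (Suc m) < \<bar>u\<bar>"
        using order_tendstoD(2)[OF LIMSEQ_Suc[OF lim_1_over_n], of "\<bar>u\<bar>"] elim by simp
      then show ?case
        by (intro tendsto_eventually) (auto elim!: eventually_mono simp: indicator_def)
    qed
    show "AE u in lebesgue. norm (indicator {-(1 / real (Suc m))..1 / real (Suc m)} u *\<^sub>R \<bar>dom u\<bar>) \<le> indicator {-1..1} u *\<^sub>R \<bar>dom u\<bar>" for m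
    proof (rule AE_I2)
      fix u :: real
      define c where "c = 1 / real (Suc m)"
      have "c \<le> 1" by (simp add: c_def)
      then show "norm (indicator {-(1 / real (Suc m))..1 / real (Suc m)} u *\<^sub>R \<bar>dom u\<bar>) \<le> indicator {-1..1} u *\<^sub>R \<bar>dom u\<bar>"
        unfolding c_def[symmetric] by (auto simp: indicator_def)
    qed
  qed simp
  then show ?thesis by (simp only: eq Bochner_Integration.integral_zero)
qed

text \<open>Split the integral at |y| = h. The near part is at most M times
  \<open>ker_mass (2 * h)\<close>, uniformly for |x| <= h; the far part converges by dominated
  convergence, because \<Phi> is continuous away from the diagonal.\<close>

lemma kernel_op_continuous_at_0:
  assumes g: "g \<in> Lp p S" and d: "0 < d" and M: "\<And>x. \<bar>x\<bar> \<le> d \<Longrightarrow> norm (g x) \<le> M"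
    and zero: "0 \<in> S" and xs: "\<And>j. xs j \<in> S" "xs \<longlonglongrightarrow> 0"
  shows "(\<lambda>j. kernel_op N ker g (xs j)) \<longlonglongrightarrow> kernel_op N ker g 0"
proof -
  have M0: "0 \<le> M" using M[of 0] d norm_ge_zero[of "g 0"] by linarith
  have gm: "g \<in> borel_measurable N" using g by (simp add: Lp_def)
  have ig: "integrable N g" using K.N.Lspace_integrable_self[of g p] g pq(1) by (simp add: Lp_eq_Lspace)
  have kx: "integrable N (ker x)" if "x \<in> S" for x
    using K.k_row_integral(1)[of x] that by simp
  have kgm: "(\<lambda>y. of_real (ker x y) * g y) \<in> borel_measurable N" if "x \<in> S" for x
    using gm borel_measurable_integrable[OF kx[OF that]] by measurable
  have ikg: "integrable N (\<lambda>y. of_real (ker x y) * g y)" if x: "x \<in> S" for x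
  proof (rule Bochner_Integration.integrable_bound[OF regD(2)[OF g x] kgm[OF x]])
    show "AE y in N. norm (of_real (ker x y) * g y) \<le> norm (of_real (\<Phi> x y) * g y)"
      by (auto simp: ker_def)
  qed
  have XN: "X \<inter> space N \<in> sets N" if "X \<in> sets borel" for X
    using measurable_sets[OF id_N that] by simp
  have ind: "integrable N (\<lambda>y. indicator X y *\<^sub>R h y)" if "integrable N h" "X \<in> sets borel"
    for X and h :: "real \<Rightarrow> 'b::{banach, second_countable_topology}"
  proof -
    have "integrable N (\<lambda>y. indicator (X \<inter> space N) y *\<^sub>R h y)"
      by (rule integrable_mult_indicator[OF XN[OF that(2)] that(1)])
    then show ?thesis
      by (rule Bochner_Integration.integrable_cong[THEN iffD1, OF refl, rotated]) (auto simp: indicator_def)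
  qed
  have near: "norm (LINT y|N. indicator {-h..h} y *\<^sub>R (of_real (ker x y) * g y)) \<le> M * ker_mass (2 * h)"
    if x: "x \<in> S" "\<bar>x\<bar> \<le> h" and h: "0 < h" "h \<le> d" for x h
  proof -
    have ik: "integrable N (\<lambda>y. indicator {-h..h} y *\<^sub>R ker x y)" by (rule ind[OF kx[OF x(1)]]) simp
    have "norm (LINT y|N. indicator {-h..h} y *\<^sub>R (of_real (ker x y) * g y))
        \<le> (LINT y|N. norm (indicator {-h..h} y *\<^sub>R (of_real (ker x y) * g y)))"
      by (rule integral_norm_bound)
    also have "\<dots> \<le> (LINT y|N. M * (indicator {-h..h} y *\<^sub>R ker x y))"
    proof (rule integral_mono')
      show "integrable N (\<lambda>y. M * (indicator {-h..h} y *\<^sub>R ker x y))"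
        by (rule integrable_mult_right[OF ik])
      show "norm (indicator {-h..h} y *\<^sub>R (of_real (ker x y) * g y)) \<le> M * (indicator {-h..h} y *\<^sub>R ker x y)" for y
      proof (cases "y \<in> {-h..h}")
        case True
        then have "norm (g y) \<le> M" using h by (intro M) auto
        then have "ker x y * norm (g y) \<le> ker x y * M" by (intro mult_left_mono K.k_nonneg)
        then show ?thesis using True by (simp add: norm_mult K.k_nonneg mult.commute)
      qed simp
    qed (use M0 K.k_nonneg in simp)
    also have "\<dots> = M * (LINT y|N. indicator {-h..h} y *\<^sub>R ker x y)" by (rule integral_mult_right_zero)
    also have "\<dots> \<le> M * ker_mass (2 * h)"
    proof (rule mult_left_mono[OF _ M0])
      have "ennreal (LINT y|N. indicator {-h..h} y *\<^sub>R ker x y) = (\<integral>\<^sup>+y. ennreal (indicator {-h..h} y * ker x y) \<partial>N)"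
        using nn_integral_eq_integral[OF ik] K.k_nonneg by simp
      also have "\<dots> \<le> ennreal (ker_mass (2 * h))"
        using h x by (intro ker_window(1)) auto
      finally show "(LINT y|N. indicator {-h..h} y *\<^sub>R ker x y) \<le> ker_mass (2 * h)"
        by (subst (asm) ennreal_le_iff) (auto simp: ker_mass_def)
    qed
    finally show ?thesis .
  qed
  have far: "(\<lambda>j. LINT y|N. indicator (- {-h..h}) y *\<^sub>R (of_real (ker (xs j) y) * g y))
      \<longlonglongrightarrow> (LINT y|N. indicator (- {-h..h}) y *\<^sub>R (of_real (ker 0 y) * g y))" if h: "0 < h" for h
  proof -
    \<comment> \<open>Pairs with |x| <= h / 2 and |y| >= h form a compact set off the diagonal, on
      which \<Phi> is therefore bounded.\<close>
    define Q where "Q = (S \<inter> cball 0 (h / 2)) \<times> (S \<inter> - ball 0 h)"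
    have Qsub: "Q \<subseteq> {(x, y). x \<in> S \<and> y \<in> S \<and> x \<noteq> y}"
      using h by (auto simp: Q_def)
    have "compact Q"
      unfolding Q_def using S_compact
      by (intro compact_Times compact_Int_closed) auto
    then have "compact ((\<lambda>(x, y). \<Phi> x y) ` Q)"
      by (intro compact_continuous_image continuous_on_subset[OF regD(4) Qsub])
    then obtain L where L: "\<And>z. z \<in> Q \<Longrightarrow> norm (case z of (x, y) \<Rightarrow> \<Phi> x y) \<le> L"
      by (meson bounded_iff compact_imp_bounded imageI)
    obtain J where J: "\<And>j. J \<le> j \<Longrightarrow> \<bar>xs j\<bar> \<le> h / 2"
    proof -
      have "\<forall>\<^sub>F j in sequentially. dist (xs j) 0 < h / 2" using xs(2) h by (intro tendstoD) auto
      then show ?thesis using that by (fastforce simp: eventually_sequentially dist_real_def)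
    qed
    have "(\<lambda>j. LINT y|N. indicator (- {-h..h}) y *\<^sub>R (of_real (ker (xs (j + J)) y) * g y))
      \<longlonglongrightarrow> (LINT y|N. indicator (- {-h..h}) y *\<^sub>R (of_real (ker 0 y) * g y))"
    proof (rule integral_dominated_convergence[where w = "\<lambda>y. norm (of_real L * g y)"])
      show "integrable N (\<lambda>y. norm (of_real L * g y))" using ig by simp
      show "(\<lambda>y. indicator (- {-h..h}) y *\<^sub>R (of_real (ker (xs (j + J)) y) * g y)) \<in> borel_measurable N" for j
        by (rule borel_measurable_integrable[OF ind[OF ikg[OF xs(1)]]]) simp
      show "(\<lambda>y. indicator (- {-h..h}) y *\<^sub>R (of_real (ker 0 y) * g y)) \<in> borel_measurable N"
        by (rule borel_measurable_integrable[OF ind[OF ikg[OF zero]]]) simp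
      show "AE y in N. norm (indicator (- {-h..h}) y *\<^sub>R (of_real (ker (xs (j + J)) y) * g y)) \<le> norm (of_real L * g y)" for j
        using AE_space
      proof eventually_elim
        case (elim y)
        show ?case
        proof (cases "y \<in> {-h..h}")
          case False
          then have "(xs (j + J), y) \<in> Q"
            using J[of "j + J"] xs(1) elim by (auto simp: Q_def dist_real_def)
          then have "\<bar>ker (xs (j + J)) y\<bar> \<le> \<bar>L\<bar>"
            using L[of "(xs (j + J), y)"] by (auto simp: ker_def)
          then show ?thesis using False by (simp add: norm_mult mult_right_mono)
        qed simp
      qed
      show "AE y in N. (\<lambda>j. indicator (- {-h..h}) y *\<^sub>R (of_real (ker (xs (j + J)) y) * g y))
          \<longlonglongrightarrow> indicator (- {-h..h}) y *\<^sub>R (of_real (ker 0 y) * g y)"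
        using AE_space
      proof eventually_elim
        case (elim y)
        show ?case
        proof (cases "y \<in> {-h..h}")
          case False
          then have yQ: "(xs (j + J), y) \<in> Q" "(0, y) \<in> Q" for j
            using J[of "j + J"] xs(1) elim zero h by (auto simp: Q_def dist_real_def)
          have "(\<lambda>j. (xs (j + J), y)) \<longlonglongrightarrow> (0, y)"
            using LIMSEQ_ignore_initial_segment[OF xs(2), of J] by (intro tendsto_Pair) auto
          then have "(\<lambda>j. (\<lambda>(x, y). \<Phi> x y) (xs (j + J), y)) \<longlonglongrightarrow> (\<lambda>(x, y). \<Phi> x y) (0, y)"
          proof (rule continuous_on_tendsto_compose[OF regD(4)])
            show "\<forall>\<^sub>F j in sequentially. (xs (j + J), y) \<in> {(x, y). x \<in> S \<and> y \<in> S \<and> x \<noteq> y}"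
              using subsetD[OF Qsub yQ(1)] by (intro always_eventually allI)
          qed (rule subsetD[OF Qsub yQ(2)])
          moreover have "ker (xs (j + J)) y = \<Phi> (xs (j + J)) y" "ker 0 y = \<Phi> 0 y" for j
            using subsetD[OF Qsub yQ(1)] subsetD[OF Qsub yQ(2)] by (auto simp: ker_def)
          ultimately have "(\<lambda>j. ker (xs (j + J)) y) \<longlonglongrightarrow> ker 0 y" by simp
          then show ?thesis by (intro tendsto_intros)
        qed simp
      qed
    qed
    then show ?thesis by (rule LIMSEQ_offset)
  qed
  show ?thesis
  proof (rule tendstoI)
    fix e :: real assume e: "0 < e"
    have "(\<lambda>m. M * ker_mass (1 / real (Suc m))) \<longlonglongrightarrow> M * 0"
      by (intro tendsto_mult_left ker_mass_tendsto_0)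
    then have "\<forall>\<^sub>F m in sequentially. M * ker_mass (1 / real (Suc m)) < e / 4"
      using e by (intro order_tendstoD(2)) auto
    moreover have "\<forall>\<^sub>F m in sequentially. 1 / real (Suc m) < d"
      using order_tendstoD(2)[OF LIMSEQ_Suc[OF lim_1_over_n] d] by simp
    ultimately have "\<forall>\<^sub>F m in sequentially. M * ker_mass (1 / real (Suc m)) < e / 4 \<and> 1 / real (Suc m) < d"
      by (rule eventually_conj)
    then obtain m where m: "M * ker_mass (1 / real (Suc m)) < e / 4" "1 / real (Suc m) < d"
      by (auto simp: eventually_sequentially)
    define w where "w = 1 / real (Suc m)"
    have "0 < w" by (simp add: w_def)
    \<comment> \<open>Two points of [- h, h] differ by at most 2 h, so half of w brings the window
      within reach of the bound for w.\<close>
    define h where "h = w / 2"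
    have h: "0 < h" "h \<le> d" "2 * h = 1 / real (Suc m)"
      using m(2) \<open>0 < w\<close> unfolding w_def[symmetric] by (simp_all add: h_def)
    define I1 where "I1 x = (LINT y|N. indicator {-h..h} y *\<^sub>R (of_real (ker x y) * g y))" for x
    define I2 where "I2 x = (LINT y|N. indicator (- {-h..h}) y *\<^sub>R (of_real (ker x y) * g y))" for x
    have split: "kernel_op N ker g x = I1 x + I2 x" if x: "x \<in> S" for x
    proof -
      have "I1 x + I2 x = (LINT y|N. indicator {-h..h} y *\<^sub>R (of_real (ker x y) * g y)
          + indicator (- {-h..h}) y *\<^sub>R (of_real (ker x y) * g y))"
        unfolding I1_def I2_def
        by (intro Bochner_Integration.integral_add[symmetric] ind ikg[OF x]) auto
      also have "\<dots> = kernel_op N ker g x"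
        unfolding kernel_op_def by (intro Bochner_Integration.integral_cong refl) (auto simp: indicator_def)
      finally show ?thesis ..
    qed
    have I1: "norm (I1 x) < e / 4" if "x \<in> S" "\<bar>x\<bar> \<le> h" for x
      using near[OF that h(1,2)] m(1) by (simp add: I1_def h(3))
    have "\<forall>\<^sub>F j in sequentially. dist (I2 (xs j)) (I2 0) < e / 4"
      unfolding I2_def using far[OF h(1)] e by (intro tendstoD) auto
    moreover have "\<forall>\<^sub>F j in sequentially. dist (xs j) 0 < h" using xs(2) h by (intro tendstoD) auto
    ultimately show "\<forall>\<^sub>F j in sequentially. dist (kernel_op N ker g (xs j)) (kernel_op N ker g 0) < e"
    proof eventually_elim
      case (elim j)
      have "kernel_op N ker g (xs j) - kernel_op N ker g 0 = I1 (xs j) - I1 0 + (I2 (xs j) - I2 0)"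
        using split[OF xs(1)] split[OF zero] by simp
      moreover have "norm (I1 (xs j) - I1 0 + (I2 (xs j) - I2 0)) \<le> norm (I1 (xs j)) + norm (I1 0) + norm (I2 (xs j) - I2 0)"
        by (meson add_mono norm_triangle_ineq norm_triangle_ineq4 order_refl order_trans)
      moreover have "norm (I1 (xs j)) < e / 4" "norm (I1 0) < e / 4"
        using I1[of "xs j"] I1[of 0] xs(1) zero h(1) elim(2) by (auto simp: dist_real_def)
      ultimately show ?case using elim(1) e by (simp add: dist_norm)
    qed
  qed
qed

end

text \<open>On the interval, \<open>e2\<close> is \<open>f2\<close> minus an affine function with
  the same zeroth and first moments. Vanishing moments let e be supported in the interval, while f2
  - e2 is affine there and hence bounded. The constant in the L^p bound must not depend on \<delta>,
  since \<delta> will tend to 0.\<close>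

lemma (in bounded_support) affine_correction:
  assumes tr: "C1_triple S f f1 f2" and p: "1 < p" and f2p: "integrable lborel (\<lambda>x. norm (f2 x) powr p)"
    and \<delta>: "0 < \<delta>" and sub: "{-\<delta>..\<delta>} \<subseteq> S"
  obtains e e1 e2 K where "C1_triple S e e1 e2" "integrable lborel (\<lambda>x. norm (e2 x) powr p)"
    "(LINT x|lborel. norm (e2 x) powr p)
      \<le> 2 powr p * (1 + 8 powr p) * (LINT x|lborel. indicator {-\<delta>..\<delta>} x * norm (f2 x) powr p)"
    "\<forall>x. \<bar>x\<bar> \<le> \<delta> \<longrightarrow> norm (f2 x - e2 x) \<le> K"
proof -
  note trD = C1_tripleD[OF tr]
  note [measurable] = f2_borel[OF tr]
  let ?X = "{-\<delta>..\<delta>}"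
  have ipow: "integrable lborel (\<lambda>t. indicator ?X t * t ^ k :: real)" for k
    using borel_integrable_atLeastAtMost'[of "-\<delta>" \<delta> "\<lambda>t. t ^ k"]
    by (simp add: set_integrable_def continuous_intros)
  have Ipow: "(LINT t|lborel. indicator ?X t * t ^ k) = (\<delta> ^ Suc k - (-\<delta>) ^ Suc k) / Suc k" for k
    using integral_power[of "-\<delta>" \<delta> k] \<delta> by (simp add: mult.commute)
  have if2: "integrable lborel (\<lambda>t. indicator ?X t *\<^sub>R (t ^ k *\<^sub>R f2 t))" for k
  proof (rule Bochner_Integration.integrable_bound[OF integrable_mult_right[OF integrable_norm[OF trD(1)], of "\<delta> ^ k"]])
    have "norm (indicator ?X t *\<^sub>R (t ^ k *\<^sub>R f2 t)) \<le> \<delta> ^ k * norm (f2 t)" for t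
    proof (cases "t \<in> ?X")
      case True
      then have "\<bar>t\<bar> ^ k \<le> \<delta> ^ k" by (intro power_mono) auto
      then show ?thesis using True by (simp add: power_abs mult_right_mono)
    qed (use \<delta> in simp)
    then show "AE t in lborel. norm (indicator ?X t *\<^sub>R (t ^ k *\<^sub>R f2 t)) \<le> norm (\<delta> ^ k * norm (f2 t))"
      using \<delta> by simp
  qed measurable
  define E where "E k = (LINT t|lborel. indicator ?X t *\<^sub>R (t ^ k *\<^sub>R f2 t))" for k :: nat
  define N where "N = (LINT t|lborel. indicator ?X t * norm (f2 t))"
  have N0: "0 \<le> N" by (simp add: N_def)
  have iN: "integrable lborel (\<lambda>t. indicator ?X t * norm (f2 t))"
    using integrable_indicator_scaleR[OF integrable_norm[OF trD(1)], of ?X] by simp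
  have EN: "norm (E k) \<le> \<delta> ^ k * N" for k
  proof -
    have "norm (E k) \<le> (LINT t|lborel. norm (indicator ?X t *\<^sub>R (t ^ k *\<^sub>R f2 t)))"
      unfolding E_def by (rule integral_norm_bound)
    also have "\<dots> \<le> (LINT t|lborel. \<delta> ^ k * (indicator ?X t * norm (f2 t)))"
    proof (rule integral_mono')
      show "norm (indicator ?X t *\<^sub>R (t ^ k *\<^sub>R f2 t)) \<le> \<delta> ^ k * (indicator ?X t * norm (f2 t))" for t
      proof (cases "t \<in> ?X")
        case True
        then have "\<bar>t\<bar> ^ k \<le> \<delta> ^ k" by (intro power_mono) auto
        then show ?thesis using True by (simp add: power_abs mult_right_mono)
      qed simp
    qed (use iN \<delta> in simp_all)
    finally show ?thesis by (simp add: N_def)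
  qed
  \<comment> \<open>The orthogonal projection on affine functions: the integrals of 1 and t^2 over
    the interval are 2 \<delta> and 2 \<delta>^3 / 3, and that of t is 0.\<close>
  define c0 where "c0 = (1 / (2 * \<delta>)) *\<^sub>R E 0"
  define c1 where "c1 = (3 / (2 * \<delta> ^ 3)) *\<^sub>R E 1"
  define \<rho> where "\<rho> = 2 * N / \<delta>"
  have \<rho>0: "0 \<le> \<rho>" using N0 \<delta> by (simp add: \<rho>_def)
  have aff: "norm (c0 + t *\<^sub>R c1) \<le> \<rho>" if "\<bar>t\<bar> \<le> \<delta>" for t
  proof -
    have "norm c0 \<le> 1 / (2 * \<delta>) * N" using EN[of 0] \<delta> by (simp add: c0_def divide_right_mono)
    moreover have "norm (t *\<^sub>R c1) \<le> \<delta> * (3 / (2 * \<delta> ^ 3) * (\<delta> * N))"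
      using EN[of 1] \<delta> that unfolding norm_scaleR c1_def
      by (intro mult_mono) (auto simp: divide_right_mono mult_left_mono)
    moreover have "\<delta> * (3 / (2 * \<delta> ^ 3) * (\<delta> * N)) = 3 / (2 * \<delta>) * N"
      using \<delta> by (simp add: power3_eq_cube)
    ultimately have "norm (c0 + t *\<^sub>R c1) \<le> 1 / (2 * \<delta>) * N + 3 / (2 * \<delta>) * N"
      using norm_triangle_ineq[of c0 "t *\<^sub>R c1"] by linarith
    also have "\<dots> = \<rho>" using \<delta> by (simp add: \<rho>_def field_simps)
    finally show ?thesis .
  qed
  define e2 where "e2 t = indicator ?X t *\<^sub>R (f2 t - (c0 + t *\<^sub>R c1))" for t
  have [measurable]: "e2 \<in> borel_measurable borel" unfolding e2_def by measurable
  have mom_eq: "t ^ k *\<^sub>R e2 t = indicator ?X t *\<^sub>R (t ^ k *\<^sub>R f2 t)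
      - ((indicator ?X t * t ^ k) *\<^sub>R c0 + (indicator ?X t * t ^ Suc k) *\<^sub>R c1)" for k t
    by (simp add: e2_def algebra_simps scaleR_add_right)
  have ie2: "integrable lborel (\<lambda>t. t ^ k *\<^sub>R e2 t)" for k
    unfolding mom_eq using if2[of k] ipow[of k] ipow[of "Suc k"]
    by (intro Bochner_Integration.integrable_diff Bochner_Integration.integrable_add integrable_scaleR_left) auto
  have mom: "(LINT t|lborel. t ^ k *\<^sub>R e2 t) = E k - (((\<delta> ^ Suc k - (-\<delta>) ^ Suc k) / Suc k) *\<^sub>R c0
      + ((\<delta> ^ Suc (Suc k) - (-\<delta>) ^ Suc (Suc k)) / Suc (Suc k)) *\<^sub>R c1)" for k
  proof -
    have "(LINT t|lborel. t ^ k *\<^sub>R e2 t) = E k - ((LINT t|lborel. indicator ?X t * t ^ k) *\<^sub>R c0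
        + (LINT t|lborel. indicator ?X t * t ^ Suc k) *\<^sub>R c1)"
      unfolding mom_eq E_def using if2[of k] ipow[of k] ipow[of "Suc k"]
      by (subst Bochner_Integration.integral_diff Bochner_Integration.integral_add
          | intro Bochner_Integration.integrable_add integrable_scaleR_left | simp)+
    then show ?thesis unfolding Ipow .
  qed
  have mom0: "(LINT t|lborel. e2 t) = 0"
    using mom[of 0] \<delta> by (simp add: c0_def)
  have mom1: "(LINT t|lborel. t *\<^sub>R e2 t) = 0"
    using mom[of 1] \<delta> by (simp add: c1_def power3_eq_cube)
  have i0: "integrable lborel e2" and i1: "integrable lborel (\<lambda>t. t *\<^sub>R e2 t)"
    using ie2[of 0] ie2[of 1] by simp_all
  define e1 where "e1 x = (LINT t|lborel. indicator {..x} t *\<^sub>R e2 t)" for x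
  define e where "e x = x *\<^sub>R e1 x - (LINT t|lborel. indicator {..x} t *\<^sub>R (t *\<^sub>R e2 t))" for x
  \<comment> \<open>To the right of the interval e x equals x times the zeroth moment minus the
    first moment, and both are 0.\<close>
  have e_out: "e x = 0" if "x \<notin> S" for x
  proof -
    from that sub have "x \<notin> ?X" by auto
    then consider "x < - \<delta>" | "\<delta> < x" by fastforce
    then show ?thesis
    proof cases
      case 1
      then have z: "indicator {..x} t *\<^sub>R e2 t = 0" "indicator {..x} t *\<^sub>R (t *\<^sub>R e2 t) = 0" for t
        by (auto simp: indicator_def e2_def)
      show ?thesis unfolding e_def e1_def z by simp
    next
      case 2
      then have z: "indicator {..x} t *\<^sub>R e2 t = e2 t" "indicator {..x} t *\<^sub>R (t *\<^sub>R e2 t) = t *\<^sub>R e2 t" for t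
        by (auto simp: indicator_def e2_def)
      show ?thesis unfolding e_def e1_def z mom0 mom1 by simp
    qed
  qed
  have tre: "C1_triple S e e1 e2"
    unfolding C1_triple_def
  proof (intro conjI allI impI)
    show "(e has_vector_derivative e1 x) (at x)" for x
      by (rule second_antiderivative[OF i0 i1]) (simp_all only: e1_def e_def)
    show "e2 x = 0" if "x \<notin> S" for x
    proof -
      have "x \<notin> ?X" using that sub by blast
      then have "indicator ?X x = (0 :: real)" by (simp add: indicator_def)
      then show ?thesis by (simp only: e2_def scaleR_zero_left)
    qed
  qed (use i0 e_out in \<open>simp_all add: e1_def\<close>)
  let ?P = "LINT x|lborel. indicator ?X x * norm (f2 x) powr p"
  have iP: "integrable lborel (\<lambda>x. indicator ?X x * norm (f2 x) powr p)"
    using integrable_indicator_scaleR[OF f2p, of ?X] by simp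
  let ?H = "\<lambda>x. 2 powr p * (indicator ?X x * norm (f2 x) powr p + indicator ?X x * \<rho> powr p)"
  have iX: "integrable lborel (\<lambda>x. indicator ?X x * \<rho> powr p)" using ipow[of 0] by simp
  have iH: "integrable lborel ?H"
    by (intro integrable_mult_right Bochner_Integration.integrable_add iP iX)
  have le: "norm (e2 x) powr p \<le> ?H x" for x
  proof (cases "x \<in> ?X")
    case True
    have "norm (e2 x) \<le> norm (f2 x) + \<rho>"
      using True aff[of x] norm_triangle_ineq4[of "f2 x" "c0 + x *\<^sub>R c1"] by (auto simp: e2_def abs_le_iff)
    then have "norm (e2 x) powr p \<le> (norm (f2 x) + \<rho>) powr p" using p by (intro powr_mono2) auto
    also have "\<dots> \<le> 2 powr p * (norm (f2 x) powr p + \<rho> powr p)"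
      using p \<rho>0 by (intro powr_add_le) auto
    finally show ?thesis using True by simp
  qed (simp add: e2_def)
  have ie2p: "integrable lborel (\<lambda>x. norm (e2 x) powr p)"
    by (rule Bochner_Integration.integrable_bound[OF iH]) (use le in \<open>auto intro!: AE_I2 order_trans[OF le abs_ge_self]\<close>)
  have "(LINT x|lborel. norm (e2 x) powr p) \<le> (LINT x|lborel. ?H x)"
    by (rule integral_mono[OF ie2p iH le])
  also have "\<dots> = 2 powr p * (?P + 2 * \<delta> * \<rho> powr p)"
    unfolding integral_mult_right_zero Bochner_Integration.integral_add[OF iP iX] using \<delta> by simp
  \<comment> \<open>The powers of \<delta> cancel: (2 / \<delta>)^p from \<rho>, (2 \<delta>)^(p -
    1) from Jensen and the length 2 \<delta>, which leaves 8^p.\<close>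
  also have "2 * \<delta> * \<rho> powr p \<le> 8 powr p * ?P"
  proof -
    have "N powr p \<le> 2 powr p * (2 * \<delta>) powr (p - 1) * ?P"
      unfolding N_def
    proof (rule powr_integral_on_le)
      show "emeasure lborel ?X < \<infinity>" by (simp add: emeasure_lborel_Icc_eq)
    qed (use \<delta> p iP in simp_all)
    then have "2 * \<delta> * ((2 / \<delta>) powr p * N powr p) \<le> 2 * \<delta> * ((2 / \<delta>) powr p * (2 powr p * (2 * \<delta>) powr (p - 1) * ?P))"
      using \<delta> by (intro mult_left_mono) auto
    also have "\<dots> = ((2 / \<delta>) powr p * (2 powr p * ((2 * \<delta>) powr (p - 1) * (2 * \<delta>)))) * ?P"
      by (simp only: mult_ac)
    also have "(2 * \<delta>) powr (p - 1) * (2 * \<delta>) = (2 * \<delta>) powr p" using \<delta> by (simp add: powr_diff)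
    also have "(2 / \<delta>) powr p * (2 powr p * (2 * \<delta>) powr p) = 8 powr p"
      using \<delta> by (simp flip: powr_mult)
    also have "(2 / \<delta>) powr p * N powr p = \<rho> powr p"
      by (simp add: \<rho>_def flip: powr_mult)
    finally show ?thesis .
  qed
  finally have Lp: "(LINT x|lborel. norm (e2 x) powr p) \<le> 2 powr p * (1 + 8 powr p) * ?P"
    by (simp add: algebra_simps)
  have K: "\<forall>x. \<bar>x\<bar> \<le> \<delta> \<longrightarrow> norm (f2 x - e2 x) \<le> \<rho>"
    using aff by (auto simp: e2_def abs_le_iff)
  show ?thesis by (rule that[OF tre ie2p Lp K])
qed

section \<open>The equation for the resolvent density\<close>

lemma Lspace_cong:
  assumes "\<And>x. x \<in> space N \<Longrightarrow> u x = v x"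
  shows "u \<in> Lspace r N \<longleftrightarrow> v \<in> Lspace r N"
  using assms measurable_cong[of N u v borel]
    Bochner_Integration.integrable_cong[OF refl, of N "\<lambda>x. norm (u x) powr r" "\<lambda>x. norm (v x) powr r"]
  by (auto simp: Lspace_def)

lemma cnj_borel [measurable]: "cnj \<in> borel_measurable borel"
  by (intro borel_measurable_continuous_onI linear_continuous_on bounded_linear_cnj)

lemma Lspace_cnj: "u \<in> Lspace r N \<Longrightarrow> (\<lambda>x. cnj (u x)) \<in> Lspace r N"
  by (auto simp: Lspace_def intro: measurable_compose[OF _ cnj_borel])

text \<open>Test with the extremal function |w|^(q - 2) w of Hoelder's inequality: it is in L^p
  because (q - 1) p = q, and it pairs with w to the integral of |w|^q.\<close>

lemma Lspace_pairing_nondegenerate: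
  assumes w: "w \<in> Lspace q N" and pq: "1 < p" "1 < q" "1 / p + 1 / q = 1"
    and z: "\<And>u. u \<in> Lspace p N \<Longrightarrow> (LINT x|N. u x * cnj (w x)) = 0"
  shows "AE x in N. w x = 0"
proof -
  note [measurable] = Lspace_measurable[OF w]
  define u where "u x = of_real (norm (w x) powr (q - 2)) * w x" for x
  have qp: "(q - 1) * p = q" using pq by (simp add: field_simps)
  have nu: "norm (u x) = norm (w x) powr (q - 1)" for x
    using powr_add[of "norm (w x)" "q - 2" 1] by (cases "w x = 0") (auto simp: u_def norm_mult)
  have uw: "u x * cnj (w x) = of_real (norm (w x) powr q)" for x
  proof (cases "w x = 0")
    case False
    then have "norm (w x) powr (q - 2) * (norm (w x))\<^sup>2 = norm (w x) powr q"
      using powr_add[of "norm (w x)" "q - 2" 2] by simp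
    moreover have "u x * cnj (w x) = of_real (norm (w x) powr (q - 2)) * of_real ((norm (w x))\<^sup>2)"
      unfolding complex_norm_square by (simp add: u_def mult.assoc)
    ultimately show ?thesis by (simp only: of_real_mult[symmetric])
  qed (simp add: u_def)
  have "integrable N (\<lambda>x. norm (u x) powr p)"
    unfolding nu powr_powr qp using Lspace_integrable[OF w] .
  moreover have "u \<in> borel_measurable N" unfolding u_def by measurable
  ultimately have "u \<in> Lspace p N" by (simp add: Lspace_def)
  from z[OF this] have "complex_of_real (LINT x|N. norm (w x) powr q) = 0"
    unfolding uw by simp
  then have "AE x in N. norm (w x) powr q = 0"
    using integral_nonneg_eq_0_iff_AE[OF Lspace_integrable[OF w]] by simp
  then show ?thesis by eventually_elim simp
qed

section \<open>The potential at the origin\<close>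

context regular_quasi_potential
begin

text \<open>A bounded second derivative near 0 makes g bounded near 0, so B g is continuous at 0
  along S, as F is. They agree on a set of full measure, from which a sequence tending to 0 is
  taken.\<close>

lemma potential_at_0_bounded:
  assumes tr: "C1_triple S F F1 F2" and F2p: "integrable lborel (\<lambda>x. norm (F2 x) powr p)"
    and r: "0 < r" "{-r..r} \<subseteq> S" and K: "\<And>x. \<bar>x\<bar> \<le> r \<Longrightarrow> norm (F2 x) \<le> K"
  shows "B (\<lambda>x. - levy_op A \<gamma> \<nu> F F1 F2 x) 0 = F 0"
proof -
  define g where "g x = - levy_op A \<gamma> \<nu> F F1 F2 x" for x
  have gL: "g \<in> Lp p S" unfolding g_def by (rule levy_op_Lp(1)[OF tr pq(1) F2p])
  define d where "d = min (r / 2) 1"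
  have d: "0 < d" "d \<le> 1" "2 * d \<le> r" using r by (auto simp: d_def)
  obtain M where M: "\<And>x. \<bar>x\<bar> \<le> d \<Longrightarrow> norm (g x) \<le> M"
    using levy_op_bounded_near_0[OF tr d(1,2), of K] K d(3) unfolding g_def norm_minus_cancel by fastforce
  have zero: "0 \<in> S" using r by auto
  have ae: "AE x in lborel. x \<in> S \<longrightarrow> B g x = F x"
    using potential_of_levy_op[OF tr F2p] unfolding AE_lebesgue_on_iff[OF S_borel] g_def .
  \<comment> \<open>An interval of positive length cannot lie in the exceptional null set.\<close>
  have "\<exists>x\<in>{0<..<min r (1 / real (Suc j))}. B g x = F x" for j
  proof (rule ccontr)
    define t where "t = min r (1 / real (Suc j))"
    have t: "0 < t" "{0<..<t} \<subseteq> S" using r by (auto simp: t_def)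
    assume "\<not> (\<exists>x\<in>{0<..<min r (1 / real (Suc j))}. B g x = F x)"
    then have no: "\<And>x. x \<in> {0<..<t} \<Longrightarrow> B g x \<noteq> F x" unfolding t_def[symmetric] by blast
    have "AE x in lborel. x \<notin> {0<..<t}"
      using ae by eventually_elim (use no t in blast)
    then have "{0<..<t} \<in> null_sets lborel" by (subst (asm) AE_iff_null_sets[symmetric]) auto
    then show False using t by (simp add: null_sets_def)
  qed
  then obtain xs where xs: "\<And>j. xs j \<in> {0<..<min r (1 / real (Suc j))}" "\<And>j. B g (xs j) = F (xs j)"
    by metis
  have xS: "xs j \<in> S" for j using xs(1)[of j] r by auto
  have x0: "xs \<longlonglongrightarrow> 0"
  proof (rule real_tendsto_sandwich[where f = "\<lambda>_. 0" and h = "\<lambda>j. 1 / real (Suc j)"])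
    show "(\<lambda>j. 1 / real (Suc j)) \<longlonglongrightarrow> 0" by (rule LIMSEQ_Suc[OF lim_1_over_n])
    show "\<forall>\<^sub>F j in sequentially. 0 \<le> xs j" using xs(1) by (auto intro!: always_eventually less_imp_le)
    show "\<forall>\<^sub>F j in sequentially. xs j \<le> 1 / real (Suc j)"
      using xs(1) by (auto intro!: always_eventually less_imp_le simp del: of_nat_Suc)
  qed simp
  have "(\<lambda>j. kernel_op N ker g (xs j)) \<longlonglongrightarrow> kernel_op N ker g 0"
    by (rule kernel_op_continuous_at_0[OF gL d(1) M zero xS x0])
  moreover have "kernel_op N ker g (xs j) = F (xs j)" for j
    using xs(2)[of j] B_eq[OF gL xS[of j]] by simp
  ultimately have "(\<lambda>j. F (xs j)) \<longlonglongrightarrow> B g 0" by (simp add: B_eq[OF gL zero])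
  moreover have "(\<lambda>j. F (xs j)) \<longlonglongrightarrow> F 0"
    using isCont_tendsto_compose[OF has_vector_derivative_continuous[OF C1_tripleD(6)[OF tr]] x0] .
  ultimately show ?thesis unfolding g_def[abs_def] by (rule LIMSEQ_unique)
qed

text \<open>Replacing \<open>F2\<close> by an affine function with the same zeroth and first moments on a shrinking
  interval around the origin reduces the claim to the preceding lemma: the kernel \<open>\<Phi> 0\<close> lies in
  \<open>L^q\<close>, and the correction is small in \<open>L^p\<close>.\<close>

lemma potential_at_0:
  assumes tr: "C1_triple S F F1 F2" and F2p: "integrable lborel (\<lambda>x. norm (F2 x) powr p)"
    and r: "0 < r" "{-r..r} \<subseteq> S"
  shows "B (\<lambda>x. - levy_op A \<gamma> \<nu> F F1 F2 x) 0 = F 0"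
proof -
  define g where "g x = - levy_op A \<gamma> \<nu> F F1 F2 x" for x
  have gL: "g \<in> Lp p S" unfolding g_def by (rule levy_op_Lp(1)[OF tr pq(1) F2p])
  have zero: "0 \<in> S" using r by auto
  note [measurable] = f2_borel[OF tr]
  define P where "P \<delta> = (LINT x|lborel. indicator {-\<delta>..\<delta>} x * norm (F2 x) powr p)" for \<delta> :: real
  define Q where "Q = (LINT y|N. norm (complex_of_real (\<Phi> 0 y)) powr q) powr (1 / q)"
  define c where "c = 2 powr p * (1 + 8 powr p)"
  \<comment> \<open>The correction enters at 0 in two ways: through B, by Hoelder with the L^q norm
    of \<Phi> at 0, and through its own value e 0, by \<open>f_bound\<close>.\<close>
  define K1 where "K1 = levy_op_const p powr (1 / p) * Q
    + 2 * (R + 1) * (2 powr p * (2 * R) powr (p - 1)) powr (1 / p)"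
  have K1: "0 \<le> K1" using R_pos by (simp add: K1_def Q_def)
  have est: "norm (B g 0 - F 0) \<le> K1 * (c * P \<delta>) powr (1 / p)" if \<delta>: "0 < \<delta>" "\<delta> \<le> r" for \<delta>
  proof -
    have sub: "{-\<delta>..\<delta>} \<subseteq> S" using \<delta> r by auto
    obtain e e1 e2 K where tre: "C1_triple S e e1 e2" and e2p: "integrable lborel (\<lambda>x. norm (e2 x) powr p)"
      and W: "(LINT x|lborel. norm (e2 x) powr p) \<le> c * P \<delta>"
      and K: "\<forall>x. \<bar>x\<bar> \<le> \<delta> \<longrightarrow> norm (F2 x - e2 x) \<le> K"
      using affine_correction[OF tr pq(1) F2p \<delta>(1) sub, folded c_def P_def] by blast
    define W where "W = (LINT x|lborel. norm (e2 x) powr p)"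
    have W0: "0 \<le> W" by (simp add: W_def)
    define ge where "ge x = - levy_op A \<gamma> \<nu> e e1 e2 x" for x
    have geL: "ge \<in> Lp p S" unfolding ge_def by (rule levy_op_Lp(1)[OF tre pq(1) e2p])
    let ?H = "\<lambda>x. 1 * F x + (- 1) * e x"
    let ?H1 = "\<lambda>x. 1 * F1 x + (- 1) * e1 x"
    let ?H2 = "\<lambda>x. 1 * F2 x + (- 1) * e2 x"
    have trH: "C1_triple S ?H ?H1 ?H2" by (rule C1_triple_lincomb[OF tr tre])
    have H2p: "integrable lborel (\<lambda>x. norm (?H2 x) powr p)"
    proof -
      have "F2 \<in> Lspace p lborel" "e2 \<in> Lspace p lborel"
        using F2p e2p f2_borel[OF tr] f2_borel[OF tre] by (auto simp: Lspace_def)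
      from Lspace_integrable[OF Lspace_diff[OF this]] pq(1) show ?thesis by simp
    qed
    define gH where "gH x = - levy_op A \<gamma> \<nu> ?H ?H1 ?H2 x" for x
    have gHL: "gH \<in> Lp p S" unfolding gH_def by (rule levy_op_Lp(1)[OF trH pq(1) H2p])
    have "B gH 0 = ?H 0"
      unfolding gH_def
      by (rule potential_at_0_bounded[OF trH H2p \<delta>(1) sub, of K]) (use K in simp)
    moreover have "B gH 0 = B (\<lambda>x. 1 * g x + (- 1) * ge x) 0"
    proof (rule B_cong_AE[OF gHL Lp_lincomb[OF gL geL pq(1)] zero])
      show "AE y in N. gH y = 1 * g y + (- 1) * ge y"
        unfolding AE_lebesgue_on_iff[OF S_borel] gH_def g_def ge_def
        using levy_op_lincomb[OF tr tre, of 1 "- 1"] by eventually_elim (auto simp only: minus_add_distrib mult_minus_left mult_minus_right)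
    qed
    ultimately have eq: "B g 0 - B ge 0 = F 0 - e 0"
      using B_lincomb[OF gL geL zero, of 1 "- 1"] by simp
    \<comment> \<open>The identity holds for F - e, so the defect at 0 of F equals that of the small
      function e.\<close>
    have diff: "B g 0 - F 0 = B ge 0 - e 0"
    proof -
      have "B g 0 - F 0 = (B g 0 - B ge 0) + (B ge 0 - F 0)" by simp
      then show ?thesis unfolding eq by simp
    qed
    have "norm (e 0) \<le> 2 * (R + 1) * (LINT t|lborel. norm (e2 t))" by (rule f_bound[OF tre])
    also have "(LINT t|lborel. norm (e2 t)) \<le> (2 powr p * (2 * R) powr (p - 1)) powr (1 / p) * W powr (1 / p)"
    proof -
      have "((LINT t|lborel. norm (e2 t)) powr p) powr (1 / p) \<le> (2 powr p * (2 * R) powr (p - 1) * W) powr (1 / p)"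
        unfolding W_def using norm_f2_powr[OF tre pq(1) e2p] pq(1) by (intro powr_mono2) auto
      then show ?thesis using pq(1) by (simp only: powr_mult[symmetric]) (simp add: powr_powr)
    qed
    finally have e0: "norm (e 0) \<le> 2 * (R + 1) * ((2 powr p * (2 * R) powr (p - 1)) powr (1 / p) * W powr (1 / p))"
      using R_pos by (simp add: mult_left_mono)
    have "norm (B ge 0) \<le> (LINT x|N. norm (ge x) powr p) powr (1 / p) * Q"
    proof -
      have "B ge 0 = (LINT y|N. ge y * of_real (\<Phi> 0 y))"
        unfolding regD(3)[OF geL zero] by (simp add: mult.commute)
      also have "norm \<dots> \<le> (LINT x|N. norm (ge x) powr p) powr (1 / p) * Q"
        unfolding Q_def using geL Phi_Lspace[OF zero] pq
        by (intro Holder_integral(2)) (auto simp: Lp_eq_Lspace Lspace_def)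
      finally show ?thesis .
    qed
    also have "\<dots> \<le> (levy_op_const p * W) powr (1 / p) * Q"
      using levy_op_Lp(2)[OF tre pq(1) e2p] pq(1)
      by (intro mult_right_mono powr_mono2) (auto simp: ge_def W_def Q_def)
    finally have "norm (B ge 0) \<le> levy_op_const p powr (1 / p) * W powr (1 / p) * Q"
      by (simp only: powr_mult)
    then have "norm (B g 0 - F 0) \<le> K1 * W powr (1 / p)"
      using e0 norm_triangle_ineq4[of "B ge 0" "e 0"] unfolding diff K1_def by (simp add: algebra_simps)
    also have "\<dots> \<le> K1 * (c * P \<delta>) powr (1 / p)"
      using W W0 K1 pq(1) by (intro mult_left_mono powr_mono2) (auto simp: W_def)
    finally show ?thesis .
  qed
  have "(\<lambda>m. P (r / real (Suc m))) \<longlonglongrightarrow> (LINT x::real|lborel. 0)"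
    unfolding P_def
  proof (rule integral_dominated_convergence[OF _ _ F2p])
    show "AE x in lborel. (\<lambda>m. indicator {-(r / real (Suc m))..r / real (Suc m)} x * norm (F2 x) powr p) \<longlonglongrightarrow> 0"
      using AE_lborel_singleton[of 0]
    proof eventually_elim
      case (elim x)
      have "(\<lambda>m. r * (1 / real (Suc m))) \<longlonglongrightarrow> r * 0"
        by (intro tendsto_mult_left LIMSEQ_Suc[OF lim_1_over_n])
      then have "\<forall>\<^sub>F m in sequentially. r / real (Suc m) < \<bar>x\<bar>"
        using elim by (intro order_tendstoD(2)[of _ 0]) auto
      then show ?case
        by (intro tendsto_eventually) (auto elim!: eventually_mono simp: indicator_def)
    qed
    show "AE x in lborel. norm (indicator {-(r / real (Suc m))..r / real (Suc m)} x * norm (F2 x) powr p) \<le> norm (F2 x) powr p" for m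
      by (auto simp: indicator_def)
    show "(\<lambda>x. indicator {-(r / real (Suc m))..r / real (Suc m)} x * norm (F2 x) powr p) \<in> borel_measurable lborel" for m
      using borel_measurable_integrable[OF integrable_indicator_scaleR[OF F2p, of "{-(r / real (Suc m))..r / real (Suc m)}"]]
      by simp
  qed simp
  then have "(\<lambda>m. c * P (r / real (Suc m))) \<longlonglongrightarrow> c * 0"
    by (intro tendsto_mult_left) simp
  then have "(\<lambda>m. (c * P (r / real (Suc m))) powr (1 / p)) \<longlonglongrightarrow> 0"
    using pq(1) by (intro tendsto_zero_powrI[where b = "1 / p"]) (auto simp: c_def P_def intro!: always_eventually mult_nonneg_nonneg)
  then have "(\<lambda>m. K1 * (c * P (r / real (Suc m))) powr (1 / p)) \<longlonglongrightarrow> K1 * 0"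
    by (rule tendsto_mult_left)
  moreover have "norm (B g 0 - F 0) \<le> K1 * (c * P (r / real (Suc m))) powr (1 / p)" for m
    using r by (intro est) (auto simp: divide_le_eq)
  ultimately have "norm (B g 0 - F 0) \<le> K1 * 0"
    by (intro LIMSEQ_le_const) auto
  then show ?thesis by (simp add: g_def[abs_def])
qed

lemma C_segments_potential:
  assumes f: "f \<in> C_segments p n a b" and zero: "0 \<in> S"
  obtains g where "g \<in> Lp p S" "AE x in N. - truncated_generator A \<gamma> \<nu> S f x = g x"
    "AE x in N. B g x = f x" "B g 0 = f 0"
proof -
  obtain f1 f2 where tr: "C1_triple S (truncation S f) f1 f2"
    and f2p: "integrable lborel (\<lambda>x. norm (f2 x) powr p)"
    and eq: "AE x in N. truncated_generator A \<gamma> \<nu> S f x = levy_op A \<gamma> \<nu> (truncation S f) f1 f2 x"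
    using triple_of_C_segments[OF f] by blast
  define g where "g x = - levy_op A \<gamma> \<nu> (truncation S f) f1 f2 x" for x
  have gL: "g \<in> Lp p S" unfolding g_def by (rule levy_op_Lp(1)[OF tr pq(1) f2p])
  have g: "AE x in N. - truncated_generator A \<gamma> \<nu> S f x = g x"
    using eq by eventually_elim (simp add: g_def)
  have Bg: "AE x in N. B g x = f x"
    using potential_of_levy_op[OF tr f2p, folded g_def] AE_space
    by eventually_elim (auto simp: truncation_def)
  have "B g 0 = f 0"
  proof -
    from zero obtain k where k: "k \<in> {1..n}" "0 \<in> {a k..b k}"
      by (auto simp: S_eq segment_union_def)
    consider "0 = a k \<or> 0 = b k" | "a k < 0" "0 < b k" using k(2) by fastforce
    then show ?thesis
    proof cases
      \<comment> \<open>If 0 is an endpoint there is no interval around it inside S, but the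
        boundary conditions of \<Phi> and of f make both sides 0.\<close>
      case 1
      then have P0: "\<Phi> 0 y = 0" if "y \<in> S" for y using regD(6,7)[OF k(1) that] by auto
      have "B g 0 = (LINT y|N. 0)"
        unfolding regD(3)[OF gL zero] by (intro Bochner_Integration.integral_cong refl) (simp add: P0)
      moreover have "f (a k) = 0" "f (b k) = 0"
        using f k(1) unfolding C_segments_def Let_def by auto
      ultimately show ?thesis using 1 by auto
    next
      case 2
      define r where "r = min (- a k) (b k)"
      have "0 < r" "{-r..r} \<subseteq> S" using 2 k(1) by (auto simp: r_def S_eq segment_union_def intro!: bexI[of _ k])
      from potential_at_0[OF tr f2p this] show ?thesis
        using zero by (simp add: g_def[abs_def] truncation_def)
    qed
  qed
  then show ?thesis by (rule that[OF gL g Bg])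
qed

section \<open>Duality and uniqueness\<close>

abbreviation "adj \<equiv> kernel_op N (\<lambda>x y. ker y x)"

text \<open>Moves I + s B from the test side to I + s adj on the side of h. The pairing conjugates
  h, and since the kernel is real its adjoint commutes with conjugation.\<close>

lemma pairing_shifted:
  assumes g: "g \<in> Lp p S" and h: "h \<in> Lp q S"
    and v: "AE x in N. v x = of_real s * B g x + g x"
  shows "pairing S v h = (LINT x|N. g x * cnj (h x + of_real s * adj h x))"
    and "v \<in> Lspace p N"
proof -
  interpret T: schur_kernel N "\<lambda>x y. ker y x" "ker_mass (2 * R)" by (rule K.transpose)
  have gL: "g \<in> Lspace p N" and hL: "h \<in> Lspace q N" using g h by (simp_all add: Lp_eq_Lspace)
  have hc: "(\<lambda>x. cnj (h x)) \<in> Lspace q N" by (rule Lspace_cnj[OF hL])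
  have KgL: "kernel_op N ker g \<in> Lspace p N" by (rule K.kernel_op_Lspace(2)[OF gL pq(1)])
  have KhL: "adj (\<lambda>x. cnj (h x)) \<in> Lspace q N" by (rule T.kernel_op_Lspace(2)[OF hc pq(2)])
  have adj_cnj: "adj (\<lambda>x. cnj (h x)) x = cnj (adj h x)" for x
  proof -
    have "adj (\<lambda>x. cnj (h x)) x = (LINT y|N. cnj (of_real (ker y x) * h y))"
      unfolding kernel_op_def by (intro Bochner_Integration.integral_cong refl) simp
    also have "\<dots> = cnj (adj h x)"
      unfolding kernel_op_def by (rule Bochner_Integration.integral_cnj)
    finally show ?thesis .
  qed
  define v' where "v' x = of_real s * kernel_op N ker g x + g x" for x
  have v'L: "v' \<in> Lspace p N"
    unfolding v'_def using pq(1) by (intro Lspace_add Lspace_mult KgL gL) simp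
  have vv': "AE x in N. v' x = v x"
    using v AE_space by eventually_elim (use B_eq[OF g] in \<open>simp add: v'_def\<close>)
  have vm: "v \<in> borel_measurable N"
    by (rule borel_measurable_lebesgue_on_AE[OF S_borel Lspace_measurable[OF v'L] vv'])
  show "v \<in> Lspace p N"
    by (rule Lspace_bound[OF v'L vm]) (use pq(1) vv' in \<open>auto elim: eventually_mono\<close>)
  note [measurable] = Lspace_measurable[OF hL] Lspace_measurable[OF v'L] vm
  have H: "integrable N (\<lambda>x. w x * z x)" if "w \<in> Lspace p N" "z \<in> Lspace q N" for w z
    using that pq by (intro Holder_integral(1)) (auto simp: Lspace_def)
  have "pairing S v h = (LINT x|N. v' x * cnj (h x))"
    unfolding pairing_def
  proof (rule integral_cong_AE)
    show "AE x in N. v x * cnj (h x) = v' x * cnj (h x)" using vv' by eventually_elim simp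
  qed measurable
  also have "\<dots> = (LINT x|N. of_real s * (kernel_op N ker g x * cnj (h x)) + g x * cnj (h x))"
    by (simp add: v'_def algebra_simps)
  also have "\<dots> = of_real s * (LINT x|N. kernel_op N ker g x * cnj (h x)) + (LINT x|N. g x * cnj (h x))"
    using H[OF KgL hc] H[OF gL hc] by simp
  also have "(LINT x|N. kernel_op N ker g x * cnj (h x)) = (LINT x|N. g x * adj (\<lambda>x. cnj (h x)) x)"
    by (rule K.kernel_op_dual[OF gL hc pq])
  also have "of_real s * \<dots> + (LINT x|N. g x * cnj (h x))
      = (LINT x|N. of_real s * (g x * adj (\<lambda>x. cnj (h x)) x) + g x * cnj (h x))"
    using H[OF gL KhL] H[OF gL hc] by simp
  also have "\<dots> = (LINT x|N. g x * cnj (h x + of_real s * adj h x))"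
    unfolding adj_cnj by (simp add: algebra_simps)
  finally show "pairing S v h = (LINT x|N. g x * cnj (h x + of_real s * adj h x))" .
qed

lemma C_segments_shifted:
  assumes f: "f \<in> C_segments p n a b" and zero: "0 \<in> S"
  obtains g where "g \<in> Lp p S" "B g 0 = f 0"
    "AE x in N. of_real s * f x - truncated_generator A \<gamma> \<nu> S f x = of_real s * B g x + g x"
proof -
  obtain g where g: "g \<in> Lp p S" "AE x in N. - truncated_generator A \<gamma> \<nu> S f x = g x"
    "AE x in N. B g x = f x" "B g 0 = f 0"
    using C_segments_potential[OF f zero] by blast
  have "AE x in N. of_real s * f x - truncated_generator A \<gamma> \<nu> S f x = of_real s * B g x + g x"
    using g(2,3) by eventually_elim (simp only: diff_conv_add_uminus)
  then show ?thesis by (rule that[OF g(1,4)])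
qed

text \<open>Testing with f = B g for g in \<open>D\<close> shows that (I + s adj) d annihilates
  \<open>D\<close>. By density and Hoelder it annihilates L^p, so it is 0 almost everywhere, and
  then so is d.\<close>

lemma orthogonal_imp_zero:
  assumes s: "0 \<le> s" "s * (2 * ker_mass (2 * R)) \<le> 1 / 4" and d: "d \<in> Lp q S" and zero: "0 \<in> S"
    and orth: "\<And>f. f \<in> C_segments p n a b \<Longrightarrow>
      pairing S (\<lambda>x. of_real s * f x - truncated_generator A \<gamma> \<nu> S f x) d = 0"
  shows "AE x in N. d x = 0"
proof -
  interpret T: schur_kernel N "\<lambda>x y. ker y x" "ker_mass (2 * R)" by (rule K.transpose)
  have dL: "d \<in> Lspace q N" using d by (simp add: Lp_eq_Lspace)
  define w where "w x = d x + of_real s * adj d x" for x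
  have wL: "w \<in> Lspace q N"
    unfolding w_def using pq(2) by (intro Lspace_add Lspace_mult dL T.kernel_op_Lspace(2)[OF dL pq(2)]) simp
  have wcL: "(\<lambda>x. cnj (w x)) \<in> Lspace q N" by (rule Lspace_cnj[OF wL])
  have H: "integrable N (\<lambda>x. u x * cnj (w x))"
    "norm (LINT x|N. u x * cnj (w x)) \<le> Lp_norm p S u * (LINT x|N. norm (cnj (w x)) powr q) powr (1 / q)"
    if "u \<in> Lp p S" for u
    using that wcL pq unfolding Lp_norm_def
    by (intro Holder_integral; auto simp: Lp_eq_Lspace Lspace_def)+
  have D0: "(LINT x|N. g x * cnj (w x)) = 0" if g: "g \<in> D" for g
  proof -
    have "AE x in N. of_real s * B g x - truncated_generator A \<gamma> \<nu> S (B g) x = of_real s * B g x + g x"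
      using D_eq[OF g] by eventually_elim (simp only: diff_conv_add_uminus)
    from pairing_shifted(1)[OF D_Lp[OF g] d this] orth[OF D_range[OF g]]
    show ?thesis by (simp add: w_def)
  qed
  have "(LINT x|N. u x * cnj (w x)) = 0" if u: "u \<in> Lspace p N" for u
  proof -
    have uL: "u \<in> Lp p S" using u by (simp add: Lp_eq_Lspace)
    define c where "c = (LINT x|N. norm (cnj (w x)) powr q) powr (1 / q)"
    have c: "0 \<le> c" by (simp add: c_def)
    have "norm (LINT x|N. u x * cnj (w x)) \<le> 0"
    proof (rule field_le_epsilon)
      fix e :: real assume e: "0 < e"
      obtain g where g: "g \<in> D" "Lp_norm p S (\<lambda>x. u x - g x) < e / (c + 1)"
        using D_dense[OF uL, of "e / (c + 1)"] c e by auto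
      have L: "(\<lambda>x. u x - g x) \<in> Lp p S"
        using Lp_lincomb[OF uL D_Lp[OF g(1)] pq(1), of 1 "- 1"] by simp
      have "(LINT x|N. u x * cnj (w x)) = (LINT x|N. u x * cnj (w x)) - (LINT x|N. g x * cnj (w x))"
        using D0[OF g(1)] by simp
      also have "\<dots> = (LINT x|N. (u x - g x) * cnj (w x))"
        using H(1)[OF uL] H(1)[OF D_Lp[OF g(1)]] by (simp add: left_diff_distrib)
      also have "norm \<dots> \<le> Lp_norm p S (\<lambda>x. u x - g x) * c"
        unfolding c_def by (rule H(2)[OF L])
      also have "\<dots> \<le> e / (c + 1) * c" using g(2) c by (intro mult_right_mono) auto
      also have "\<dots> \<le> e" using c e by (simp add: divide_le_eq mult_left_mono)
      finally show "norm (LINT x|N. u x * cnj (w x)) \<le> 0 + e" by simp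
    qed
    then show ?thesis by simp
  qed
  from Lspace_pairing_nondegenerate[OF wL pq this]
  have "AE x in N. d x + of_real s * adj d x = 0" by (simp add: w_def)
  then show ?thesis by (rule T.neumann_unique[OF pq(2) s dL])
qed

section \<open>Bounded inverse of the shifted adjoint\<close>

lemma boundedly_invertible_shift:
  assumes s: "0 \<le> s" "s * (2 * ker_mass (2 * R)) \<le> 1 / 4"
  shows "boundedly_invertible q S (\<lambda>f x. f x + of_real s * adjoint_kernel_operator S \<Phi> f x)"
proof -
  interpret T: schur_kernel N "\<lambda>x y. ker y x" "ker_mass (2 * R)" by (rule K.transpose)
  let ?T = "\<lambda>f x. f x + of_real s * adjoint_kernel_operator S \<Phi> f x"
  have Teq: "?T f x = f x + of_real s * adj f x" if "f \<in> Lp q S" "x \<in> S" for f x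
    using adjoint_eq[of f x] that by (simp add: Lp_def)
  have TL: "?T f \<in> Lp q S" if f: "f \<in> Lp q S" for f
  proof -
    have fL: "f \<in> Lspace q N" using f by (simp add: Lp_eq_Lspace)
    have "(\<lambda>x. f x + of_real s * adj f x) \<in> Lspace q N"
      using pq(2) by (intro Lspace_add Lspace_mult fL T.kernel_op_Lspace(2)[OF fL pq(2)]) simp
    then show ?thesis
      unfolding Lp_eq_Lspace by (subst Lspace_cong[where v = "\<lambda>x. f x + of_real s * adj f x"]) (use Teq[OF f] in auto)
  qed
  have uniq: "eq_ae S g f" if f: "f \<in> Lp q S" and g: "g \<in> Lp q S" and e: "eq_ae S (?T g) (?T f)" for f g
  proof -
    have L: "f \<in> Lspace q N" "g \<in> Lspace q N" using f g by (simp_all add: Lp_eq_Lspace)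
    have dL: "(\<lambda>x. g x - f x) \<in> Lspace q N" using pq(2) by (intro Lspace_diff L) simp
    have "AE x in N. (g x - f x) + of_real s * adj (\<lambda>x. g x - f x) x = 0"
      using e[unfolded eq_ae_def] T.kernel_op_Lspace(1)[OF L(1) pq(2)] T.kernel_op_Lspace(1)[OF L(2) pq(2)] AE_space
    proof eventually_elim
      case (elim x)
      have *: "adj (\<lambda>x. g x - f x) x = adj g x - adj f x"
        unfolding kernel_op_def right_diff_distrib using elim(2,3) by simp
      have "x \<in> S" using elim(4) by simp
      then have "g x + of_real s * adj g x = f x + of_real s * adj f x"
        using elim(1) Teq[OF f] Teq[OF g] by (simp only:)
      then show ?case unfolding * right_diff_distrib add_diff_add[symmetric] by simp
    qed
    from T.neumann_unique[OF pq(2) s dL this] show ?thesis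
      unfolding eq_ae_def by eventually_elim simp
  qed
  have ex: "\<exists>f\<in>Lp q S. eq_ae S (?T f) h \<and> (LINT x|N. norm (f x) powr q) \<le> 2 powr (q + 1) * (LINT x|N. norm (h x) powr q)"
    if h: "h \<in> Lp q S" for h
  proof -
    obtain f where f: "f \<in> Lspace q N" "AE x in N. f x + of_real s * adj f x = h x"
      "(LINT x|N. norm (f x) powr q) \<le> 2 powr (q + 1) * (LINT x|N. norm (h x) powr q)"
      using T.neumann_exists[OF pq(2) s, of h] h by (auto simp: Lp_eq_Lspace)
    have fL: "f \<in> Lp q S" using f(1) by (simp add: Lp_eq_Lspace)
    have "eq_ae S (?T f) h"
      unfolding eq_ae_def using f(2) AE_space
    proof eventually_elim
      case (elim x)
      then have "x \<in> S" by simp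
      from Teq[OF fL this] elim(1) show ?case by (simp only:)
    qed
    then show ?thesis using fL f(3) by blast
  qed
  have trans: "eq_ae S u w" if "eq_ae S u v" "eq_ae S w v" for u v w
    using that unfolding eq_ae_def by eventually_elim simp
  have inv: "\<exists>f\<in>Lp q S. eq_ae S (?T f) h \<and> (\<forall>g\<in>Lp q S. eq_ae S (?T g) h \<longrightarrow> eq_ae S g f)" if h: "h \<in> Lp q S" for h
  proof -
    obtain f where f: "f \<in> Lp q S" "eq_ae S (?T f) h" using ex[OF h] by blast
    have "eq_ae S g f" if "g \<in> Lp q S" "eq_ae S (?T g) h" for g
      by (rule uniq[OF f(1) that(1) trans[OF that(2) f(2)]])
    then show ?thesis using f by blast
  qed
  have bound: "Lp_norm q S f \<le> (2 powr (q + 1)) powr (1 / q) * Lp_norm q S (?T f)" if f: "f \<in> Lp q S" for f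
  proof -
    \<comment> \<open>The Neumann solution for the right-hand side \<open>?T f\<close> comes with a
      norm bound; by uniqueness it is f itself, so the bound passes to f.\<close>
    obtain f' where f': "f' \<in> Lp q S" "eq_ae S (?T f') (?T f)"
      "(LINT x|N. norm (f' x) powr q) \<le> 2 powr (q + 1) * (LINT x|N. norm (?T f x) powr q)"
      using ex[OF TL[OF f]] by blast
    have "eq_ae S f' f" by (rule uniq[OF f f'(1,2)])
    then have "(LINT x|N. norm (f x) powr q) = (LINT x|N. norm (f' x) powr q)"
      unfolding eq_ae_def using f f'(1)
      by (intro integral_cong_AE) (auto simp: Lp_def elim!: eventually_mono)
    then have "(LINT x|N. norm (f x) powr q) \<le> 2 powr (q + 1) * (LINT x|N. norm (?T f x) powr q)"
      using f'(3) by simp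
    then have "(LINT x|N. norm (f x) powr q) powr (1 / q) \<le> (2 powr (q + 1) * (LINT x|N. norm (?T f x) powr q)) powr (1 / q)"
      using pq(2) by (intro powr_mono2) auto
    then show ?thesis by (simp only: Lp_norm_def powr_mult)
  qed
  show ?thesis
    unfolding boundedly_invertible_def using TL inv bound by blast
qed

end

theorem theorem5p2:
  fixes M :: "'w measure" and X :: "real \<Rightarrow> 'w \<Rightarrow> real"
    and A \<gamma> :: real and \<nu> :: "real measure"
    and n :: nat and a b :: "nat \<Rightarrow> real" and \<Delta> :: "real set"
    and p q :: real
    and D :: "(real \<Rightarrow> complex) set"
    and B :: "(real \<Rightarrow> complex) \<Rightarrow> real \<Rightarrow> complex"
    and \<Phi> :: "real \<Rightarrow> real \<Rightarrow> real"
  assumes "levy_process M X A \<gamma> \<nu>"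
    and "continuous_levy_density M X A \<gamma> \<nu>"
    and "disjoint_segments n a b" and "\<Delta> = segment_union n a b" and "0 \<in> \<Delta>"
    and "1 < p" and "1 < q" and "1 / p + 1 / q = 1"
    and "quasi_potential A \<gamma> \<nu> p n a b D B"
    and "regular_operator p n a b B \<Phi>"
  shows "\<exists>s0>0. \<forall>s. 0 \<le> s \<and> s < s0 \<longrightarrow>
     boundedly_invertible q \<Delta> (\<lambda>f x. f x + of_real s * adjoint_kernel_operator \<Delta> \<Phi> f x) \<and>
     (\<exists>\<psi>\<in>Lp q \<Delta>.
        (\<forall>f\<in>C_segments p n a b.
           pairing \<Delta> (\<lambda>x. of_real s * f x - truncated_generator A \<gamma> \<nu> \<Delta> f x) \<psi> = f 0) \<and>
        eq_ae \<Delta> (\<lambda>x. \<psi> x + of_real s * adjoint_kernel_operator \<Delta> \<Phi> \<psi> x) (\<lambda>x. of_real (\<Phi> 0 x)) \<and>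
        (\<forall>\<eta>\<in>Lp q \<Delta>.
           (\<forall>f\<in>C_segments p n a b.
              pairing \<Delta> (\<lambda>x. of_real s * f x - truncated_generator A \<gamma> \<nu> \<Delta> f x) \<eta> = f 0) \<longrightarrow>
           eq_ae \<Delta> \<eta> \<psi>))"
proof -
  have cpt: "compact \<Delta>" unfolding assms(4) by (rule segment_union_compact)
  obtain R where R: "0 < R" "\<Delta> \<subseteq> {- R..R}"
  proof -
    obtain R where "0 < R" "\<And>x. x \<in> \<Delta> \<Longrightarrow> norm x \<le> R"
      using compact_imp_bounded[OF cpt] unfolding bounded_pos by blast
    then show ?thesis using that[of R] by (force simp: abs_le_iff)
  qed
  interpret regular_quasi_potential \<Delta> R A \<gamma> \<nu> p q n a b B \<Phi> D
  proof unfold_locales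
    show "levy_triple A \<nu>" using assms(1) by (simp add: levy_process_def)
    show "levy_exponent A \<gamma> \<nu> (- (1 / R)) \<noteq> 0"
      using R(1) by (intro levy_exponent_nonzero[OF assms(1,2)]) simp
  qed (use cpt R assms in auto)
  interpret T: schur_kernel N "\<lambda>x y. ker y x" "ker_mass (2 * R)" by (rule K.transpose)
  \<comment> \<open>Chosen so that s0 times 2 (C + 1) is exactly 1 / 4, with C the Schur constant;
    the summand 1 covers C = 0.\<close>
  define s0 where "s0 = 1 / (8 * (ker_mass (2 * R) + 1))"
  have s0: "0 < s0" using K.C_nonneg by (simp add: s0_def)
  show ?thesis
  proof (intro exI[of _ s0] conjI s0 allI impI; (elim conjE)?)
    fix s :: real assume s: "0 \<le> s" "s < s0"
    have "s * (2 * ker_mass (2 * R)) \<le> s0 * (2 * (ker_mass (2 * R) + 1))"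
      using s K.C_nonneg by (intro mult_mono) auto
    also have "\<dots> = 1 / 4" using K.C_nonneg by (simp add: s0_def field_simps)
    finally have sC: "s * (2 * ker_mass (2 * R)) \<le> 1 / 4" .
    show "boundedly_invertible q \<Delta> (\<lambda>f x. f x + of_real s * adjoint_kernel_operator \<Delta> \<Phi> f x)"
      by (rule boundedly_invertible_shift[OF s(1) sC])
    obtain \<psi> where \<psi>: "\<psi> \<in> Lspace q N" "AE x in N. \<psi> x + of_real s * adj \<psi> x = of_real (\<Phi> 0 x)"
      using T.neumann_exists[OF pq(2) s(1) sC Phi_Lspace[OF assms(5)]] by blast
    have \<psi>L: "\<psi> \<in> Lp q \<Delta>" using \<psi>(1) by (simp add: Lp_eq_Lspace)
    let ?v = "\<lambda>f x. of_real s * f x - truncated_generator A \<gamma> \<nu> \<Delta> f x"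
    have sol: "pairing \<Delta> (?v f) \<psi> = f 0" if f: "f \<in> C_segments p n a b" for f
    proof -
      obtain g where g: "g \<in> Lp p \<Delta>" "B g 0 = f 0" "AE x in N. ?v f x = of_real s * B g x + g x"
        using C_segments_shifted[OF f assms(5)] by blast
      \<comment> \<open>With f = B g the left side tests sB g + g. Transposing, the equation for
        \<psi> leaves the integral of g against \<Phi> at 0, which is B g 0 = f 0.\<close>
      have "pairing \<Delta> (?v f) \<psi> = (LINT x|N. g x * cnj (\<psi> x + of_real s * adj \<psi> x))"
        by (rule pairing_shifted(1)[OF g(1) \<psi>L g(3)])
      also have "\<dots> = (LINT x|N. of_real (\<Phi> 0 x) * g x)"
      proof (rule integral_cong_AE)
        show "AE x in N. g x * cnj (\<psi> x + of_real s * adj \<psi> x) = of_real (\<Phi> 0 x) * g x"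
          using \<psi>(2) by eventually_elim (simp add: mult.commute)
        show "(\<lambda>x. of_real (\<Phi> 0 x) * g x) \<in> borel_measurable N"
          using regD(2)[OF g(1) assms(5)] by (rule borel_measurable_integrable)
        have "(\<lambda>x. \<psi> x + of_real s * adj \<psi> x) \<in> borel_measurable N"
          by (intro borel_measurable_add borel_measurable_times borel_measurable_const
              Lspace_measurable[OF \<psi>(1)] T.kernel_op_measurable)
        then show "(\<lambda>x. g x * cnj (\<psi> x + of_real s * adj \<psi> x)) \<in> borel_measurable N"
          using g(1) by (intro borel_measurable_times measurable_compose[OF _ cnj_borel]) (simp_all add: Lp_def)
      qed
      also have "\<dots> = f 0" using regD(3)[OF g(1) assms(5)] g(2) by simp
      finally show ?thesis .
    qed
    have eq: "eq_ae \<Delta> (\<lambda>x. \<psi> x + of_real s * adjoint_kernel_operator \<Delta> \<Phi> \<psi> x) (\<lambda>x. of_real (\<Phi> 0 x))"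
      unfolding eq_ae_def using \<psi>(2) AE_space
      by eventually_elim (use adjoint_eq[OF Lspace_measurable[OF \<psi>(1)]] in simp)
    have uniq: "eq_ae \<Delta> \<eta> \<psi>"
      if \<eta>: "\<eta> \<in> Lp q \<Delta>" and sol\<eta>: "\<forall>f\<in>C_segments p n a b. pairing \<Delta> (?v f) \<eta> = f 0" for \<eta>
    proof -
      have dL: "(\<lambda>x. 1 * \<eta> x + (- 1) * \<psi> x) \<in> Lp q \<Delta>" by (rule Lp_lincomb[OF \<eta> \<psi>L pq(2)])
      have "pairing \<Delta> (?v f) (\<lambda>x. 1 * \<eta> x + (- 1) * \<psi> x) = 0" if f: "f \<in> C_segments p n a b" for f
      proof -
        obtain g where g: "g \<in> Lp p \<Delta>" "AE x in N. ?v f x = of_real s * B g x + g x"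
          using C_segments_shifted[OF f assms(5)] by blast
        have vL: "?v f \<in> Lspace p N" by (rule pairing_shifted(2)[OF g(1) \<psi>L g(2)])
        have H: "integrable N (\<lambda>x. ?v f x * cnj (z x))" if "z \<in> Lp q \<Delta>" for z
          using vL Lspace_cnj[of z q N] that pq
          by (intro Holder_integral(1)) (auto simp: Lspace_def Lp_eq_Lspace)
        have "pairing \<Delta> (?v f) (\<lambda>x. 1 * \<eta> x + (- 1) * \<psi> x) = (LINT x|N. ?v f x * cnj (\<eta> x) - ?v f x * cnj (\<psi> x))"
          unfolding pairing_def by (intro Bochner_Integration.integral_cong refl) (simp add: right_diff_distrib)
        also have "\<dots> = pairing \<Delta> (?v f) \<eta> - pairing \<Delta> (?v f) \<psi>"
          unfolding pairing_def by (rule Bochner_Integration.integral_diff[OF H[OF \<eta>] H[OF \<psi>L]])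
        finally show ?thesis using sol[OF f] sol\<eta> f by simp
      qed
      then have "AE x in N. 1 * \<eta> x + (- 1) * \<psi> x = 0"
        by (rule orthogonal_imp_zero[OF s(1) sC dL assms(5)])
      then show ?thesis unfolding eq_ae_def by eventually_elim simp
    qed
    show "\<exists>\<psi>\<in>Lp q \<Delta>.
        (\<forall>f\<in>C_segments p n a b. pairing \<Delta> (?v f) \<psi> = f 0) \<and>
        eq_ae \<Delta> (\<lambda>x. \<psi> x + of_real s * adjoint_kernel_operator \<Delta> \<Phi> \<psi> x) (\<lambda>x. of_real (\<Phi> 0 x)) \<and>
        (\<forall>\<eta>\<in>Lp q \<Delta>. (\<forall>f\<in>C_segments p n a b. pairing \<Delta> (?v f) \<eta> = f 0) \<longrightarrow> eq_ae \<Delta> \<eta> \<psi>)"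
      using \<psi>L sol eq uniq by blast
  qed
qed

end
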